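(* Let $\mathsf{C}$ be a cocomplete category, and let $D:\mathsf{J}\to\mathsf{C}$ and $D':\mathsf{K}\to\mathsf{C}$ be small diagrams. There is a bijection between partial evaluations of colimits from $D$ to $D'$ (for the monad $\mathsf{Diag}$) and split opfibrations $F:\mathsf{J}\to\mathsf{K}$ exhibiting $D'$ as a (pointwise) left Kan extension of $D$ along $F$.
   Context: A cocomplete category is a (possibly large) locally small category admitting all small colimits. For a locally small category $\mathsf{C}$, $\mathsf{Diag}(\mathsf{C})$ is the category whose objects are small diagrams $(\mathsf{J},D)$, i.e. a small category $\mathsf{J}$ with a functor $D:\mathsf{J}\to\mathsf{C}$, and whose morphisms $(\mathsf{J},D)\to(\mathsf{J}',D')$ are pairs $(R,\rho)$ of a functor $R:\mathsf{J}\to\mathsf{J}'$ and a natural transformation $\rho:D\Rightarrow D'\circ R$. An object $E$ of $\mathsf{Diag}(\mathsf{Diag}(\mathsf{C}))$ is a functor $E:\mathsf{I}\to\mathsf{Diag}(\mathsf{C})$ with $\mathsf{I}$ small; write $E(I)=(E_0I,\,E_1I:E_0I\to\mathsf{C})$ and, for $i:I\to I'$, $E(i)=(E_0i:E_0I\to E_0I',\;E_1i:E_1I\Rightarrow E_1I'\circ E_0i)$. The multiplication $\mu:\mathsf{Diag}(\mathsf{Diag}(\mathsf{C}))\to\mathsf{Diag}(\mathsf{C})$ of the pseudomonad $\mathsf{Diag}$ sends $E$ to the diagram whose domain is the Grothendieck construction $\int E_0$ of $E_0:\mathsf{I}\to\mathsf{Cat}$ (objects $(I,X)$ with $X\in E_0I$;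 morphisms $(i,f):(I,X)\to(I',X')$ with $i:I\to I'$ and $f:E_0i(X)\to X'$), given by $\mu(E)(I,X)=E_1I(X)$ and $\mu(E)(i,f)=E_1I'(f)\circ(E_1i)_X$. For $\mathsf{C}$ cocomplete, $c:\mathsf{Diag}(\mathsf{C})\to\mathsf{C}$ is the functor given by a choice of colimit for each small diagram (acting on morphisms by the induced maps between colimits), and $c_*:\mathsf{Diag}(\mathsf{Diag}(\mathsf{C}))\to\mathsf{Diag}(\mathsf{C})$ is postcomposition with $c$. A partial evaluation from $D$ to $D'$ for the monad $\mathsf{Diag}$ (a partial evaluation of colimits) is an object $E$ of $\mathsf{Diag}(\mathsf{Diag}(\mathsf{C}))$ such that $\mu(E)\cong D$ and $c_*E\cong D'$. That $F$ exhibits $D'$ as a (pointwise) left Kan extension of $D$ along $F$ means that $D'\cong\mathrm{Lan}_F D$, with universal natural transformation $\lambda:D\Rightarrow D'\circ F$.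
   Formalization: A partial evaluation here includes the isomorphisms μ(E)≅D and c_*E≅D' as data and is taken up to compatible isomorphism of E; a split opfibration includes its splitting and λ. For bare objects E the bijection fails (C terminal, J=K two points: 4 functors F, 2 classes of E). *)

theory Defs
  imports "HOL-Library.Equipollence" "HOL-Library.FuncSet"
begin

text \<open>
  Size convention.  A type \<open>'u\<close> plays the role of a Grothendieck universe: a set is
  small if it has fewer elements than \<open>'u\<close>, written \<open>A \<prec> (UNIV :: 'u set)\<close>.  For
  \<open>'u\<close> of inaccessible cardinality this is smallness with respect to that universe; the inequality
  is strict because a category with coproducts indexed by \<open>'u\<close> and hom-sets no larger than
  \<open>'u\<close> is a preorder.
  Small categories have their objects and arrows in \<open>'u\<close>; the objects and arrows of the
  large category \<open>C\<close> live in arbitrary types.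
\<close>


section \<open>Categories, functors, natural transformations\<close>

record ('o, 'a) cat =
  ob :: "'o set"
  ar :: "'a set"
  src :: "'a \<Rightarrow> 'o"
  tgt :: "'a \<Rightarrow> 'o"
  idt :: "'o \<Rightarrow> 'a"
  cmp :: "'a \<Rightarrow> 'a \<Rightarrow> 'a"  \<comment> \<open>\<open>cmp C g f\<close> is \<open>g \<circ> f\<close>\<close>

definition hom :: "('o, 'a) cat \<Rightarrow> 'o \<Rightarrow> 'o \<Rightarrow> 'a set" where
  "hom C x y = {f \<in> ar C. src C f = x \<and> tgt C f = y}"

locale category =
  fixes C :: "('o, 'a) cat"
  assumes src_ob: "f \<in> ar C \<Longrightarrow> src C f \<in> ob C"
    and tgt_ob: "f \<in> ar C \<Longrightarrow> tgt C f \<in> ob C"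
    and idt_hom: "x \<in> ob C \<Longrightarrow> idt C x \<in> hom C x x"
    and cmp_hom: "\<lbrakk>f \<in> ar C; g \<in> ar C; tgt C f = src C g\<rbrakk> \<Longrightarrow> cmp C g f \<in> hom C (src C f) (tgt C g)"
    and cmp_idt_right: "f \<in> ar C \<Longrightarrow> cmp C f (idt C (src C f)) = f"
    and cmp_idt_left: "f \<in> ar C \<Longrightarrow> cmp C (idt C (tgt C f)) f = f"
    and cmp_assoc: "\<lbrakk>f \<in> ar C; g \<in> ar C; h \<in> ar C; tgt C f = src C g; tgt C g = src C h\<rbrakk> \<Longrightarrow>
      cmp C h (cmp C g f) = cmp C (cmp C h g) f"

record ('o, 'a, 'p, 'b) ftr =
  omap :: "'o \<Rightarrow> 'p"
  amap :: "'a \<Rightarrow> 'b"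

definition is_functor :: "('o, 'a) cat \<Rightarrow> ('p, 'b) cat \<Rightarrow> ('o, 'a, 'p, 'b) ftr \<Rightarrow> bool" where
  "is_functor A B F \<longleftrightarrow> category A \<and> category B \<and>
     (\<forall>x \<in> ob A. omap F x \<in> ob B) \<and>
     (\<forall>f \<in> ar A. amap F f \<in> hom B (omap F (src A f)) (omap F (tgt A f))) \<and>
     (\<forall>x \<in> ob A. amap F (idt A x) = idt B (omap F x)) \<and>
     (\<forall>f \<in> ar A. \<forall>g \<in> ar A. tgt A f = src A g \<longrightarrow>
        amap F (cmp A g f) = cmp B (amap F g) (amap F f))"

definition id_ftr :: "('o, 'a, 'o, 'a) ftr" where
  "id_ftr = \<lparr>omap = (\<lambda>x. x), amap = (\<lambda>f. f)\<rparr>"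

definition comp_ftr :: "('p, 'b, 'q, 'c) ftr \<Rightarrow> ('o, 'a, 'p, 'b) ftr \<Rightarrow> ('o, 'a, 'q, 'c) ftr" where
  "comp_ftr G F = \<lparr>omap = (\<lambda>x. omap G (omap F x)), amap = (\<lambda>f. amap G (amap F f))\<rparr>"

text \<open>Functors out of \<open>A\<close> are only meaningful on \<open>ob A\<close> and \<open>ar A\<close>; the
  extensional ones, which are \<open>undefined\<close> elsewhere, are canonical representatives.\<close>

definition restrict_ftr :: "('o, 'a) cat \<Rightarrow> ('o, 'a, 'p, 'b) ftr \<Rightarrow> ('o, 'a, 'p, 'b) ftr" where
  "restrict_ftr A F = \<lparr>omap = restrict (omap F) (ob A), amap = restrict (amap F) (ar A)\<rparr>"

definition nat_trans ::
  "('o, 'a) cat \<Rightarrow> ('p, 'b) cat \<Rightarrow> ('o, 'a, 'p, 'b) ftr \<Rightarrow> ('o, 'a, 'p, 'b) ftr \<Rightarrow> ('o \<Rightarrow> 'b) \<Rightarrow> bool" where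
  "nat_trans A B F G t \<longleftrightarrow> is_functor A B F \<and> is_functor A B G \<and>
     (\<forall>x \<in> ob A. t x \<in> hom B (omap F x) (omap G x)) \<and>
     (\<forall>f \<in> ar A. cmp B (t (tgt A f)) (amap F f) = cmp B (amap G f) (t (src A f)))"

definition is_iso :: "('o, 'a) cat \<Rightarrow> 'a \<Rightarrow> bool" where
  "is_iso C f \<longleftrightarrow> f \<in> ar C \<and>
     (\<exists>g \<in> hom C (tgt C f) (src C f). cmp C g f = idt C (src C f) \<and> cmp C f g = idt C (tgt C f))"


section \<open>Diagrams and the category \<open>Diag(C)\<close>\<close>

record ('i, 'k, 'o, 'a) diagram =
  shape :: "('i, 'k) cat"
  dgm :: "('i, 'k, 'o, 'a) ftr"

definition is_diagram :: "('o, 'a) cat \<Rightarrow> ('i, 'k, 'o, 'a) diagram \<Rightarrow> bool" where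
  "is_diagram C D \<longleftrightarrow> is_functor (shape D) C (dgm D)"

definition small_diagram :: "('o, 'a) cat \<Rightarrow> ('u, 'u, 'o, 'a) diagram \<Rightarrow> bool" where
  "small_diagram C D \<longleftrightarrow> is_diagram C D \<and>
     ob (shape D) \<prec> (UNIV :: 'u set) \<and> ar (shape D) \<prec> (UNIV :: 'u set)"

record ('i, 'k, 'j, 'l, 'a) diag_mor =
  fun_part :: "('i, 'k, 'j, 'l) ftr"
  nat_part :: "'i \<Rightarrow> 'a"

text \<open>Morphisms are defined between diagrams over possibly different types, because
  \<open>\<mu>(E)\<close> below is indexed by pairs.\<close>

definition is_diag_mor ::
  "('o, 'a) cat \<Rightarrow> ('i, 'k, 'o, 'a) diagram \<Rightarrow> ('j, 'l, 'o, 'a) diagram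
     \<Rightarrow> ('i, 'k, 'j, 'l, 'a) diag_mor \<Rightarrow> bool" where
  "is_diag_mor C D D' m \<longleftrightarrow> is_functor (shape D) (shape D') (fun_part m) \<and>
     nat_trans (shape D) C (dgm D) (comp_ftr (dgm D') (fun_part m)) (nat_part m)"

definition id_mor :: "('o, 'a) cat \<Rightarrow> ('i, 'k, 'o, 'a) diagram \<Rightarrow> ('i, 'k, 'i, 'k, 'a) diag_mor" where
  "id_mor C D = \<lparr>fun_part = id_ftr, nat_part = (\<lambda>x. idt C (omap (dgm D) x))\<rparr>"

definition comp_mor ::
  "('o, 'a) cat \<Rightarrow> ('j, 'l, 'p, 'q, 'a) diag_mor \<Rightarrow> ('i, 'k, 'j, 'l, 'a) diag_mor
     \<Rightarrow> ('i, 'k, 'p, 'q, 'a) diag_mor" where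
  "comp_mor C n m = \<lparr>fun_part = comp_ftr (fun_part n) (fun_part m),
     nat_part = (\<lambda>x. cmp C (nat_part n (omap (fun_part m) x)) (nat_part m x))\<rparr>"

definition restrict_mor ::
  "('i, 'k, 'o, 'a) diagram \<Rightarrow> ('i, 'k, 'j, 'l, 'a) diag_mor \<Rightarrow> ('i, 'k, 'j, 'l, 'a) diag_mor" where
  "restrict_mor D m = \<lparr>fun_part = restrict_ftr (shape D) (fun_part m),
     nat_part = restrict (nat_part m) (ob (shape D))\<rparr>"

definition mor_eq ::
  "('i, 'k, 'o, 'a) diagram \<Rightarrow> ('i, 'k, 'j, 'l, 'a) diag_mor \<Rightarrow> ('i, 'k, 'j, 'l, 'a) diag_mor \<Rightarrow> bool" where
  "mor_eq D m n \<longleftrightarrow> restrict_mor D m = restrict_mor D n"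

definition is_diag_iso ::
  "('o, 'a) cat \<Rightarrow> ('i, 'k, 'o, 'a) diagram \<Rightarrow> ('j, 'l, 'o, 'a) diagram
     \<Rightarrow> ('i, 'k, 'j, 'l, 'a) diag_mor \<Rightarrow> bool" where
  "is_diag_iso C D D' m \<longleftrightarrow> is_diag_mor C D D' m \<and>
     (\<exists>n. is_diag_mor C D' D n \<and> mor_eq D (comp_mor C n m) (id_mor C D) \<and>
          mor_eq D' (comp_mor C m n) (id_mor C D'))"

type_synonym ('u, 'o, 'a) darrow =
  "('u, 'u, 'o, 'a) diagram \<times> ('u, 'u, 'u, 'u, 'a) diag_mor \<times> ('u, 'u, 'o, 'a) diagram"

abbreviation mor_of :: "('u, 'o, 'a) darrow \<Rightarrow> ('u, 'u, 'u, 'u, 'a) diag_mor" where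
  "mor_of a \<equiv> fst (snd a)"

text \<open>Arrows carry their source and target; the condition \<open>restrict_mor D m = m\<close> makes
  equality of arrows coincide with equality of the morphisms they represent.\<close>

definition diag_cat :: "('o, 'a) cat \<Rightarrow> (('u, 'u, 'o, 'a) diagram, ('u, 'o, 'a) darrow) cat" where
  "diag_cat C = \<lparr>
     ob = {D. small_diagram C D},
     ar = {(D, m, D'). small_diagram C D \<and> small_diagram C D' \<and>
                       is_diag_mor C D D' m \<and> restrict_mor D m = m},
     src = (\<lambda>(D, m, D'). D),
     tgt = (\<lambda>(D, m, D'). D'),
     idt = (\<lambda>D. (D, restrict_mor D (id_mor C D), D)),
     cmp = (\<lambda>(D', n, D'') (D, m, D'\<^sub>1). (D, restrict_mor D (comp_mor C n m), D''))\<rparr>"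


section \<open>Colimits and the functor \<open>c\<close>\<close>

definition is_cocone ::
  "('o, 'a) cat \<Rightarrow> ('i, 'k, 'o, 'a) diagram \<Rightarrow> 'o \<Rightarrow> ('i \<Rightarrow> 'a) \<Rightarrow> bool" where
  "is_cocone C D x l \<longleftrightarrow> is_diagram C D \<and> x \<in> ob C \<and>
     (\<forall>j \<in> ob (shape D). l j \<in> hom C (omap (dgm D) j) x) \<and>
     (\<forall>f \<in> ar (shape D). cmp C (l (tgt (shape D) f)) (amap (dgm D) f) = l (src (shape D) f))"

definition is_colimit ::
  "('o, 'a) cat \<Rightarrow> ('i, 'k, 'o, 'a) diagram \<Rightarrow> 'o \<Rightarrow> ('i \<Rightarrow> 'a) \<Rightarrow> bool" where
  "is_colimit C D x l \<longleftrightarrow> is_cocone C D x l \<and>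
     (\<forall>y m. is_cocone C D y m \<longrightarrow>
        (\<exists>!h. h \<in> hom C x y \<and> (\<forall>j \<in> ob (shape D). cmp C h (l j) = m j)))"

definition cocomplete :: "'u itself \<Rightarrow> ('o, 'a) cat \<Rightarrow> bool" where
  "cocomplete (_ :: 'u itself) C \<longleftrightarrow> category C \<and>
     (\<forall>x \<in> ob C. \<forall>y \<in> ob C. hom C x y \<prec> (UNIV :: 'u set)) \<and>
     (\<forall>D :: ('u, 'u, 'o, 'a) diagram. small_diagram C D \<longrightarrow> (\<exists>x l. is_colimit C D x l))"

type_synonym ('u, 'o, 'a) colimits = "('u, 'u, 'o, 'a) diagram \<Rightarrow> 'o \<times> ('u \<Rightarrow> 'a)"

definition colimit_choice :: "('o, 'a) cat \<Rightarrow> ('u, 'o, 'a) colimits \<Rightarrow> bool" where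
  "colimit_choice C c \<longleftrightarrow> (\<forall>D. small_diagram C D \<longrightarrow> is_colimit C D (fst (c D)) (snd (c D)))"

definition colim_ftr ::
  "('o, 'a) cat \<Rightarrow> ('u, 'o, 'a) colimits
     \<Rightarrow> (('u, 'u, 'o, 'a) diagram, ('u, 'o, 'a) darrow, 'o, 'a) ftr" where
  "colim_ftr C c = \<lparr>
     omap = (\<lambda>D. fst (c D)),
     amap = (\<lambda>(D, m, D'). THE h. h \<in> hom C (fst (c D)) (fst (c D')) \<and>
       (\<forall>j \<in> ob (shape D). cmp C h (snd (c D) j) =
          cmp C (snd (c D') (omap (fun_part m) j)) (nat_part m j)))\<rparr>"


section \<open>\<open>Diag(Diag(C))\<close>, the multiplication \<open>\<mu>\<close>, and \<open>c\<^sub>*\<close>\<close>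

type_synonym ('u, 'o, 'a) ddiagram =
  "('u, 'u, ('u, 'u, 'o, 'a) diagram, ('u, 'o, 'a) darrow) diagram"

type_synonym ('u, 'o, 'a) ddarrow =
  "('u, ('u, 'u, 'o, 'a) diagram, ('u, 'o, 'a) darrow) darrow"

abbreviation E0_ob :: "('u, 'o, 'a) ddiagram \<Rightarrow> 'u \<Rightarrow> ('u, 'u) cat" where
  "E0_ob E x \<equiv> shape (omap (dgm E) x)"

abbreviation E1_ob :: "('u, 'o, 'a) ddiagram \<Rightarrow> 'u \<Rightarrow> ('u, 'u, 'o, 'a) ftr" where
  "E1_ob E x \<equiv> dgm (omap (dgm E) x)"

abbreviation E0_ar :: "('u, 'o, 'a) ddiagram \<Rightarrow> 'u \<Rightarrow> ('u, 'u, 'u, 'u) ftr" where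
  "E0_ar E i \<equiv> fun_part (mor_of (amap (dgm E) i))"

abbreviation E1_ar :: "('u, 'o, 'a) ddiagram \<Rightarrow> 'u \<Rightarrow> 'u \<Rightarrow> 'a" where
  "E1_ar E i \<equiv> nat_part (mor_of (amap (dgm E) i))"

text \<open>An arrow \<open>(i, f) : (x, y) \<rightarrow> (x', y')\<close> of the Grothendieck construction is encoded as
  \<open>((x, y), (i, f), (x', y'))\<close>, since \<open>y\<close> cannot be recovered from \<open>(i, f)\<close>.\<close>

definition grothendieck ::
  "('i, 'k) cat \<Rightarrow> ('i \<Rightarrow> ('j, 'l) cat) \<Rightarrow> ('k \<Rightarrow> ('j, 'l, 'j, 'l) ftr)
     \<Rightarrow> ('i \<times> 'j, ('i \<times> 'j) \<times> ('k \<times> 'l) \<times> ('i \<times> 'j)) cat" where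
  "grothendieck I S T = \<lparr>
     ob = {(x, y). x \<in> ob I \<and> y \<in> ob (S x)},
     ar = {((x, y), (i, f), (x', y')). i \<in> hom I x x' \<and> y \<in> ob (S x) \<and> y' \<in> ob (S x') \<and>
                                       f \<in> hom (S x') (omap (T i) y) y'},
     src = (\<lambda>(p, a, q). p),
     tgt = (\<lambda>(p, a, q). q),
     idt = (\<lambda>(x, y). ((x, y), (idt I x, idt (S x) y), (x, y))),
     cmp = (\<lambda>(q, (i', f'), (x'', y'')) (p, (i, f), q\<^sub>1).
              (p, (cmp I i' i, cmp (S x'') f' (amap (T i') f)), (x'', y'')))\<rparr>"

type_synonym ('u, 'o, 'a) mdiagram =
  "('u \<times> 'u, ('u \<times> 'u) \<times> ('u \<times> 'u) \<times> ('u \<times> 'u), 'o, 'a) diagram"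

definition mult :: "('o, 'a) cat \<Rightarrow> ('u, 'o, 'a) ddiagram \<Rightarrow> ('u, 'o, 'a) mdiagram" where
  "mult C E = \<lparr>
     shape = grothendieck (shape E) (E0_ob E) (E0_ar E),
     dgm = \<lparr>omap = (\<lambda>(x, y). omap (E1_ob E x) y),
            amap = (\<lambda>((x, y), (i, f), (x', y')). cmp C (amap (E1_ob E x') f) (E1_ar E i y))\<rparr>\<rparr>"

text \<open>The action of \<open>\<mu>\<close> on a morphism \<open>(A, \<alpha>) : E \<rightarrow> E'\<close>, where \<open>\<alpha>\<close> has components
  \<open>\<alpha>\<^sub>x : E(x) \<rightarrow> E'(A x)\<close> in \<open>Diag(C)\<close>.\<close>

definition mult_mor ::
  "('u, 'u, 'u, 'u, ('u, 'o, 'a) darrow) diag_mor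
     \<Rightarrow> ('u \<times> 'u, ('u \<times> 'u) \<times> ('u \<times> 'u) \<times> ('u \<times> 'u),
         'u \<times> 'u, ('u \<times> 'u) \<times> ('u \<times> 'u) \<times> ('u \<times> 'u), 'a) diag_mor" where
  "mult_mor m = (let
       A = fun_part m;
       \<alpha> = (\<lambda>x. mor_of (nat_part m x));
       P = (\<lambda>(x, y). (omap A x, omap (fun_part (\<alpha> x)) y))
     in \<lparr>fun_part = \<lparr>omap = P,
           amap = (\<lambda>(p, (i, f), q). (P p, (amap A i, amap (fun_part (\<alpha> (fst q))) f), P q))\<rparr>,
         nat_part = (\<lambda>(x, y). nat_part (\<alpha> x) y)\<rparr>)"

definition colim_push ::
  "('o, 'a) cat \<Rightarrow> ('u, 'o, 'a) colimits \<Rightarrow> ('u, 'o, 'a) ddiagram \<Rightarrow> ('u, 'u, 'o, 'a) diagram" where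
  "colim_push C c E = \<lparr>shape = shape E, dgm = comp_ftr (colim_ftr C c) (dgm E)\<rparr>"

definition colim_push_mor ::
  "('o, 'a) cat \<Rightarrow> ('u, 'o, 'a) colimits \<Rightarrow> ('u, 'u, 'u, 'u, ('u, 'o, 'a) darrow) diag_mor
     \<Rightarrow> ('u, 'u, 'u, 'u, 'a) diag_mor" where
  "colim_push_mor C c m = \<lparr>fun_part = fun_part m,
     nat_part = (\<lambda>x. amap (colim_ftr C c) (nat_part m x))\<rparr>"


section \<open>Partial evaluations\<close>

text \<open>A partial evaluation is an object \<open>E\<close> together with the isomorphisms
  \<open>\<phi> : \<mu>(E) \<cong> D\<close> and \<open>\<psi> : c\<^sub>* E \<cong> D'\<close>.  Two of them are identified when they are related by an
  isomorphism of \<open>Diag(Diag(C))\<close> compatible with these data.\<close>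

type_synonym ('u, 'o, 'a) peval =
  "('u, 'o, 'a) ddiagram
     \<times> ('u \<times> 'u, ('u \<times> 'u) \<times> ('u \<times> 'u) \<times> ('u \<times> 'u), 'u, 'u, 'a) diag_mor
     \<times> ('u, 'u, 'u, 'u, 'a) diag_mor"

definition partial_evals ::
  "('o, 'a) cat \<Rightarrow> ('u, 'o, 'a) colimits \<Rightarrow> ('u, 'u, 'o, 'a) diagram \<Rightarrow> ('u, 'u, 'o, 'a) diagram
     \<Rightarrow> ('u, 'o, 'a) peval set" where
  "partial_evals C c D D' = {(E, \<phi>, \<psi>). E \<in> ob (diag_cat (diag_cat C)) \<and>
     is_diag_iso C (mult C E) D \<phi> \<and> is_diag_iso C (colim_push C c E) D' \<psi>}"

definition peval_iso ::
  "('o, 'a) cat \<Rightarrow> ('u, 'o, 'a) colimits \<Rightarrow> ('u, 'u, 'o, 'a) diagram \<Rightarrow> ('u, 'u, 'o, 'a) diagram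
     \<Rightarrow> (('u, 'o, 'a) peval \<times> ('u, 'o, 'a) peval) set" where
  "peval_iso C c D D' = {((E, \<phi>, \<psi>), (E', \<phi>', \<psi>')).
     (E, \<phi>, \<psi>) \<in> partial_evals C c D D' \<and> (E', \<phi>', \<psi>') \<in> partial_evals C c D D' \<and>
     (\<exists>a :: ('u, 'o, 'a) ddarrow. is_iso (diag_cat (diag_cat C)) a \<and>
        a \<in> hom (diag_cat (diag_cat C)) E E' \<and>
        mor_eq (mult C E) (comp_mor C \<phi>' (mult_mor (mor_of a))) \<phi> \<and>
        mor_eq (colim_push C c E) (comp_mor C \<psi>' (colim_push_mor C c (mor_of a))) \<psi>)}"


section \<open>Pointwise left Kan extensions\<close>

definition left_kan ::
  "('o, 'a) cat \<Rightarrow> ('i, 'k, 'o, 'a) diagram \<Rightarrow> ('i, 'k, 'j, 'l) ftr \<Rightarrow> ('j, 'l, 'o, 'a) diagram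
     \<Rightarrow> ('i \<Rightarrow> 'a) \<Rightarrow> bool" where
  "left_kan C D F D' l \<longleftrightarrow> is_functor (shape D) (shape D') F \<and>
     nat_trans (shape D) C (dgm D) (comp_ftr (dgm D') F) l \<and>
     (\<forall>G g. nat_trans (shape D) C (dgm D) (comp_ftr G F) g \<and> is_functor (shape D') C G \<longrightarrow>
        (\<exists>!d. d \<in> extensional (ob (shape D')) \<and> nat_trans (shape D') C (dgm D') G d \<and>
              (\<forall>j \<in> ob (shape D). cmp C (d (omap F j)) (l j) = g j)))"

text \<open>The comma category \<open>F \<down> k\<close>: objects \<open>(j, u : F j \<rightarrow> k)\<close>, and arrows
  \<open>g : (j, u) \<rightarrow> (j', u')\<close> with \<open>u' \<circ> F g = u\<close>, again stored with source and target.\<close>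

definition comma ::
  "('i, 'k) cat \<Rightarrow> ('j, 'l) cat \<Rightarrow> ('i, 'k, 'j, 'l) ftr \<Rightarrow> 'j
     \<Rightarrow> ('i \<times> 'l, ('i \<times> 'l) \<times> 'k \<times> ('i \<times> 'l)) cat" where
  "comma J K F k = \<lparr>
     ob = {(j, u). j \<in> ob J \<and> u \<in> hom K (omap F j) k},
     ar = {((j, u), g, (j', u')). u \<in> hom K (omap F j) k \<and> u' \<in> hom K (omap F j') k \<and>
                                  g \<in> hom J j j' \<and> cmp K u' (amap F g) = u},
     src = (\<lambda>(p, g, q). p),
     tgt = (\<lambda>(p, g, q). q),
     idt = (\<lambda>(j, u). ((j, u), idt J j, (j, u))),
     cmp = (\<lambda>(q, g', r) (p, g, q\<^sub>1). (p, cmp J g' g, r))\<rparr>"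

definition comma_dgm ::
  "('i, 'k, 'o, 'a) diagram \<Rightarrow> ('j, 'l) cat \<Rightarrow> ('i, 'k, 'j, 'l) ftr \<Rightarrow> 'j
     \<Rightarrow> ('i \<times> 'l, ('i \<times> 'l) \<times> 'k \<times> ('i \<times> 'l), 'o, 'a) diagram" where
  "comma_dgm D K F k = \<lparr>shape = comma (shape D) K F k,
     dgm = comp_ftr (dgm D) \<lparr>omap = fst, amap = (\<lambda>(p, g, q). g)\<rparr>\<rparr>"

definition pointwise_left_kan ::
  "('o, 'a) cat \<Rightarrow> ('i, 'k, 'o, 'a) diagram \<Rightarrow> ('i, 'k, 'j, 'l) ftr \<Rightarrow> ('j, 'l, 'o, 'a) diagram
     \<Rightarrow> ('i \<Rightarrow> 'a) \<Rightarrow> bool" where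
  "pointwise_left_kan C D F D' l \<longleftrightarrow> left_kan C D F D' l \<and>
     (\<forall>k \<in> ob (shape D'). is_colimit C (comma_dgm D (shape D') F k) (omap (dgm D') k)
        (\<lambda>(j, u). cmp C (amap (dgm D') u) (l j)))"


section \<open>Split opfibrations\<close>

definition opcartesian ::
  "('i, 'k) cat \<Rightarrow> ('j, 'l) cat \<Rightarrow> ('i, 'k, 'j, 'l) ftr \<Rightarrow> 'k \<Rightarrow> bool" where
  "opcartesian J K F f \<longleftrightarrow> f \<in> ar J \<and>
     (\<forall>g \<in> ar J. \<forall>w \<in> hom K (omap F (tgt J f)) (omap F (tgt J g)).
        src J g = src J f \<and> amap F g = cmp K w (amap F f) \<longrightarrow>
        (\<exists>!h. h \<in> hom J (tgt J f) (tgt J g) \<and> amap F h = w \<and> cmp J h f = g))"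

text \<open>\<open>s (j, u)\<close> is the chosen opcartesian lift of \<open>u : F j \<rightarrow> k\<close> starting at \<open>j\<close>; the
  last two conditions say that the choice is split.\<close>

definition split_opfibration ::
  "('i, 'k) cat \<Rightarrow> ('j, 'l) cat \<Rightarrow> ('i, 'k, 'j, 'l) ftr \<Rightarrow> ('i \<times> 'l \<Rightarrow> 'k) \<Rightarrow> bool" where
  "split_opfibration J K F s \<longleftrightarrow> is_functor J K F \<and>
     (\<forall>j \<in> ob J. \<forall>u \<in> ar K. src K u = omap F j \<longrightarrow>
        src J (s (j, u)) = j \<and> amap F (s (j, u)) = u \<and> opcartesian J K F (s (j, u))) \<and>
     (\<forall>j \<in> ob J. s (j, idt K (omap F j)) = idt J j) \<and>
     (\<forall>j \<in> ob J. \<forall>u \<in> ar K. \<forall>v \<in> ar K. src K u = omap F j \<and> src K v = tgt K u \<longrightarrow>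
        s (j, cmp K v u) = cmp J (s (tgt J (s (j, u)), v)) (s (j, u)))"

text \<open>A split opfibration \<open>F\<close> (with its splitting \<open>s\<close>) exhibiting \<open>D'\<close> as a pointwise left
  Kan extension of \<open>D\<close> along \<open>F\<close> (with its universal transformation \<open>l\<close>), all three
  in extensional form.\<close>

type_synonym ('u, 'a) kan_opfib = "('u, 'u, 'u, 'u) ftr \<times> ('u \<times> 'u \<Rightarrow> 'u) \<times> ('u \<Rightarrow> 'a)"

definition kan_opfibs ::
  "('o, 'a) cat \<Rightarrow> ('u, 'u, 'o, 'a) diagram \<Rightarrow> ('u, 'u, 'o, 'a) diagram \<Rightarrow> ('u, 'a) kan_opfib set" where
  "kan_opfibs C D D' = {(F, s, l).
     split_opfibration (shape D) (shape D') F s \<and> pointwise_left_kan C D F D' l \<and>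
     restrict_ftr (shape D) F = F \<and>
     s \<in> extensional {(j, u). j \<in> ob (shape D) \<and> u \<in> ar (shape D') \<and> src (shape D') u = omap F j} \<and>
     l \<in> extensional (ob (shape D))}"

text \<open>\<open>(F, s, l)\<close> is the transport of the canonical data on the projection
  \<open>\<integral>E\<^sub>0 \<rightarrow> I\<close> along \<open>\<phi>\<close> and \<open>\<psi>\<close>: its canonical splitting \<open>(i, id)\<close>, and the colimit cocones
  \<open>E\<^sub>1 x y \<rightarrow> c(E x)\<close>.\<close>

definition corresponds ::
  "('o, 'a) cat \<Rightarrow> ('u, 'o, 'a) colimits \<Rightarrow> ('u, 'o, 'a) peval \<Rightarrow> ('u, 'a) kan_opfib \<Rightarrow> bool" where
  "corresponds C c = (\<lambda>(E, \<phi>, \<psi>) (F, s, l). let R = fun_part \<phi>; S = fun_part \<psi> in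
     (\<forall>(x, y) \<in> ob (shape (mult C E)).
        omap F (omap R (x, y)) = omap S x \<and>
        (\<forall>i \<in> ar (shape E). src (shape E) i = x \<longrightarrow>
           (let x' = tgt (shape E) i; y' = omap (E0_ar E i) y in
            s (omap R (x, y), amap S i) = amap R ((x, y), (i, idt (E0_ob E x') y'), (x', y')))) \<and>
        cmp C (l (omap R (x, y))) (nat_part \<phi> (x, y)) =
          cmp C (nat_part \<psi> x) (snd (c (omap (dgm E) x)) y)) \<and>
     (\<forall>(p, (i, f), q) \<in> ar (shape (mult C E)). amap F (amap R (p, (i, f), q)) = amap S i))"

end

theory Submission
  imports Defs
begin

text \<open>
  A partial evaluation \<open>(E, \<phi>, \<psi>)\<close> transports the projection \<open>\<integral>E\<^sub>0 \<rightarrow> I\<close>, with its canonical splitting,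
  to a split opfibration \<open>F : J \<rightarrow> K\<close>.  The fibre of \<open>F\<close> over \<open>k\<close> is reflective in the comma category \<open>F \<down> k\<close>,
  so \<open>D'\<close> is a pointwise left Kan extension of \<open>D\<close> along \<open>F\<close> exactly if each \<open>D' k\<close> is the colimit of \<open>D\<close>
  over that fibre, which is what \<open>\<psi>\<close> says.  Conversely \<open>E k\<close> is recovered as \<open>D\<close> restricted to the fibre over \<open>k\<close>,
  with transport along the chosen lifts.

  Since \<open>corresponds\<close> determines \<open>(F, s, l)\<close>, well-definedness and injectivity amount to two partial
  evaluations being isomorphic exactly if they determine the same triple.
\<close>

section \<open>Categories, functors and diagrams\<close>

text \<open>Strictness shapes the proof. A splitting makes transport between fibres strictly
  functorial, as a functor into \<open>diag_cat C\<close> demands; conversely strict functoriality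
  of \<open>E\<close> is what makes the lifts \<open>(i, id)\<close> a splitting. Every arrow of the
  Grothendieck construction is a vertical arrow after such a lift. A functor over the base that
  preserves these lifts is therefore given by its restrictions to the fibres, and these commute with
  transport. This is how agreement of \<open>F\<close> and \<open>s\<close> lets a comparison of
  \<mu>(E) with \<mu>(E') descend to a morphism from \<open>E\<close> to \<open>E'\<close>;
  agreement of \<open>l\<close> makes that morphism compatible with the chosen colimits. Functors
  and transformations are functions on whole types but carry information only on carriers. Equality
  of diagram morphisms is therefore \<open>mor_eq\<close>, and restriction picks canonical
  representatives. The bijection sends a class to the unique triple that corresponds to its members.
  The relation \<open>peval_iso\<close> turns out to be the kernel of this assignment, so the
  quotient is treated as a set of fibres of a function.\<close>

lemma homI: "f \<in> ar C \<Longrightarrow> src C f = x \<Longrightarrow> tgt C f = y \<Longrightarrow> f \<in> hom C x y"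
  by (simp add: hom_def)

lemma homD:
  assumes "f \<in> hom C x y"
  shows "f \<in> ar C" "src C f = x" "tgt C f = y"
  using assms by (simp_all add: hom_def)

context category
begin

lemma hom_ob:
  assumes "f \<in> hom C x y"
  shows "x \<in> ob C" "y \<in> ob C"
  using assms src_ob tgt_ob by (auto simp: hom_def)

lemma cmp_in_hom: "f \<in> hom C x y \<Longrightarrow> g \<in> hom C y z \<Longrightarrow> cmp C g f \<in> hom C x z"
  using cmp_hom by (auto simp: hom_def)

lemma idt_right: "f \<in> hom C x y \<Longrightarrow> cmp C f (idt C x) = f"
  using cmp_idt_right by (auto simp: hom_def)

lemma idt_left: "f \<in> hom C x y \<Longrightarrow> cmp C (idt C y) f = f"
  using cmp_idt_left by (auto simp: hom_def)

lemma assoc: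
  "f \<in> hom C w x \<Longrightarrow> g \<in> hom C x y \<Longrightarrow> h \<in> hom C y z \<Longrightarrow>
    cmp C h (cmp C g f) = cmp C (cmp C h g) f"
  using cmp_assoc by (auto simp: hom_def)

lemma idt_ar: "x \<in> ob C \<Longrightarrow> idt C x \<in> ar C" "x \<in> ob C \<Longrightarrow> src C (idt C x) = x"
  "x \<in> ob C \<Longrightarrow> tgt C (idt C x) = x"
  using idt_hom by (auto simp: hom_def)

lemma cmp_ar:
  assumes "f \<in> ar C" "g \<in> ar C" "tgt C f = src C g"
  shows "cmp C g f \<in> ar C" "src C (cmp C g f) = src C f" "tgt C (cmp C g f) = tgt C g"
  using cmp_hom[OF assms] by (auto simp: hom_def)

end

lemma is_functorD:
  assumes "is_functor A B F"
  shows "category A" "category B"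
    and "x \<in> ob A \<Longrightarrow> omap F x \<in> ob B"
    and "f \<in> hom A x y \<Longrightarrow> amap F f \<in> hom B (omap F x) (omap F y)"
    and "x \<in> ob A \<Longrightarrow> amap F (idt A x) = idt B (omap F x)"
    and "f \<in> hom A x y \<Longrightarrow> g \<in> hom A y z \<Longrightarrow> amap F (cmp A g f) = cmp B (amap F g) (amap F f)"
  using assms unfolding is_functor_def by (auto simp: hom_def)

lemma is_functor_ar:
  assumes "is_functor A B F" "f \<in> ar A"
  shows "amap F f \<in> ar B" "src B (amap F f) = omap F (src A f)" "tgt B (amap F f) = omap F (tgt A f)"
  using assms unfolding is_functor_def by (auto simp: hom_def)

lemma is_functorI:
  assumes "category A" "category B"
    and "\<And>x. x \<in> ob A \<Longrightarrow> omap F x \<in> ob B"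
    and "\<And>f x y. f \<in> hom A x y \<Longrightarrow> amap F f \<in> hom B (omap F x) (omap F y)"
    and "\<And>x. x \<in> ob A \<Longrightarrow> amap F (idt A x) = idt B (omap F x)"
    and "\<And>f g x y z. f \<in> hom A x y \<Longrightarrow> g \<in> hom A y z \<Longrightarrow>
      amap F (cmp A g f) = cmp B (amap F g) (amap F f)"
  shows "is_functor A B F"
  using assms unfolding is_functor_def by (auto simp: hom_def)

lemma omap_id_ftr [simp]: "omap id_ftr x = x" and amap_id_ftr [simp]: "amap id_ftr f = f"
  by (simp_all add: id_ftr_def)

lemma omap_comp_ftr [simp]: "omap (comp_ftr G F) x = omap G (omap F x)"
  and amap_comp_ftr [simp]: "amap (comp_ftr G F) f = amap G (amap F f)"
  by (simp_all add: comp_ftr_def)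

lemma restrict_ftr_simps:
  "x \<in> ob A \<Longrightarrow> omap (restrict_ftr A F) x = omap F x"
  "f \<in> ar A \<Longrightarrow> amap (restrict_ftr A F) f = amap F f"
  by (simp_all add: restrict_ftr_def)

lemma restrict_eq_iff: "restrict f X = restrict g X \<longleftrightarrow> (\<forall>x\<in>X. f x = g x)"
  by (auto simp: restrict_def fun_eq_iff)

lemma restrict_ftr_eq_iff:
  "restrict_ftr A F = restrict_ftr A G \<longleftrightarrow>
    (\<forall>x\<in>ob A. omap F x = omap G x) \<and> (\<forall>f\<in>ar A. amap F f = amap G f)"
  by (simp add: restrict_ftr_def restrict_eq_iff)

lemma restrict_ftr_idem: "restrict_ftr A (restrict_ftr A F) = restrict_ftr A F"
  by (simp add: restrict_ftr_def)

lemma is_functor_id: "category A \<Longrightarrow> is_functor A A id_ftr"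
  by (auto intro!: is_functorI)

lemma is_functor_comp:
  assumes F: "is_functor A B F" and G: "is_functor B B' G"
  shows "is_functor A B' (comp_ftr G F)"
proof (rule is_functorI)
  show "category A" "category B'"
    by (rule is_functorD(1)[OF F], rule is_functorD(2)[OF G])
  show "omap (comp_ftr G F) x \<in> ob B'"
    "amap (comp_ftr G F) (idt A x) = idt B' (omap (comp_ftr G F) x)" if "x \<in> ob A" for x
    using is_functorD(3,5)[OF F that] is_functorD(3,5)[OF G] by simp_all
  show "amap (comp_ftr G F) f \<in> hom B' (omap (comp_ftr G F) x) (omap (comp_ftr G F) y)"
    if "f \<in> hom A x y" for f x y
    using is_functorD(4)[OF G is_functorD(4)[OF F that]] by simp
  fix f g x y z
  assume f: "f \<in> hom A x y" and g: "g \<in> hom A y z"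
  show "amap (comp_ftr G F) (cmp A g f) = cmp B' (amap (comp_ftr G F) g) (amap (comp_ftr G F) f)"
    using is_functorD(6)[OF F f g] is_functorD(6)[OF G is_functorD(4)[OF F f] is_functorD(4)[OF F g]]
    by simp
qed

text \<open>Identities and composites of arrows of \<open>A\<close> lie in its carrier, so agreement
  on carriers reaches every term in the functor laws.\<close>

lemma is_functor_cong:
  assumes F: "is_functor A B F"
    and o: "\<And>x. x \<in> ob A \<Longrightarrow> omap G x = omap F x" and a: "\<And>f. f \<in> ar A \<Longrightarrow> amap G f = amap F f"
  shows "is_functor A B G"
proof -
  interpret A: category A
    by (rule is_functorD(1)[OF F])
  show ?thesis
    using F o a A.src_ob A.tgt_ob A.idt_ar A.cmp_ar
    unfolding is_functor_def by (auto simp: A.idt_ar(1) A.cmp_ar(1))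
qed

section \<open>Natural transformations and morphisms of diagrams\<close>

lemma nat_transD:
  assumes "nat_trans A B F G t"
  shows "is_functor A B F" "is_functor A B G"
    and "x \<in> ob A \<Longrightarrow> t x \<in> hom B (omap F x) (omap G x)"
    and "f \<in> hom A x y \<Longrightarrow> cmp B (t y) (amap F f) = cmp B (amap G f) (t x)"
  using assms unfolding nat_trans_def by (auto simp: hom_def)

lemma nat_transI:
  assumes "is_functor A B F" "is_functor A B G"
    and "\<And>x. x \<in> ob A \<Longrightarrow> t x \<in> hom B (omap F x) (omap G x)"
    and "\<And>f x y. f \<in> hom A x y \<Longrightarrow> cmp B (t y) (amap F f) = cmp B (amap G f) (t x)"
  shows "nat_trans A B F G t"
  using assms unfolding nat_trans_def by (auto simp: hom_def)

lemma is_diag_morD: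
  assumes "is_diag_mor C X Y m"
  shows "is_functor (shape X) (shape Y) (fun_part m)"
    and "is_functor (shape X) C (dgm X)"
    and "x \<in> ob (shape X) \<Longrightarrow>
      nat_part m x \<in> hom C (omap (dgm X) x) (omap (dgm Y) (omap (fun_part m) x))"
    and "f \<in> hom (shape X) x y \<Longrightarrow>
      cmp C (nat_part m y) (amap (dgm X) f) = cmp C (amap (dgm Y) (amap (fun_part m) f)) (nat_part m x)"
  using assms nat_transD unfolding is_diag_mor_def by fastforce+

lemma is_diag_morI:
  assumes "is_functor (shape X) (shape Y) (fun_part m)"
    and "is_functor (shape X) C (dgm X)" "is_functor (shape Y) C (dgm Y)"
    and "\<And>x. x \<in> ob (shape X) \<Longrightarrow>
      nat_part m x \<in> hom C (omap (dgm X) x) (omap (dgm Y) (omap (fun_part m) x))"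
    and "\<And>f x y. f \<in> hom (shape X) x y \<Longrightarrow>
      cmp C (nat_part m y) (amap (dgm X) f) = cmp C (amap (dgm Y) (amap (fun_part m) f)) (nat_part m x)"
  shows "is_diag_mor C X Y m"
  unfolding is_diag_mor_def using assms by (auto intro!: nat_transI is_functor_comp)

lemma id_mor_simps [simp]:
  "fun_part (id_mor C X) = id_ftr" "nat_part (id_mor C X) x = idt C (omap (dgm X) x)"
  by (simp_all add: id_mor_def)

lemma comp_mor_simps [simp]:
  "fun_part (comp_mor C n m) = comp_ftr (fun_part n) (fun_part m)"
  "nat_part (comp_mor C n m) x = cmp C (nat_part n (omap (fun_part m) x)) (nat_part m x)"
  by (simp_all add: comp_mor_def)

lemma restrict_mor_simps:
  "x \<in> ob (shape X) \<Longrightarrow> omap (fun_part (restrict_mor X m)) x = omap (fun_part m) x"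
  "f \<in> ar (shape X) \<Longrightarrow> amap (fun_part (restrict_mor X m)) f = amap (fun_part m) f"
  "x \<in> ob (shape X) \<Longrightarrow> nat_part (restrict_mor X m) x = nat_part m x"
  by (simp_all add: restrict_mor_def restrict_ftr_simps)

lemma mor_eq_iff:
  "mor_eq X m n \<longleftrightarrow> (\<forall>x\<in>ob (shape X). omap (fun_part m) x = omap (fun_part n) x) \<and>
    (\<forall>f\<in>ar (shape X). amap (fun_part m) f = amap (fun_part n) f) \<and>
    (\<forall>x\<in>ob (shape X). nat_part m x = nat_part n x)"
  by (auto simp: mor_eq_def restrict_mor_def restrict_ftr_eq_iff restrict_eq_iff)

lemma restrict_mor_idem: "restrict_mor X (restrict_mor X m) = restrict_mor X m"
  by (simp add: restrict_mor_def restrict_ftr_idem)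

text \<open>Identities and composites of \<open>diag_cat\<close> are restricted representatives;
  this is why they are again arrows there.\<close>

lemma is_diag_mor_restrict:
  assumes m: "is_diag_mor C X Y m" and Y: "is_functor (shape Y) C (dgm Y)"
  shows "is_diag_mor C X Y (restrict_mor X m)"
proof -
  interpret X: category "shape X"
    by (rule is_functorD(1)[OF is_diag_morD(1)[OF m]])
  show ?thesis
  proof (rule is_diag_morI)
    show "is_functor (shape X) (shape Y) (fun_part (restrict_mor X m))"
      by (rule is_functor_cong[OF is_diag_morD(1)[OF m]]) (simp_all add: restrict_mor_simps)
    show "cmp C (nat_part (restrict_mor X m) y) (amap (dgm X) f) =
        cmp C (amap (dgm Y) (amap (fun_part (restrict_mor X m)) f)) (nat_part (restrict_mor X m) x)"
      if f: "f \<in> hom (shape X) x y" for f x y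
      using is_diag_morD(4)[OF m f] homD(1)[OF f] X.hom_ob[OF f] by (simp add: restrict_mor_simps)
  qed (use is_diag_morD(2,3)[OF m] Y in \<open>auto simp: restrict_mor_simps\<close>)
qed

lemma is_diag_mor_id: 
  assumes "is_functor (shape X) C (dgm X)"
  shows "is_diag_mor C X X (id_mor C X)"
proof -
  interpret C: category C
    by (rule is_functorD(2)[OF assms])
  show ?thesis
    using is_functorD(1,3)[OF assms] C.idt_left[OF is_functorD(4)[OF assms]]
      C.idt_right[OF is_functorD(4)[OF assms]]
    by (auto intro!: is_diag_morI is_functor_id C.idt_hom assms)
qed

lemma is_diag_mor_comp:
  assumes m: "is_diag_mor C X Y m" and n: "is_diag_mor C Y Z n" and Z: "is_functor (shape Z) C (dgm Z)"
  shows "is_diag_mor C X Z (comp_mor C n m)"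
proof -
  interpret C: category C
    by (rule is_functorD(2)[OF is_diag_morD(2)[OF m]])
  note M = is_diag_morD[OF m] and N = is_diag_morD[OF n]
  show ?thesis
  proof (rule is_diag_morI)
    show "is_functor (shape X) (shape Z) (fun_part (comp_mor C n m))"
      using is_functor_comp[OF M(1) N(1)] by simp
    show "nat_part (comp_mor C n m) x
        \<in> hom C (omap (dgm X) x) (omap (dgm Z) (omap (fun_part (comp_mor C n m)) x))"
      if "x \<in> ob (shape X)" for x
      using C.cmp_in_hom[OF M(3)[OF that] N(3)[OF is_functorD(3)[OF M(1) that]]] by simp
  next
    fix f x y
    assume f: "f \<in> hom (shape X) x y"
    have xy: "x \<in> ob (shape X)" "y \<in> ob (shape X)"
      using category.hom_ob[OF is_functorD(1)[OF M(1)] f] by auto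
    let ?R = "fun_part m"
    have Rf: "amap ?R f \<in> hom (shape Y) (omap ?R x) (omap ?R y)"
      by (rule is_functorD(4)[OF M(1) f])
    have nx: "nat_part n (omap ?R x) \<in> hom C (omap (dgm Y) (omap ?R x))
        (omap (dgm Z) (omap (fun_part n) (omap ?R x)))"
      and ny: "nat_part n (omap ?R y) \<in> hom C (omap (dgm Y) (omap ?R y))
        (omap (dgm Z) (omap (fun_part n) (omap ?R y)))"
      using N(3) is_functorD(3)[OF M(1)] xy by auto
    have Zf: "amap (dgm Z) (amap (fun_part n) (amap ?R f)) \<in> hom C
       (omap (dgm Z) (omap (fun_part n) (omap ?R x))) (omap (dgm Z) (omap (fun_part n) (omap ?R y)))"
      by (intro is_functorD(4)[OF Z] is_functorD(4)[OF N(1)] Rf)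
    \<comment> \<open>Two naturality squares are pasted: \<open>m\<close> at \<open>f\<close>, and
      \<open>n\<close> at the image of \<open>f\<close> under the functor part of
      \<open>m\<close>.\<close>
    have "cmp C (cmp C (nat_part n (omap ?R y)) (nat_part m y)) (amap (dgm X) f)
        = cmp C (nat_part n (omap ?R y)) (cmp C (nat_part m y) (amap (dgm X) f))"
      using C.assoc[OF is_functorD(4)[OF M(2) f] M(3)[OF xy(2)] ny] by simp
    also have "\<dots> = cmp C (nat_part n (omap ?R y)) (cmp C (amap (dgm Y) (amap ?R f)) (nat_part m x))"
      by (simp add: M(4)[OF f])
    also have "\<dots> = cmp C (cmp C (nat_part n (omap ?R y)) (amap (dgm Y) (amap ?R f))) (nat_part m x)"
      by (rule C.assoc[OF M(3)[OF xy(1)] is_functorD(4)[OF N(2) Rf] ny])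
    also have "\<dots> = cmp C (cmp C (amap (dgm Z) (amap (fun_part n) (amap ?R f))) (nat_part n (omap ?R x)))
        (nat_part m x)"
      by (simp add: N(4)[OF Rf])
    also have "\<dots> = cmp C (amap (dgm Z) (amap (fun_part n) (amap ?R f)))
        (cmp C (nat_part n (omap ?R x)) (nat_part m x))"
      by (rule C.assoc[OF M(3)[OF xy(1)] nx Zf, symmetric])
    finally show "cmp C (nat_part (comp_mor C n m) y) (amap (dgm X) f) =
        cmp C (amap (dgm Z) (amap (fun_part (comp_mor C n m)) f)) (nat_part (comp_mor C n m) x)"
      by simp
  qed (use M Z in auto)
qed

section \<open>The category of small diagrams\<close>

lemma diag_cat_simps [simp]:
  "ob (diag_cat C) = {X. small_diagram C X}"
  "src (diag_cat C) (X, m, Y) = X"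
  "tgt (diag_cat C) (X, m, Y) = Y"
  "idt (diag_cat C) X = (X, restrict_mor X (id_mor C X), X)"
  "cmp (diag_cat C) (Y', n, Z) (X, m, Y) = (X, restrict_mor X (comp_mor C n m), Z)"
  by (simp_all add: diag_cat_def)

lemma diag_cat_ar:
  "(X, m, Y) \<in> ar (diag_cat C) \<longleftrightarrow> small_diagram C X \<and> small_diagram C Y \<and>
    is_diag_mor C X Y m \<and> restrict_mor X m = m"
  by (simp add: diag_cat_def)

lemma diag_cat_hom:
  "a \<in> hom (diag_cat C) X Y \<longleftrightarrow> a = (X, mor_of a, Y) \<and> small_diagram C X \<and> small_diagram C Y \<and>
    is_diag_mor C X Y (mor_of a) \<and> restrict_mor X (mor_of a) = mor_of a"
  by (cases a) (auto simp: hom_def diag_cat_ar)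

lemma small_diagramD:
  assumes "small_diagram C X"
  shows "is_functor (shape X) C (dgm X)"
  using assms by (simp add: small_diagram_def is_diagram_def)

lemma category_diag_cat: "category C \<Longrightarrow> category (diag_cat C)"
proof -
  assume "category C"
  then interpret C: category C .
  have cmp: "(X, restrict_mor X (comp_mor C n m), Z) \<in> ar (diag_cat C)"
    if "(X, m, Y) \<in> ar (diag_cat C)" "(Y, n, Z) \<in> ar (diag_cat C)" for X Y Z m n
    using that unfolding diag_cat_ar
    by (auto simp: restrict_mor_idem intro!: is_diag_mor_restrict is_diag_mor_comp dest: small_diagramD)
  show "category (diag_cat C)"
  proof
    fix f g h
    assume fgh: "f \<in> ar (diag_cat C)" "g \<in> ar (diag_cat C)" "h \<in> ar (diag_cat C)"
      "tgt (diag_cat C) f = src (diag_cat C) g" "tgt (diag_cat C) g = src (diag_cat C) h"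
    obtain W X Y Z l m n where e: "f = (W, l, X)" "g = (X, m, Y)" "h = (Y, n, Z)"
      using fgh(4,5) by (cases f; cases g; cases h) auto
    have L: "is_diag_mor C W X l" and M: "is_diag_mor C X Y m" and N: "is_diag_mor C Y Z n"
      using fgh by (auto simp: e diag_cat_ar)
    note l = is_diag_morD[OF L] and m = is_diag_morD[OF M] and n = is_diag_morD[OF N]
    note Wcat = is_functorD(1)[OF l(2)]
    \<comment> \<open>Functor parts send carriers into carriers, so the inner restrictions are
      invisible and only associativity of the components in \<open>C\<close> remains.\<close>
    have "mor_eq W (comp_mor C n (restrict_mor W (comp_mor C m l)))
      (comp_mor C (restrict_mor X (comp_mor C n m)) l)"
      unfolding mor_eq_iff
    proof (intro conjI ballI)
      fix x assume x: "x \<in> ob (shape W)"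
      have Rx: "omap (fun_part l) x \<in> ob (shape X)"
        by (rule is_functorD(3)[OF l(1) x])
      show "nat_part (comp_mor C n (restrict_mor W (comp_mor C m l))) x =
         nat_part (comp_mor C (restrict_mor X (comp_mor C n m)) l) x"
        using C.assoc[OF l(3)[OF x] m(3)[OF Rx] n(3)[OF is_functorD(3)[OF m(1) Rx]]]
        by (simp add: restrict_mor_simps x Rx)
    qed (use is_functor_ar(1)[OF l(1)] is_functorD(3)[OF l(1)] in \<open>simp_all add: restrict_mor_simps\<close>)
    then show "cmp (diag_cat C) h (cmp (diag_cat C) g f) = cmp (diag_cat C) (cmp (diag_cat C) h g) f"
      by (simp add: e mor_eq_def)
  next
    fix f assume f: "f \<in> ar (diag_cat C)"
    obtain X m Y where e: "f = (X, m, Y)" by (cases f)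
    have M: "is_diag_mor C X Y m" and r: "restrict_mor X m = m"
      using f by (auto simp: e diag_cat_ar)
    note m = is_diag_morD[OF M]
    have "mor_eq X (comp_mor C m (restrict_mor X (id_mor C X))) m"
      "mor_eq X (comp_mor C (restrict_mor Y (id_mor C Y)) m) m"
      using is_functor_ar(1)[OF m(1)] is_functorD(3)[OF m(1)] C.idt_left[OF m(3)] C.idt_right[OF m(3)]
      by (auto simp: mor_eq_iff restrict_mor_simps)
    then show "cmp (diag_cat C) f (idt (diag_cat C) (src (diag_cat C) f)) = f"
      "cmp (diag_cat C) (idt (diag_cat C) (tgt (diag_cat C) f)) f = f"
      by (simp_all add: e mor_eq_def r)
  next
    fix f g assume "f \<in> ar (diag_cat C)" "g \<in> ar (diag_cat C)" "tgt (diag_cat C) f = src (diag_cat C) g"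
    then show "cmp (diag_cat C) g f \<in> hom (diag_cat C) (src (diag_cat C) f) (tgt (diag_cat C) g)"
      by (cases f; cases g) (auto intro!: homI cmp)
  next
    fix X assume "X \<in> ob (diag_cat C)"
    then show "idt (diag_cat C) X \<in> hom (diag_cat C) X X"
      by (auto simp: diag_cat_hom restrict_mor_idem intro!: is_diag_mor_restrict is_diag_mor_id dest: small_diagramD)
  qed (auto simp: diag_cat_def)
qed

section \<open>Cocones and colimits\<close>

lemma is_cocone_iff:
  "is_cocone C X x l \<longleftrightarrow> is_functor (shape X) C (dgm X) \<and> x \<in> ob C \<and>
     (\<forall>j \<in> ob (shape X). l j \<in> hom C (omap (dgm X) j) x) \<and>
     (\<forall>i j f. f \<in> hom (shape X) i j \<longrightarrow> cmp C (l j) (amap (dgm X) f) = l i)"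
  unfolding is_cocone_def is_diagram_def hom_def by auto

lemma is_coconeD:
  assumes "is_cocone C X x l"
  shows "is_functor (shape X) C (dgm X)" "x \<in> ob C"
    and "j \<in> ob (shape X) \<Longrightarrow> l j \<in> hom C (omap (dgm X) j) x"
    and "f \<in> hom (shape X) i j \<Longrightarrow> cmp C (l j) (amap (dgm X) f) = l i"
  using assms unfolding is_cocone_iff by auto

lemma is_coconeI:
  assumes "is_functor (shape X) C (dgm X)" "x \<in> ob C"
    and "\<And>j. j \<in> ob (shape X) \<Longrightarrow> l j \<in> hom C (omap (dgm X) j) x"
    and "\<And>f i j. f \<in> hom (shape X) i j \<Longrightarrow> cmp C (l j) (amap (dgm X) f) = l i"
  shows "is_cocone C X x l"
  using assms unfolding is_cocone_iff by auto

lemma is_colimitD: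
  assumes "is_colimit C X x l"
  shows "is_cocone C X x l"
    and "is_cocone C X y m \<Longrightarrow> \<exists>!h. h \<in> hom C x y \<and> (\<forall>j \<in> ob (shape X). cmp C h (l j) = m j)"
  using assms unfolding is_colimit_def by auto

lemma is_cocone_postcompose:
  assumes l: "is_cocone C X x l" and h: "h \<in> hom C x y"
  shows "is_cocone C X y (\<lambda>j. cmp C h (l j))"
proof -
  note L = is_coconeD[OF l]
  interpret C: category C
    by (rule is_functorD(2)[OF L(1)])
  show ?thesis
  proof (rule is_coconeI[OF L(1)])
    fix f i j assume f: "f \<in> hom (shape X) i j"
    have ij: "i \<in> ob (shape X)" "j \<in> ob (shape X)"
      using category.hom_ob[OF is_functorD(1)[OF L(1)] f] by auto
    show "cmp C (cmp C h (l j)) (amap (dgm X) f) = cmp C h (l i)"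
      using C.assoc[OF is_functorD(4)[OF L(1) f] L(3)[OF ij(2)] h] L(4)[OF f] by simp
  qed (use C.cmp_in_hom[OF L(3) h] C.hom_ob[OF h] in auto)
qed

text \<open>The legs of a colimit are jointly epic: \<open>h\<close> and \<open>h'\<close> both
  mediate the cocone obtained from \<open>l\<close> by postcomposing with \<open>h\<close>.\<close>

lemma is_colimit_eqI:
  assumes l: "is_colimit C X x l" and h: "h \<in> hom C x y" and h': "h' \<in> hom C x y"
    and eq: "\<And>j. j \<in> ob (shape X) \<Longrightarrow> cmp C h (l j) = cmp C h' (l j)"
  shows "h = h'"
proof -
  let ?Q = "\<lambda>k. k \<in> hom C x y \<and> (\<forall>j\<in>ob (shape X). cmp C k (l j) = cmp C h (l j))"
  have "\<exists>!k. ?Q k"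
    by (rule is_colimitD(2)[OF l is_cocone_postcompose[OF is_colimitD(1)[OF l] h]])
  moreover have "?Q h" "?Q h'"
    using h h' eq by simp_all
  ultimately show ?thesis
    by blast
qed

lemma is_colimitI:
  assumes "is_cocone C X x l"
    and "\<And>y m. is_cocone C X y m \<Longrightarrow> \<exists>h. h \<in> hom C x y \<and> (\<forall>j\<in>ob (shape X). cmp C h (l j) = m j)"
    and "\<And>y h h'. \<lbrakk>h \<in> hom C x y; h' \<in> hom C x y; \<forall>j\<in>ob (shape X). cmp C h (l j) = cmp C h' (l j)\<rbrakk> \<Longrightarrow> h = h'"
  shows "is_colimit C X x l"
  unfolding is_colimit_def
proof (intro conjI allI impI)
  fix y m assume m: "is_cocone C X y m"
  obtain h where "h \<in> hom C x y \<and> (\<forall>j\<in>ob (shape X). cmp C h (l j) = m j)"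
    using assms(2)[OF m] by blast
  then show "\<exists>!h. h \<in> hom C x y \<and> (\<forall>j\<in>ob (shape X). cmp C h (l j) = m j)"
    using assms(3) by (intro ex1I[of _ h]) auto
qed (rule assms(1))

text \<open>Applied to a chosen colimit of \<open>Y\<close>, this is the cocone that induces the
  action of \<open>c\<close> on the morphism \<open>m\<close>.\<close>

lemma is_cocone_pullback:
  assumes l: "is_cocone C Y y l" and m: "is_diag_mor C X Y m"
  shows "is_cocone C X y (\<lambda>j. cmp C (l (omap (fun_part m) j)) (nat_part m j))"
proof -
  note L = is_coconeD[OF l] and M = is_diag_morD[OF m]
  interpret C: category C
    by (rule is_functorD(2)[OF L(1)])
  show ?thesis
  proof (rule is_coconeI[OF M(2) L(2)])
    fix j assume "j \<in> ob (shape X)"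
    then show "cmp C (l (omap (fun_part m) j)) (nat_part m j) \<in> hom C (omap (dgm X) j) y"
      using C.cmp_in_hom M(3) L(3) is_functorD(3)[OF M(1)] by blast
  next
    fix f i j assume f: "f \<in> hom (shape X) i j"
    have ij: "i \<in> ob (shape X)" "j \<in> ob (shape X)"
      using category.hom_ob[OF is_functorD(1)[OF M(1)] f] by auto
    have Rj: "l (omap (fun_part m) j) \<in> hom C (omap (dgm Y) (omap (fun_part m) j)) y"
      using ij L(3) is_functorD(3)[OF M(1)] by blast
    have Rf: "amap (fun_part m) f \<in> hom (shape Y) (omap (fun_part m) i) (omap (fun_part m) j)"
      by (rule is_functorD(4)[OF M(1) f])
    show "cmp C (cmp C (l (omap (fun_part m) j)) (nat_part m j)) (amap (dgm X) f)
        = cmp C (l (omap (fun_part m) i)) (nat_part m i)"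
      using C.assoc[OF is_functorD(4)[OF M(2) f] M(3)[OF ij(2)] Rj] M(4)[OF f] L(4)[OF Rf]
        C.assoc[OF M(3)[OF ij(1)] is_functorD(4)[OF L(1) Rf] Rj]
      by simp
  qed
qed

section \<open>The colimit functor\<close>

lemma colim_ftr_omap [simp]: "omap (colim_ftr C c) X = fst (c X)"
  by (simp add: colim_ftr_def)

lemma colimit_choiceD:
  "colimit_choice C c \<Longrightarrow> small_diagram C X \<Longrightarrow> is_colimit C X (fst (c X)) (snd (c X))"
  by (auto simp: colimit_choice_def)

text \<open>The universal property at the pulled-back cocone gives unique existence, so the definite
  description in \<open>colim_ftr\<close> is proper.\<close>

lemma colim_ftr_amap:
  assumes c: "colimit_choice C c" and X: "small_diagram C X" and Y: "small_diagram C Y"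
    and m: "is_diag_mor C X Y m"
  shows "amap (colim_ftr C c) (X, m, Y) \<in> hom C (fst (c X)) (fst (c Y))"
    and "j \<in> ob (shape X) \<Longrightarrow> cmp C (amap (colim_ftr C c) (X, m, Y)) (snd (c X) j) =
      cmp C (snd (c Y) (omap (fun_part m) j)) (nat_part m j)"
proof -
  let ?Q = "\<lambda>h. h \<in> hom C (fst (c X)) (fst (c Y)) \<and> (\<forall>j \<in> ob (shape X). cmp C h (snd (c X) j) =
          cmp C (snd (c Y) (omap (fun_part m) j)) (nat_part m j))"
  have "is_cocone C X (fst (c Y)) (\<lambda>j. cmp C (snd (c Y) (omap (fun_part m) j)) (nat_part m j))"
    by (rule is_cocone_pullback[OF is_colimitD(1)[OF colimit_choiceD[OF c Y]] m])
  from is_colimitD(2)[OF colimit_choiceD[OF c X] this] have "\<exists>!h. ?Q h" .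
  from theI'[OF this] have "?Q (amap (colim_ftr C c) (X, m, Y))"
    by (simp add: colim_ftr_def)
  then show "amap (colim_ftr C c) (X, m, Y) \<in> hom C (fst (c X)) (fst (c Y))"
    and "j \<in> ob (shape X) \<Longrightarrow> cmp C (amap (colim_ftr C c) (X, m, Y)) (snd (c X) j) =
      cmp C (snd (c Y) (omap (fun_part m) j)) (nat_part m j)"
    by auto
qed

text \<open>Both functor laws equate arrows out of a chosen colimit, so
  \<open>is_colimit_eqI\<close> reduces them to the legs, where they follow from
  \<open>colim_ftr_amap\<close>.\<close>

lemma is_functor_colim_ftr:
  fixes C :: "('o, 'a) cat" and c :: "('u, 'o, 'a) colimits"
  assumes C: "category C" and c: "colimit_choice C c"
  shows "is_functor (diag_cat C) C (colim_ftr C c)"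
proof (rule is_functorI[OF category_diag_cat[OF C] C])
  interpret C: category C by (rule C)
  interpret DC: category "diag_cat C" by (rule category_diag_cat[OF C])
  note col = colimit_choiceD[OF c] and am = colim_ftr_amap[OF c]
  fix x :: "('u, 'u, 'o, 'a) diagram"
  assume "x \<in> ob (diag_cat C)"
  then have x: "small_diagram C x" by simp
  note K = is_coconeD[OF is_colimitD(1)[OF col[OF x]]]
  show "omap (colim_ftr C c) x \<in> ob C"
    using K(2) by simp
  have "idt (diag_cat C) x \<in> hom (diag_cat C) x x"
    using x by (intro DC.idt_hom) simp
  then have m: "is_diag_mor C x x (restrict_mor x (id_mor C x))"
    by (simp add: diag_cat_hom)
  show "amap (colim_ftr C c) (idt (diag_cat C) x) = idt C (omap (colim_ftr C c) x)"
    unfolding diag_cat_simps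
  proof (rule is_colimit_eqI[OF col[OF x] am(1)[OF x x m]])
    show "idt C (omap (colim_ftr C c) x) \<in> hom C (fst (c x)) (fst (c x))"
      using C.idt_hom[OF K(2)] by simp
    fix j assume j: "j \<in> ob (shape x)"
    show "cmp C (amap (colim_ftr C c) (x, restrict_mor x (id_mor C x), x)) (snd (c x) j) =
        cmp C (idt C (omap (colim_ftr C c) x)) (snd (c x) j)"
      using am(2)[OF x x m j] C.idt_left[OF K(3)[OF j]] C.idt_right[OF K(3)[OF j]]
      by (simp add: restrict_mor_simps j)
  qed
next
  interpret C: category C by (rule C)
  note col = colimit_choiceD[OF c] and am = colim_ftr_amap[OF c]
  interpret DC: category "diag_cat C" by (rule category_diag_cat[OF C])
  show "amap (colim_ftr C c) f \<in> hom C (omap (colim_ftr C c) x) (omap (colim_ftr C c) y)"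
    if "f \<in> hom (diag_cat C) x y" for f and x y :: "('u, 'u, 'o, 'a) diagram"
    using that am(1) unfolding diag_cat_hom colim_ftr_omap by metis
  fix f g and X Y Z :: "('u, 'u, 'o, 'a) diagram"
  assume f: "f \<in> hom (diag_cat C) X Y" and g: "g \<in> hom (diag_cat C) Y Z"
  have gf: "cmp (diag_cat C) g f \<in> hom (diag_cat C) X Z"
    by (rule DC.cmp_in_hom[OF f g])
  obtain m n where e: "f = (X, m, Y)" "g = (Y, n, Z)"
    using f g unfolding diag_cat_hom by metis
  have X: "small_diagram C X" and Y: "small_diagram C Y" and Z: "small_diagram C Z"
    and m: "is_diag_mor C X Y m" and n: "is_diag_mor C Y Z n"
    and nm: "is_diag_mor C X Z (restrict_mor X (comp_mor C n m))"
    using f g gf by (auto simp: diag_cat_hom e)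
  note KX = is_coconeD[OF is_colimitD(1)[OF col[OF X]]]
   and KY = is_coconeD[OF is_colimitD(1)[OF col[OF Y]]]
   and KZ = is_coconeD[OF is_colimitD(1)[OF col[OF Z]]]
  show "amap (colim_ftr C c) (cmp (diag_cat C) g f) = cmp C (amap (colim_ftr C c) g) (amap (colim_ftr C c) f)"
    unfolding e diag_cat_simps
  proof (rule is_colimit_eqI[OF col[OF X] am(1)[OF X Z nm] C.cmp_in_hom[OF am(1)[OF X Y m] am(1)[OF Y Z n]]])
    fix j assume j: "j \<in> ob (shape X)"
    let ?mj = "omap (fun_part m) j"
    have mj: "?mj \<in> ob (shape Y)" by (rule is_functorD(3)[OF is_diag_morD(1)[OF m] j])
    note mh = is_diag_morD(3)[OF m j] and nh = is_diag_morD(3)[OF n mj]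
    have nmj: "omap (fun_part n) ?mj \<in> ob (shape Z)" by (rule is_functorD(3)[OF is_diag_morD(1)[OF n] mj])
    have "cmp C (cmp C (amap (colim_ftr C c) (Y, n, Z)) (amap (colim_ftr C c) (X, m, Y))) (snd (c X) j)
       = cmp C (amap (colim_ftr C c) (Y, n, Z)) (cmp C (snd (c Y) ?mj) (nat_part m j))"
      using C.assoc[OF KX(3)[OF j] am(1)[OF X Y m] am(1)[OF Y Z n]] am(2)[OF X Y m j] by simp
    also have "\<dots> = cmp C (cmp C (snd (c Z) (omap (fun_part n) ?mj)) (nat_part n ?mj)) (nat_part m j)"
      using C.assoc[OF mh KY(3)[OF mj] am(1)[OF Y Z n]] am(2)[OF Y Z n mj] by simp
    also have "\<dots> = cmp C (snd (c Z) (omap (fun_part n) ?mj)) (cmp C (nat_part n ?mj) (nat_part m j))"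
      using C.assoc[OF mh nh KZ(3)[OF nmj]] by simp
    finally show "cmp C (amap (colim_ftr C c) (X, restrict_mor X (comp_mor C n m), Z)) (snd (c X) j) =
        cmp C (cmp C (amap (colim_ftr C c) (Y, n, Z)) (amap (colim_ftr C c) (X, m, Y))) (snd (c X) j)"
      using am(2)[OF X Z nm j] by (simp add: restrict_mor_simps j)
  qed
qed

section \<open>The Grothendieck construction and the multiplication\<close>

lemma grothendieck_simps [simp]:
  "(x, y) \<in> ob (grothendieck I S T) \<longleftrightarrow> x \<in> ob I \<and> y \<in> ob (S x)"
  "src (grothendieck I S T) (p, a, q) = p" "tgt (grothendieck I S T) (p, a, q) = q"
  "idt (grothendieck I S T) (x, y) = ((x, y), (idt I x, idt (S x) y), (x, y))"
  "cmp (grothendieck I S T) (q', (i', f'), (x'', y'')) (p, (i, f), q) =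
      (p, (cmp I i' i, cmp (S x'') f' (amap (T i') f)), (x'', y''))"
  by (simp_all add: grothendieck_def)

locale double_diagram = category C for C :: "('o, 'a) cat" +
  fixes E :: "('u, 'o, 'a) ddiagram"
  assumes small_E: "small_diagram (diag_cat C) E"
begin

abbreviation I where "I \<equiv> shape E"

lemma functor_E: "is_functor I (diag_cat C) (dgm E)"
  by (rule small_diagramD[OF small_E])

sublocale I: category I
  by (rule is_functorD(1)[OF functor_E])

lemma small_E_ob: "x \<in> ob I \<Longrightarrow> small_diagram C (omap (dgm E) x)"
  using is_functorD(3)[OF functor_E] by simp

lemma functor_E1: "x \<in> ob I \<Longrightarrow> is_functor (E0_ob E x) C (E1_ob E x)"
  by (rule small_diagramD[OF small_E_ob])

lemma category_E0: "x \<in> ob I \<Longrightarrow> category (E0_ob E x)"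
  by (rule is_functorD(1)[OF functor_E1])

lemma amap_E:
  assumes "i \<in> hom I x x'"
  shows "amap (dgm E) i = (omap (dgm E) x, mor_of (amap (dgm E) i), omap (dgm E) x')"
    and "is_diag_mor C (omap (dgm E) x) (omap (dgm E) x') (mor_of (amap (dgm E) i))"
  using is_functorD(4)[OF functor_E assms] unfolding diag_cat_hom by auto

lemma functor_E0: "i \<in> hom I x x' \<Longrightarrow> is_functor (E0_ob E x) (E0_ob E x') (E0_ar E i)"
  by (rule is_diag_morD(1)[OF amap_E(2)])

lemma E0_ob: "i \<in> hom I x x' \<Longrightarrow> y \<in> ob (E0_ob E x) \<Longrightarrow> omap (E0_ar E i) y \<in> ob (E0_ob E x')"
  by (rule is_functorD(3)[OF functor_E0])

lemma E0_hom: "i \<in> hom I x x' \<Longrightarrow> f \<in> hom (E0_ob E x) y y' \<Longrightarrow>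
   amap (E0_ar E i) f \<in> hom (E0_ob E x') (omap (E0_ar E i) y) (omap (E0_ar E i) y')"
  by (rule is_functorD(4)[OF functor_E0])

lemma E1_hom: "i \<in> hom I x x' \<Longrightarrow> y \<in> ob (E0_ob E x) \<Longrightarrow>
    E1_ar E i y \<in> hom C (omap (E1_ob E x) y) (omap (E1_ob E x') (omap (E0_ar E i) y))"
  by (rule is_diag_morD(3)[OF amap_E(2)])

lemma E1_nat: "i \<in> hom I x x' \<Longrightarrow> f \<in> hom (E0_ob E x) y y' \<Longrightarrow>
    cmp C (E1_ar E i y') (amap (E1_ob E x) f) = cmp C (amap (E1_ob E x') (amap (E0_ar E i) f)) (E1_ar E i y)"
  by (rule is_diag_morD(4)[OF amap_E(2)])

text \<open>An equation of arrows in \<open>diag_cat C\<close> is one between restricted morphisms.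
  It therefore yields equations of functors and components only on the carriers of
  \<open>E0_ob E x\<close>; the same holds in \<open>E_cmp\<close>.\<close>

lemma E_idt:
  assumes "x \<in> ob I"
  shows "y \<in> ob (E0_ob E x) \<Longrightarrow> omap (E0_ar E (idt I x)) y = y"
    and "f \<in> ar (E0_ob E x) \<Longrightarrow> amap (E0_ar E (idt I x)) f = f"
    and "y \<in> ob (E0_ob E x) \<Longrightarrow> E1_ar E (idt I x) y = idt C (omap (E1_ob E x) y)"
  using is_functorD(5)[OF functor_E assms] by (simp_all add: restrict_mor_simps)

lemma E_cmp:
  assumes i: "i \<in> hom I x x'" and i': "i' \<in> hom I x' x''"
  shows "y \<in> ob (E0_ob E x) \<Longrightarrow> omap (E0_ar E (cmp I i' i)) y = omap (E0_ar E i') (omap (E0_ar E i) y)"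
    and "f \<in> ar (E0_ob E x) \<Longrightarrow> amap (E0_ar E (cmp I i' i)) f = amap (E0_ar E i') (amap (E0_ar E i) f)"
    and "y \<in> ob (E0_ob E x) \<Longrightarrow>
      E1_ar E (cmp I i' i) y = cmp C (E1_ar E i' (omap (E0_ar E i) y)) (E1_ar E i y)"
proof -
  have "mor_of (amap (dgm E) (cmp I i' i)) = restrict_mor (omap (dgm E) x)
      (comp_mor C (mor_of (amap (dgm E) i')) (mor_of (amap (dgm E) i)))"
  proof -
    obtain m n where mn: "amap (dgm E) i = (omap (dgm E) x, m, omap (dgm E) x')"
      "amap (dgm E) i' = (omap (dgm E) x', n, omap (dgm E) x'')"
      using amap_E(1)[OF i] amap_E(1)[OF i'] by blast
    show ?thesis
      unfolding is_functorD(6)[OF functor_E i i'] mn by simp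
  qed
  then show "y \<in> ob (E0_ob E x) \<Longrightarrow> omap (E0_ar E (cmp I i' i)) y = omap (E0_ar E i') (omap (E0_ar E i) y)"
    "f \<in> ar (E0_ob E x) \<Longrightarrow> amap (E0_ar E (cmp I i' i)) f = amap (E0_ar E i') (amap (E0_ar E i) f)"
    "y \<in> ob (E0_ob E x) \<Longrightarrow>
      E1_ar E (cmp I i' i) y = cmp C (E1_ar E i' (omap (E0_ar E i) y)) (E1_ar E i y)"
    by (simp_all add: restrict_mor_simps)
qed

abbreviation G where "G \<equiv> grothendieck I (E0_ob E) (E0_ar E)"

lemma G_ar: "((x, y), (i, f), (x', y')) \<in> ar G \<longleftrightarrow>
    i \<in> hom I x x' \<and> y \<in> ob (E0_ob E x) \<and> f \<in> hom (E0_ob E x') (omap (E0_ar E i) y) y'"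
proof -
  have "y' \<in> ob (E0_ob E x')" if "i \<in> hom I x x'" "f \<in> hom (E0_ob E x') (omap (E0_ar E i) y) y'"
    using category.hom_ob(2)[OF category_E0 that(2)] I.hom_ob[OF that(1)] by blast
  then show ?thesis
    by (auto simp: grothendieck_def)
qed

lemma G_hom: "((x, y), (i, f), (x', y')) \<in> hom G (x, y) (x', y') \<longleftrightarrow>
    i \<in> hom I x x' \<and> y \<in> ob (E0_ob E x) \<and> f \<in> hom (E0_ob E x') (omap (E0_ar E i) y) y'"
  using G_ar by (auto simp: hom_def)

lemma G_arE:
  assumes "a \<in> ar G"
  obtains x y i f x' y' where "a = ((x, y), (i, f), (x', y'))" "i \<in> hom I x x'"
    "y \<in> ob (E0_ob E x)" "f \<in> hom (E0_ob E x') (omap (E0_ar E i) y) y'"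
proof -
  obtain x y i f x' y' where e: "a = ((x, y), (i, f), (x', y'))"
    by (metis surj_pair)
  show ?thesis
    using assms unfolding e G_ar by (intro that[OF e]) auto
qed

lemma G_homE:
  assumes "a \<in> hom G p q"
  obtains x y i f x' y' where "a = ((x, y), (i, f), (x', y'))" "p = (x, y)" "q = (x', y')" "i \<in> hom I x x'"
    "y \<in> ob (E0_ob E x)" "f \<in> hom (E0_ob E x') (omap (E0_ar E i) y) y'"
  using G_arE[OF homD(1)[OF assms]] homD(2,3)[OF assms] by (metis grothendieck_simps(2,3))

lemma category_G: "category G"
proof
  fix a assume "a \<in> ar G"
  then obtain x y i f x' y' where a: "a = ((x, y), (i, f), (x', y'))" "i \<in> hom I x x'"
    "y \<in> ob (E0_ob E x)" "f \<in> hom (E0_ob E x') (omap (E0_ar E i) y) y'"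
    by (rule G_arE)
  note x = I.hom_ob[OF a(2)]
  note E' = category_E0[OF x(2)]
  show "src G a \<in> ob G" "tgt G a \<in> ob G"
    using a x category.hom_ob(2)[OF E' a(4)] by simp_all
  have "amap (E0_ar E i) (idt (E0_ob E x) y) = idt (E0_ob E x') (omap (E0_ar E i) y)"
    by (rule is_functorD(5)[OF functor_E0[OF a(2)] a(3)])
  then show "cmp G a (idt G (src G a)) = a"
    using I.idt_right[OF a(2)] category.idt_right[OF E' a(4)] by (simp add: a(1))
  show "cmp G (idt G (tgt G a)) a = a"
    using I.idt_left[OF a(2)] category.idt_left[OF E' a(4)] E_idt(2)[OF x(2) homD(1)[OF a(4)]]
    by (simp add: a(1))
next
  fix p assume p: "p \<in> ob G"
  obtain x y where e: "p = (x, y)" by (cases p)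
  have xy: "x \<in> ob I" "y \<in> ob (E0_ob E x)"
    using p by (auto simp: e)
  show "idt G p \<in> hom G p p"
    unfolding e grothendieck_simps G_hom
    using xy I.idt_hom[OF xy(1)] category.idt_hom[OF category_E0[OF xy(1)] xy(2)] E_idt(1)[OF xy]
    by simp
next
  fix a b assume ab: "a \<in> ar G" "b \<in> ar G" "tgt G a = src G b"
  obtain x y i f x' y' where a: "a = ((x, y), (i, f), (x', y'))" "i \<in> hom I x x'"
    "y \<in> ob (E0_ob E x)" "f \<in> hom (E0_ob E x') (omap (E0_ar E i) y) y'"
    using ab(1) by (rule G_arE)
  obtain i' f' x'' y'' where b: "b = ((x', y'), (i', f'), (x'', y''))" "i' \<in> hom I x' x''"
    "f' \<in> hom (E0_ob E x'') (omap (E0_ar E i') y') y''"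
    using ab(2,3) by (elim G_arE) (auto simp: a(1))
  note x = I.hom_ob[OF b(2)]
  have "cmp (E0_ob E x'') f' (amap (E0_ar E i') f) \<in>
      hom (E0_ob E x'') (omap (E0_ar E i') (omap (E0_ar E i) y)) y''"
    by (rule category.cmp_in_hom[OF category_E0[OF x(2)] E0_hom[OF b(2) a(4)] b(3)])
  then show "cmp G b a \<in> hom G (src G a) (tgt G b)"
    unfolding a(1) b(1) grothendieck_simps G_hom
    using I.cmp_in_hom[OF a(2) b(2)] a(3) E_cmp(1)[OF a(2) b(2) a(3)] by simp
  fix d assume d': "d \<in> ar G" "tgt G b = src G d"
  obtain i'' f'' x3 y3 where d: "d = ((x'', y''), (i'', f''), (x3, y3))" "i'' \<in> hom I x'' x3"
    "f'' \<in> hom (E0_ob E x3) (omap (E0_ar E i'') y'') y3"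
    using d' by (elim G_arE) (auto simp: b(1))
  note x3 = I.hom_ob[OF d(2)]
  \<comment> \<open>In the fibre part, the functor \<open>E0_ar E i''\<close> distributes over the
    inner composite, and \<open>E_cmp\<close> identifies iterated transport of \<open>f\<close> with
    transport along the composite.\<close>
  have "cmp (E0_ob E x3) f'' (amap (E0_ar E i'') (cmp (E0_ob E x'') f' (amap (E0_ar E i') f)))
    = cmp (E0_ob E x3) f'' (cmp (E0_ob E x3) (amap (E0_ar E i'') f') (amap (E0_ar E i'') (amap (E0_ar E i') f)))"
    using is_functorD(6)[OF functor_E0[OF d(2)] E0_hom[OF b(2) a(4)] b(3)] by simp
  also have "\<dots> = cmp (E0_ob E x3) (cmp (E0_ob E x3) f'' (amap (E0_ar E i'') f'))
      (amap (E0_ar E i'') (amap (E0_ar E i') f))"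
    by (rule category.assoc[OF category_E0[OF x3(2)] E0_hom[OF d(2) E0_hom[OF b(2) a(4)]]
          E0_hom[OF d(2) b(3)] d(3)])
  finally show "cmp G d (cmp G b a) = cmp G (cmp G d b) a"
    using I.assoc[OF a(2) b(2) d(2)] E_cmp(2)[OF b(2) d(2) homD(1)[OF a(4)]]
    by (simp add: a(1) b(1) d(1))
qed

lemma mult_simps [simp]:
  "shape (mult C E) = G"
  "omap (dgm (mult C E)) (x, y) = omap (E1_ob E x) y"
  "amap (dgm (mult C E)) ((x, y), (i, f), (x', y')) = cmp C (amap (E1_ob E x') f) (E1_ar E i y)"
  by (simp_all add: mult_def)

lemma functor_mult: "is_functor G C (dgm (mult C E))"
proof (rule is_functorI[OF category_G])
  show "category C" by (rule category_axioms)
next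
  fix p assume p: "p \<in> ob G"
  obtain x y where e: "p = (x, y)" by (cases p)
  have xy: "x \<in> ob I" "y \<in> ob (E0_ob E x)"
    using p by (auto simp: e)
  have C: "omap (E1_ob E x) y \<in> ob C"
    by (rule is_functorD(3)[OF functor_E1[OF xy(1)] xy(2)])
  then show "omap (dgm (mult C E)) p \<in> ob C"
    by (simp add: e)
  show "amap (dgm (mult C E)) (idt G p) = idt C (omap (dgm (mult C E)) p)"
    using is_functorD(5)[OF functor_E1[OF xy(1)] xy(2)] E_idt(3)[OF xy] idt_left[OF idt_hom[OF C]]
    by (simp add: e)
next
  fix a p q assume "a \<in> hom G p q"
  then obtain x y i f x' y' where a: "a = ((x, y), (i, f), (x', y'))" "p = (x, y)" "q = (x', y')" "i \<in> hom I x x'"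
    "y \<in> ob (E0_ob E x)" "f \<in> hom (E0_ob E x') (omap (E0_ar E i) y) y'"
    by (rule G_homE)
  show "amap (dgm (mult C E)) a \<in> hom C (omap (dgm (mult C E)) p) (omap (dgm (mult C E)) q)"
    using cmp_in_hom[OF E1_hom[OF a(4,5)] is_functorD(4)[OF functor_E1 a(6)]] I.hom_ob[OF a(4)]
    by (simp add: a(1,2,3))
  fix b r assume "b \<in> hom G q r"
  then obtain i' f' x'' y'' where b: "b = ((x', y'), (i', f'), (x'', y''))" "r = (x'', y'')" "i' \<in> hom I x' x''"
    "f' \<in> hom (E0_ob E x'') (omap (E0_ar E i') y') y''"
    by (elim G_homE) (auto simp: a(3))
  note x = I.hom_ob[OF b(3)]
  let ?e = "amap (E1_ob E x'')"
  note F = functor_E1[OF x(2)]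
  have Tf: "amap (E0_ar E i') f \<in> hom (E0_ob E x'') (omap (E0_ar E i') (omap (E0_ar E i) y)) (omap (E0_ar E i') y')"
    by (rule E0_hom[OF b(3) a(6)])
  note h1 = E1_hom[OF a(4,5)]
  note h2 = E1_hom[OF b(3) E0_ob[OF a(4,5)]]
  note y' = category.hom_ob(2)[OF category_E0[OF x(1)] a(6)]
  note h3 = E1_hom[OF b(3) y']
  note ef = is_functorD(4)[OF functor_E1[OF x(1)] a(6)]
  note eTf = is_functorD(4)[OF F Tf] and ef' = is_functorD(4)[OF F b(4)]
  \<comment> \<open>The essential step of this chain is \<open>E1_nat\<close>: it moves the
    transition component of \<open>i'\<close> from before the transported \<open>f\<close> to after
    \<open>f\<close> itself.\<close>
  have "cmp C (?e (cmp (E0_ob E x'') f' (amap (E0_ar E i') f)))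
      (cmp C (E1_ar E i' (omap (E0_ar E i) y)) (E1_ar E i y))
    = cmp C (cmp C (?e f') (?e (amap (E0_ar E i') f))) (cmp C (E1_ar E i' (omap (E0_ar E i) y)) (E1_ar E i y))"
    using is_functorD(6)[OF F Tf b(4)] by simp
  also have "\<dots> = cmp C (?e f') (cmp C (?e (amap (E0_ar E i') f)) (cmp C (E1_ar E i' (omap (E0_ar E i) y)) (E1_ar E i y)))"
    by (rule assoc[OF cmp_in_hom[OF h1 h2] eTf ef', symmetric])
  also have "\<dots> = cmp C (?e f') (cmp C (cmp C (?e (amap (E0_ar E i') f)) (E1_ar E i' (omap (E0_ar E i) y))) (E1_ar E i y))"
    using assoc[OF h1 h2 eTf] by simp
  also have "\<dots> = cmp C (?e f') (cmp C (cmp C (E1_ar E i' y') (amap (E1_ob E x') f)) (E1_ar E i y))"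
    using E1_nat[OF b(3) a(6)] by simp
  also have "\<dots> = cmp C (?e f') (cmp C (E1_ar E i' y') (cmp C (amap (E1_ob E x') f) (E1_ar E i y)))"
    using assoc[OF h1 ef h3] by simp
  also have "\<dots> = cmp C (cmp C (?e f') (E1_ar E i' y')) (cmp C (amap (E1_ob E x') f) (E1_ar E i y))"
    by (rule assoc[OF cmp_in_hom[OF h1 ef] h3 ef'])
  finally show "amap (dgm (mult C E)) (cmp G b a) = cmp C (amap (dgm (mult C E)) b) (amap (dgm (mult C E)) a)"
    using E_cmp(3)[OF a(4) b(3) a(5)] by (simp add: a(1) b(1))
qed

section \<open>Vertical arrows and canonical lifts\<close>

definition vert where
  "vert x f = ((x, src (E0_ob E x) f), (idt I x, f), (x, tgt (E0_ob E x) f))"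

text \<open>The canonical opcartesian lift of \<open>i\<close> at \<open>y\<close>, the arrow by
  which \<open>corresponds\<close> prescribes the splitting. Together with \<open>vert\<close> it
  generates the arrows of \<open>G\<close>, see \<open>vert_cmp_lift\<close>.\<close>

definition lift where
  "lift y i = ((src I i, y), (i, idt (E0_ob E (tgt I i)) (omap (E0_ar E i) y)), (tgt I i, omap (E0_ar E i) y))"

lemma vert_hom:
  assumes "x \<in> ob I" "f \<in> hom (E0_ob E x) y y'"
  shows "vert x f \<in> hom G (x, y) (x, y')"
  using assms I.idt_hom category.hom_ob(1)[OF category_E0[OF assms(1)] assms(2)] E_idt(1)[OF assms(1)]
  by (simp add: vert_def G_hom homD[OF assms(2)])

lemma lift_hom:
  assumes "i \<in> hom I x x'" "y \<in> ob (E0_ob E x)"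
  shows "lift y i \<in> hom G (x, y) (x', omap (E0_ar E i) y)"
  using assms category.idt_hom[OF category_E0 E0_ob[OF assms]] I.hom_ob[OF assms(1)]
  by (simp add: lift_def G_hom homD[OF assms(1)])

lemma lift_eq:
  assumes "i \<in> hom I x x'"
  shows "lift y i = ((x, y), (i, idt (E0_ob E x') (omap (E0_ar E i) y)), (x', omap (E0_ar E i) y))"
  by (simp add: lift_def homD[OF assms])

text \<open>Transport along \<open>i'\<close> sends the identity inside \<open>lift y i\<close> to
  an identity, so precomposing with a lift changes the base arrow and keeps the fibre arrow. The
  opcartesian property of lifts rests on this.\<close>

lemma cmp_lift:
  assumes i: "i \<in> hom I x x'" and y: "y \<in> ob (E0_ob E x)" and i': "i' \<in> hom I x' x''"
    and f: "f \<in> hom (E0_ob E x'') (omap (E0_ar E i') (omap (E0_ar E i) y)) y''"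
  shows "cmp G ((x', omap (E0_ar E i) y), (i', f), (x'', y'')) (lift y i) =
    ((x, y), (cmp I i' i, f), (x'', y''))"
proof -
  have "amap (E0_ar E i') (idt (E0_ob E x') (omap (E0_ar E i) y)) =
      idt (E0_ob E x'') (omap (E0_ar E i') (omap (E0_ar E i) y))"
    by (rule is_functorD(5)[OF functor_E0[OF i'] E0_ob[OF i y]])
  then show ?thesis
    using category.idt_right[OF category_E0 f] I.hom_ob[OF i'] by (simp add: lift_eq[OF i])
qed

lemma vert_cmp_lift:
  assumes "i \<in> hom I x x'" "y \<in> ob (E0_ob E x)" "f \<in> hom (E0_ob E x') (omap (E0_ar E i) y) y'"
  shows "cmp G (vert x' f) (lift y i) = ((x, y), (i, f), (x', y'))"
proof -
  have x': "x' \<in> ob I"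
    by (rule I.hom_ob(2)[OF assms(1)])
  show ?thesis
    using cmp_lift[OF assms(1,2) I.idt_hom[OF x'], of f y'] assms(3) E_idt(1)[OF x' E0_ob[OF assms(1,2)]]
      I.idt_left[OF assms(1)]
    by (simp add: vert_def homD[OF assms(3)])
qed

text \<open>Both sides have base arrow \<open>i\<close> and, as fibre arrow, the transport of
  \<open>f\<close>. Under a functor preserving lifts and vertical arrows this exchange law becomes
  compatibility with transport.\<close>

lemma lift_cmp_vert:
  assumes i: "i \<in> hom I x x'" and f: "f \<in> hom (E0_ob E x) y y'"
  shows "cmp G (lift y' i) (vert x f) = cmp G (vert x' (amap (E0_ar E i) f)) (lift y i)"
proof -
  note x = I.hom_ob[OF i]
  note y = category.hom_ob[OF category_E0[OF x(1)] f]
  note Tf = E0_hom[OF i f]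
  show ?thesis
    using vert_cmp_lift[OF i y(1) Tf] I.idt_right[OF i] category.idt_left[OF category_E0[OF x(2)] Tf]
    by (simp add: lift_eq[OF i] vert_def homD[OF f])
qed

lemma lift_idt:
  assumes "x \<in> ob I" "y \<in> ob (E0_ob E x)"
  shows "lift y (idt I x) = idt G (x, y)"
  using assms E_idt(1)[OF assms] by (simp add: lift_eq[OF I.idt_hom[OF assms(1)]])

lemma lift_cmp:
  assumes "i \<in> hom I x x'" "i' \<in> hom I x' x''" "y \<in> ob (E0_ob E x)"
  shows "lift y (cmp I i' i) = cmp G (lift (omap (E0_ar E i) y) i') (lift y i)"
proof -
  have "cmp G (lift (omap (E0_ar E i) y) i') (lift y i) = ((x, y),
     (cmp I i' i, idt (E0_ob E x'') (omap (E0_ar E i') (omap (E0_ar E i) y))), x'', omap (E0_ar E i') (omap (E0_ar E i) y))"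
    unfolding lift_eq[OF assms(2)]
    using category.idt_hom[OF category_E0 E0_ob[OF assms(2) E0_ob[OF assms(1,3)]]] I.hom_ob[OF assms(2)]
    by (intro cmp_lift assms) auto
  then show ?thesis
    by (simp add: lift_eq[OF I.cmp_in_hom[OF assms(1,2)]] E_cmp(1)[OF assms])
qed

text \<open>Together with \<open>mult_lift\<close>: the two kinds of generators of \<open>G\<close>
  recover the diagrams \<open>E1_ob E x\<close> and the transition components
  \<open>E1_ar E i\<close> separately.\<close>

lemma mult_vert:
  assumes "x \<in> ob I" "f \<in> hom (E0_ob E x) y y'"
  shows "amap (dgm (mult C E)) (vert x f) = amap (E1_ob E x) f"
  using assms category.hom_ob(1)[OF category_E0[OF assms(1)] assms(2)] E_idt(3)[OF assms(1)]
    idt_right[OF is_functorD(4)[OF functor_E1[OF assms(1)] assms(2)]]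
  by (simp add: vert_def homD[OF assms(2)])

lemma mult_lift:
  assumes "i \<in> hom I x x'" "y \<in> ob (E0_ob E x)"
  shows "amap (dgm (mult C E)) (lift y i) = E1_ar E i y"
  using is_functorD(5)[OF functor_E1 E0_ob[OF assms]] I.hom_ob[OF assms(1)] idt_left[OF E1_hom[OF assms]]
  by (simp add: lift_eq[OF assms(1)])

lemma vert_cmp:
  assumes x: "x \<in> ob I" and f: "f \<in> hom (E0_ob E x) y y'" and g: "g \<in> hom (E0_ob E x) y' y''"
  shows "vert x (cmp (E0_ob E x) g f) = cmp G (vert x g) (vert x f)"
  using homD[OF f] homD[OF g] homD[OF category.cmp_in_hom[OF category_E0[OF x] f g]]
    E_idt(2)[OF x homD(1)[OF f]] I.idt_left[OF I.idt_hom[OF x]]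
  by (simp add: vert_def)

lemma vert_idt:
  assumes "x \<in> ob I" "y \<in> ob (E0_ob E x)"
  shows "vert x (idt (E0_ob E x) y) = idt G (x, y)"
  using homD[OF category.idt_hom[OF category_E0[OF assms(1)] assms(2)]] by (simp add: vert_def)

lemma functor_colim_push:
  assumes "colimit_choice C c"
  shows "is_functor I C (dgm (colim_push C c E))"
  using is_functor_comp[OF functor_E is_functor_colim_ftr[OF category_axioms assms]]
  by (simp add: colim_push_def)

end

lemma is_colimit_factor:
  assumes "is_colimit C X x l" "is_cocone C X y m"
  obtains h where "h \<in> hom C x y" "\<And>j. j \<in> ob (shape X) \<Longrightarrow> cmp C h (l j) = m j"
  using is_colimitD(2)[OF assms] by (elim ex1E) blast

section \<open>Split opfibrations and pointwise Kan extensions\<close>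

lemma comma_simps [simp]:
  "(j, u) \<in> ob (comma J K F k) \<longleftrightarrow> j \<in> ob J \<and> u \<in> hom K (omap F j) k"
  "((j, u), g, (j', u')) \<in> hom (comma J K F k) p q \<longleftrightarrow> p = (j, u) \<and> q = (j', u') \<and>
     u \<in> hom K (omap F j) k \<and> u' \<in> hom K (omap F j') k \<and> g \<in> hom J j j' \<and> cmp K u' (amap F g) = u"
  "idt (comma J K F k) (j, u) = ((j, u), idt J j, (j, u))"
  "cmp (comma J K F k) (q', g', r) (p, g, q) = (p, cmp J g' g, r)"
  by (auto simp: comma_def hom_def)

lemma comma_homE:
  assumes "a \<in> hom (comma J K F k) p q"
  obtains j u g j' u' where "a = ((j, u), g, (j', u'))" "p = (j, u)" "q = (j', u')"
     "u \<in> hom K (omap F j) k" "u' \<in> hom K (omap F j') k" "g \<in> hom J j j'" "cmp K u' (amap F g) = u"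
proof -
  obtain j u g j' u' where a: "a = ((j, u), g, (j', u'))"
    by (metis surj_pair)
  show ?thesis
    using assms unfolding a comma_simps by (intro that[OF a]) auto
qed

lemma category_comma:
  assumes F: "is_functor J K F"
  shows "category (comma J K F k)"
proof -
  interpret J: category J by (rule is_functorD(1)[OF F])
  interpret K: category K by (rule is_functorD(2)[OF F])
  let ?C = "comma J K F k"
  have st: "src ?C (p, g, q) = p" "tgt ?C (p, g, q) = q" for p g q
    by (simp_all add: comma_def)
  have ar: "a \<in> ar ?C \<longleftrightarrow> a \<in> hom ?C (src ?C a) (tgt ?C a)" for a
    by (simp add: hom_def)
  have cmp: "cmp K u'' (amap F (cmp J g' g)) = u"
    if "u'' \<in> hom K (omap F j'') k" "g \<in> hom J j j'" "g' \<in> hom J j' j''"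
      "cmp K u'' (amap F g') = u'" "cmp K u' (amap F g) = u" for u u' u'' j j' j'' g g'
    using K.assoc[OF is_functorD(4)[OF F that(2)] is_functorD(4)[OF F that(3)] that(1)]
      is_functorD(6)[OF F that(2,3)] that(4,5) by simp
  show ?thesis
  proof
    fix a assume "a \<in> ar ?C"
    then have "a \<in> hom ?C (src ?C a) (tgt ?C a)" by (simp add: ar)
    then obtain j u g j' u' where a: "a = ((j, u), g, (j', u'))"
      "u \<in> hom K (omap F j) k" "u' \<in> hom K (omap F j') k" "g \<in> hom J j j'" "cmp K u' (amap F g) = u"
      by (rule comma_homE)
    show "src ?C a \<in> ob ?C" "tgt ?C a \<in> ob ?C" "cmp ?C a (idt ?C (src ?C a)) = a"
      "cmp ?C (idt ?C (tgt ?C a)) a = a"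
      using a(2,3) J.hom_ob[OF a(4)] J.idt_left[OF a(4)] J.idt_right[OF a(4)] by (simp_all add: a(1) st)
  next
    fix p assume "p \<in> ob ?C"
    then show "idt ?C p \<in> hom ?C p p"
      using J.idt_hom is_functorD(5)[OF F] K.idt_right by (cases p) auto
  next
    fix a b assume ab: "a \<in> ar ?C" "b \<in> ar ?C" "tgt ?C a = src ?C b"
    obtain j u g j' u' where a: "a = ((j, u), g, (j', u'))"
      "u \<in> hom K (omap F j) k" "u' \<in> hom K (omap F j') k" "g \<in> hom J j j'" "cmp K u' (amap F g) = u"
      using ab(1) unfolding ar[of a] by (rule comma_homE)
    obtain g' j'' u'' where b: "b = ((j', u'), g', (j'', u''))"
      "u'' \<in> hom K (omap F j'') k" "g' \<in> hom J j' j''" "cmp K u'' (amap F g') = u'"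
      using ab(2,3) ar[of b] by (auto simp: a(1) st elim!: comma_homE)
    show "cmp ?C b a \<in> hom ?C (src ?C a) (tgt ?C b)"
      using a(2) b(2) J.cmp_in_hom[OF a(4) b(3)] cmp[OF b(2) a(4) b(3,4) a(5)] by (simp add: a(1) b(1) st)
    fix d assume d': "d \<in> ar ?C" "tgt ?C b = src ?C d"
    obtain g'' j3 u3 where d: "d = ((j'', u''), g'', (j3, u3))" "g'' \<in> hom J j'' j3"
      using d' ar[of d] by (auto simp: b(1) st elim!: comma_homE)
    show "cmp ?C d (cmp ?C b a) = cmp ?C (cmp ?C d b) a"
      using J.assoc[OF a(4) b(3) d(2)] by (simp add: a(1) b(1) d(1))
  qed
qed

lemma comma_dgm_simps [simp]:
  "shape (comma_dgm D K F k) = comma (shape D) K F k"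
  "omap (dgm (comma_dgm D K F k)) (j, u) = omap (dgm D) j"
  "amap (dgm (comma_dgm D K F k)) (p, g, q) = amap (dgm D) g"
  by (simp_all add: comma_dgm_def)

lemma functor_comma_dgm:
  assumes F: "is_functor (shape D) K F" and D: "is_functor (shape D) C (dgm D)"
  shows "is_functor (comma (shape D) K F k) C (dgm (comma_dgm D K F k))"
proof (rule is_functorI[OF category_comma[OF F] is_functorD(2)[OF D]])
  fix a p q b r
  assume a: "a \<in> hom (comma (shape D) K F k) p q" and b: "b \<in> hom (comma (shape D) K F k) q r"
  show "amap (dgm (comma_dgm D K F k)) (cmp (comma (shape D) K F k) b a) =
       cmp C (amap (dgm (comma_dgm D K F k)) b) (amap (dgm (comma_dgm D K F k)) a)"
    using a b is_functorD(6)[OF D] by (auto elim!: comma_homE)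
qed (use is_functorD(3,4,5)[OF D] in \<open>auto elim!: comma_homE\<close>)

text \<open>A subcategory on the original types, so that \<open>dgm D\<close> serves unchanged as
  its diagram. For a functor \<open>F\<close> and an object \<open>k\<close>, an arrow over
  \<open>idt K k\<close> has both ends over \<open>k\<close>.\<close>

definition fibre :: "('i, 'k) cat \<Rightarrow> ('j, 'l) cat \<Rightarrow> ('i, 'k, 'j, 'l) ftr \<Rightarrow> 'j \<Rightarrow> ('i, 'k) cat" where
  "fibre J K F k = \<lparr>ob = {j \<in> ob J. omap F j = k}, ar = {f \<in> ar J. amap F f = idt K k},
     src = src J, tgt = tgt J, idt = idt J, cmp = cmp J\<rparr>"

definition fibre_dgm ::
  "('i, 'k, 'o, 'a) diagram \<Rightarrow> ('j, 'l) cat \<Rightarrow> ('i, 'k, 'j, 'l) ftr \<Rightarrow> 'j \<Rightarrow> ('i, 'k, 'o, 'a) diagram" where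
  "fibre_dgm D K F k = \<lparr>shape = fibre (shape D) K F k, dgm = dgm D\<rparr>"

lemma fibre_simps [simp]:
  "j \<in> ob (fibre J K F k) \<longleftrightarrow> j \<in> ob J \<and> omap F j = k"
  "f \<in> ar (fibre J K F k) \<longleftrightarrow> f \<in> ar J \<and> amap F f = idt K k"
  "f \<in> hom (fibre J K F k) i j \<longleftrightarrow> f \<in> hom J i j \<and> amap F f = idt K k"
  "src (fibre J K F k) = src J" "tgt (fibre J K F k) = tgt J"
  "idt (fibre J K F k) = idt J" "cmp (fibre J K F k) = cmp J"
  by (auto simp: fibre_def hom_def)

lemma fibre_dgm_simps [simp]:
  "shape (fibre_dgm D K F k) = fibre (shape D) K F k" "dgm (fibre_dgm D K F k) = dgm D"
  by (simp_all add: fibre_dgm_def)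

lemma category_fibre:
  assumes F: "is_functor J K F" and k: "k \<in> ob K"
  shows "category (fibre J K F k)"
proof -
  interpret J: category J by (rule is_functorD(1)[OF F])
  interpret K: category K by (rule is_functorD(2)[OF F])
  have st: "omap F (src J f) = k" "omap F (tgt J f) = k" if "f \<in> ar J" "amap F f = idt K k" for f
    using is_functor_ar(2,3)[OF F that(1)] that(2) K.idt_ar(2,3)[OF k] by simp_all
  show ?thesis
  proof
    fix f g assume fg: "f \<in> ar (fibre J K F k)" "g \<in> ar (fibre J K F k)"
      "tgt (fibre J K F k) f = src (fibre J K F k) g"
    have "amap F (cmp J g f) = cmp K (amap F g) (amap F f)"
      using fg is_functorD(6)[OF F, of f "src J f" "src J g" g "tgt J g"] by (simp add: hom_def)
    then show "cmp (fibre J K F k) g f \<in> hom (fibre J K F k) (src (fibre J K F k) f) (tgt (fibre J K F k) g)"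
      using fg J.cmp_hom K.idt_left[OF K.idt_hom[OF k]] by simp
  qed (use st J.src_ob J.tgt_ob J.idt_hom J.cmp_idt_left J.cmp_idt_right J.cmp_assoc
      is_functorD(5)[OF F] in simp_all)
qed

lemma functor_fibre_dgm:
  assumes F: "is_functor (shape D) K F" and D: "is_functor (shape D) C (dgm D)" and k: "k \<in> ob K"
  shows "is_functor (fibre (shape D) K F k) C (dgm D)"
  by (rule is_functorI[OF category_fibre[OF F k] is_functorD(2)[OF D]]) (auto intro: is_functorD(3-6)[OF D])

section \<open>Opcartesian lifts and transport of objects\<close>

lemma opcartesianD:
  assumes "opcartesian J K F f" "f \<in> hom J i j" "g \<in> hom J i j'"
    and "w \<in> hom K (omap F j) (omap F j')" "amap F g = cmp K w (amap F f)"
  shows "\<exists>!h. h \<in> hom J j j' \<and> amap F h = w \<and> cmp J h f = g"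
proof -
  have "\<forall>g \<in> ar J. \<forall>w \<in> hom K (omap F (tgt J f)) (omap F (tgt J g)).
        src J g = src J f \<and> amap F g = cmp K w (amap F f) \<longrightarrow>
        (\<exists>!h. h \<in> hom J (tgt J f) (tgt J g) \<and> amap F h = w \<and> cmp J h f = g)"
    using assms(1) by (simp add: opcartesian_def)
  from bspec[OF bspec[OF this homD(1)[OF assms(3)]], of w] show ?thesis
    using assms(4,5) homD(2,3)[OF assms(2)] homD(2,3)[OF assms(3)] by simp
qed

locale split_opfib =
  fixes J :: "('i, 'k) cat" and K :: "('j, 'l) cat" and F :: "('i, 'k, 'j, 'l) ftr"
    and s :: "'i \<times> 'l \<Rightarrow> 'k"
  assumes split_opfib: "split_opfibration J K F s"
begin

lemma functor_F: "is_functor J K F"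
  using split_opfib by (simp add: split_opfibration_def)

sublocale J: category J by (rule is_functorD(1)[OF functor_F])
sublocale K: category K by (rule is_functorD(2)[OF functor_F])

text \<open>The object part of transport along \<open>u\<close>, from the fibre over the source of
  \<open>u\<close> to the fibre over its target.\<close>

definition push where "push u j = tgt J (s (j, u))"

context
  fixes j u k
  assumes j: "j \<in> ob J" and u: "u \<in> hom K (omap F j) k"
begin

lemma s_props: "src J (s (j, u)) = j" "amap F (s (j, u)) = u" "opcartesian J K F (s (j, u))"
  using split_opfib j homD[OF u] by (simp_all add: split_opfibration_def)

lemma s_hom: "s (j, u) \<in> hom J j (push u j)"
  using s_props by (simp add: hom_def push_def opcartesian_def)

lemma push_ob: "push u j \<in> ob J"
  by (rule J.hom_ob(2)[OF s_hom])

lemma F_push: "omap F (push u j) = k"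
  using homD(3)[OF is_functorD(4)[OF functor_F s_hom]] homD(3)[OF u] s_props(2) by simp

end

lemma s_idt: "j \<in> ob J \<Longrightarrow> s (j, idt K (omap F j)) = idt J j"
  using split_opfib by (simp add: split_opfibration_def)

lemma push_idt: "j \<in> ob J \<Longrightarrow> push (idt K (omap F j)) j = j"
  using J.idt_ar by (simp add: push_def s_idt)

lemma s_cmp:
  assumes "j \<in> ob J" "u \<in> hom K (omap F j) k" "v \<in> hom K k k'"
  shows "s (j, cmp K v u) = cmp J (s (push u j, v)) (s (j, u))"
  using split_opfib assms(1) homD[OF assms(2)] homD[OF assms(3)]
  by (simp add: split_opfibration_def push_def)

lemma push_cmp:
  assumes "j \<in> ob J" "u \<in> hom K (omap F j) k" "v \<in> hom K k k'"
  shows "push (cmp K v u) j = push v (push u j)"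
proof -
  have "s (push u j, v) \<in> hom J (push u j) (push v (push u j))"
    using s_hom[OF push_ob[OF assms(1,2)]] F_push[OF assms(1,2)] assms(3) by simp
  from homD(3)[OF J.cmp_in_hom[OF s_hom[OF assms(1,2)] this]] show ?thesis
    using s_cmp[OF assms] by (simp add: push_def)
qed

lemma s_factor:
  assumes j: "j \<in> ob J" and u: "u \<in> hom K (omap F j) k" and g: "g \<in> hom J j j'"
    and w: "w \<in> hom K k (omap F j')" and e: "amap F g = cmp K w u"
  shows "\<exists>!h. h \<in> hom J (push u j) j' \<and> amap F h = w \<and> cmp J h (s (j, u)) = g"
  by (rule opcartesianD[OF s_props(3)[OF j u] s_hom[OF j u] g])
    (use w e F_push[OF j u] s_props(2)[OF j u] in simp_all)

text \<open>Both arrows factor the same arrow through the lift over the same base arrow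
  \<open>amap F h\<close>, so the uniqueness in \<open>s_factor\<close> applies.\<close>

lemma s_factor_unique:
  assumes j: "j \<in> ob J" and u: "u \<in> hom K (omap F j) k"
    and h: "h \<in> hom J (push u j) j'" and h': "h' \<in> hom J (push u j) j'"
    and e: "amap F h = amap F h'" "cmp J h (s (j, u)) = cmp J h' (s (j, u))"
  shows "h = h'"
proof -
  note sh = s_hom[OF j u]
  have w: "amap F h \<in> hom K k (omap F j')"
    using is_functorD(4)[OF functor_F h] F_push[OF j u] by simp
  have "\<exists>!k. k \<in> hom J (push u j) j' \<and> amap F k = amap F h \<and> cmp J k (s (j, u)) = cmp J h (s (j, u))"
    by (rule s_factor[OF j u J.cmp_in_hom[OF sh h] w])
      (use is_functorD(6)[OF functor_F sh h] s_props(2)[OF j u] in simp)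
  then show ?thesis
    using h h' e by (elim ex1E) metis
qed

end

text \<open>Here \<open>l\<close> is given before any universality, so that its three universal
  properties can be compared: on fibres, on comma categories, and as a Kan extension.\<close>

locale opfib_cocone = split_opfib "shape D" "shape D'" F s
  for C :: "('o, 'a) cat" and D :: "('i, 'k, 'o, 'a) diagram" and D' :: "('j, 'l, 'o, 'a) diagram"
    and F :: "('i, 'k, 'j, 'l) ftr" and s :: "'i \<times> 'l \<Rightarrow> 'k" and l :: "'i \<Rightarrow> 'a" +
  assumes nat: "nat_trans (shape D) C (dgm D) (comp_ftr (dgm D') F) l"
    and functor_D': "is_functor (shape D') C (dgm D')"
begin

abbreviation Fib_dgm where "Fib_dgm \<equiv> fibre_dgm D (shape D') F"
abbreviation Comma_dgm where "Comma_dgm \<equiv> comma_dgm D (shape D') F"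

lemma functor_D: "is_functor (shape D) C (dgm D)"
  by (rule nat_transD(1)[OF nat])

sublocale C: category C by (rule is_functorD(2)[OF functor_D])

lemma l_hom: "j \<in> ob (shape D) \<Longrightarrow> omap F j = k \<Longrightarrow> l j \<in> hom C (omap (dgm D) j) (omap (dgm D') k)"
  using nat_transD(3)[OF nat] by auto

lemma l_nat: "f \<in> hom (shape D) j j' \<Longrightarrow>
    cmp C (l j') (amap (dgm D) f) = cmp C (amap (dgm D') (amap F f)) (l j)"
  using nat_transD(4)[OF nat] by simp

text \<open>Naturality at the chosen lift. It expresses the comma leg at \<open>(j, u)\<close>
  through the fibre leg at \<open>push u j\<close>, the reflection of \<open>(j, u)\<close> into the
  fibre.\<close>

lemma l_push:
  "j \<in> ob (shape D) \<Longrightarrow> u \<in> hom (shape D') (omap F j) k \<Longrightarrow>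
    cmp C (l (push u j)) (amap (dgm D) (s (j, u))) = cmp C (amap (dgm D') u) (l j)"
  using l_nat[OF s_hom] s_props(2) by metis

lemma cocone_fibre:
  assumes k: "k \<in> ob (shape D')"
  shows "is_cocone C (Fib_dgm k) (omap (dgm D') k) l"
proof (rule is_coconeI)
  show "is_functor (shape (Fib_dgm k)) C (dgm (Fib_dgm k))"
    using functor_fibre_dgm[OF functor_F functor_D k] by simp
  fix f i j assume "f \<in> hom (shape (Fib_dgm k)) i j"
  then have f: "f \<in> hom (shape D) i j" "amap F f = idt (shape D') k"
    by simp_all
  have "omap F i = k"
    using homD(2)[OF is_functorD(4)[OF functor_F f(1)]] K.idt_ar(2)[OF k] f(2) by simp
  then show "cmp C (l j) (amap (dgm (Fib_dgm k)) f) = l i"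
    using l_nat[OF f(1)] f(2) is_functorD(5)[OF functor_D' k] C.idt_left[OF l_hom[OF J.hom_ob(1)[OF f(1)]]]
    by simp
qed (use is_functorD(3)[OF functor_D' k] l_hom in auto)

lemma cocone_comma:
  assumes k: "k \<in> ob (shape D')"
  shows "is_cocone C (Comma_dgm k) (omap (dgm D') k) (\<lambda>(j, u). cmp C (amap (dgm D') u) (l j))"
proof (rule is_coconeI)
  show "is_functor (shape (Comma_dgm k)) C (dgm (Comma_dgm k))"
    using functor_comma_dgm[OF functor_F functor_D] by simp
  show "omap (dgm D') k \<in> ob C"
    by (rule is_functorD(3)[OF functor_D' k])
  fix p assume "p \<in> ob (shape (Comma_dgm k))"
  then show "(\<lambda>(j, u). cmp C (amap (dgm D') u) (l j)) p
      \<in> hom C (omap (dgm (Comma_dgm k)) p) (omap (dgm D') k)"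
    using C.cmp_in_hom[OF l_hom[OF _ refl] is_functorD(4)[OF functor_D']] by (cases p) simp
next
  fix a p q assume "a \<in> hom (shape (Comma_dgm k)) p q"
  then obtain j u g j' u' where a: "a = ((j, u), g, (j', u'))" "p = (j, u)" "q = (j', u')"
    "u \<in> hom (shape D') (omap F j) k" "u' \<in> hom (shape D') (omap F j') k" "g \<in> hom (shape D) j j'"
    "cmp (shape D') u' (amap F g) = u"
    unfolding comma_dgm_simps by (rule comma_homE)
  note g = J.hom_ob[OF a(6)]
  note Fg = is_functorD(4)[OF functor_F a(6)]
  have "cmp C (cmp C (amap (dgm D') u') (l j')) (amap (dgm D) g)
      = cmp C (amap (dgm D') u') (cmp C (l j') (amap (dgm D) g))"
    by (rule C.assoc[OF is_functorD(4)[OF functor_D a(6)] l_hom[OF g(2) refl] is_functorD(4)[OF functor_D' a(5)], symmetric])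
  also have "\<dots> = cmp C (cmp C (amap (dgm D') u') (amap (dgm D') (amap F g))) (l j)"
    unfolding l_nat[OF a(6)]
    by (rule C.assoc[OF l_hom[OF g(1) refl] is_functorD(4)[OF functor_D' Fg] is_functorD(4)[OF functor_D' a(5)]])
  also have "\<dots> = cmp C (amap (dgm D') u) (l j)"
    using is_functorD(6)[OF functor_D' Fg a(5)] a(7) by simp
  finally show "cmp C ((\<lambda>(j, u). cmp C (amap (dgm D') u) (l j)) q) (amap (dgm (Comma_dgm k)) a) =
      (\<lambda>(j, u). cmp C (amap (dgm D') u) (l j)) p"
    by (simp add: a(1,2,3))
qed

text \<open>For an opfibration the fibre over \<open>k\<close> is reflective in \<open>F \<down> k\<close>, with \<open>(j, u)\<close> reflected to the
  codomain of the opcartesian lift of \<open>u\<close>; so cocones on the comma category and on the fibre agree.\<close>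

lemma colimit_comma_if_colimit_fibre:
  assumes k: "k \<in> ob (shape D')"
    and col: "is_colimit C (Fib_dgm k) (omap (dgm D') k) l"
  shows "is_colimit C (Comma_dgm k) (omap (dgm D') k) (\<lambda>(j, u). cmp C (amap (dgm D') u) (l j))"
proof (rule is_colimitI[OF cocone_comma[OF k]])
  fix y m assume m: "is_cocone C (Comma_dgm k) y m"
  note M = is_coconeD[OF m]
  have id: "idt (shape D') k \<in> hom (shape D') k k"
    by (rule K.idt_hom[OF k])
  \<comment> \<open>The cocone is restricted along the inclusion
    \<open>j \<mapsto> (j, idt k)\<close> of the fibre into the comma category.\<close>
  have "is_cocone C (Fib_dgm k) y (\<lambda>j. m (j, idt (shape D') k))"
  proof (rule is_coconeI)
    show "is_functor (shape (Fib_dgm k)) C (dgm (Fib_dgm k))"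
      using functor_fibre_dgm[OF functor_F functor_D k] by simp
    fix j assume "j \<in> ob (shape (Fib_dgm k))"
    then show "m (j, idt (shape D') k) \<in> hom C (omap (dgm (Fib_dgm k)) j) y"
      using M(3)[of "(j, idt (shape D') k)"] id by auto
  next
    fix f i j assume "f \<in> hom (shape (Fib_dgm k)) i j"
    then have f: "f \<in> hom (shape D) i j" "amap F f = idt (shape D') k" by simp_all
    have "omap F i = k" "omap F j = k"
      using homD(2,3)[OF is_functorD(4)[OF functor_F f(1)]] K.idt_ar(2,3)[OF k] f(2) by simp_all
    then show "cmp C (m (j, idt (shape D') k)) (amap (dgm (Fib_dgm k)) f) = m (i, idt (shape D') k)"
      using M(4)[of "((i, idt (shape D') k), f, (j, idt (shape D') k))"] f id K.idt_left[OF id] by simp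
  qed (rule M(2))
  then obtain h where h: "h \<in> hom C (omap (dgm D') k) y" and hl':
    "\<And>j. j \<in> ob (shape (Fib_dgm k)) \<Longrightarrow> cmp C h (l j) = m (j, idt (shape D') k)"
    by (rule is_colimit_factor[OF col]) blast
  have hl: "cmp C h (l j) = m (j, idt (shape D') k)" if "j \<in> ob (shape D)" "omap F j = k" for j
    by (rule hl') (use that in simp)
  \<comment> \<open>The chosen lift is an arrow of the comma category from \<open>(j, u)\<close> to
    \<open>(push u j, idt k)\<close>; the cocone condition of \<open>m\<close> there reduces every
    leg to one on the fibre.\<close>
  have "cmp C h (cmp C (amap (dgm D') u) (l j)) = m (j, u)"
    if j: "j \<in> ob (shape D)" and u: "u \<in> hom (shape D') (omap F j) k" for j u
  proof -
    note sh = s_hom[OF j u] and lp = l_hom[OF push_ob[OF j u] F_push[OF j u]]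
    have "cmp C h (cmp C (amap (dgm D') u) (l j)) = cmp C (cmp C h (l (push u j))) (amap (dgm D) (s (j, u)))"
      unfolding l_push[OF j u, symmetric] by (rule C.assoc[OF is_functorD(4)[OF functor_D sh] lp h])
    also have "\<dots> = cmp C (m (push u j, idt (shape D') k)) (amap (dgm D) (s (j, u)))"
      using hl[OF push_ob[OF j u] F_push[OF j u]] by simp
    also have "\<dots> = m (j, u)"
      using M(4)[of "((j, u), s (j, u), (push u j, idt (shape D') k))"] u sh id K.idt_left[OF u]
        s_props(2)[OF j u] F_push[OF j u] by simp
    finally show ?thesis .
  qed
  then show "\<exists>h. h \<in> hom C (omap (dgm D') k) y \<and> (\<forall>p\<in>ob (shape (Comma_dgm k)).
      cmp C h ((\<lambda>(j, u). cmp C (amap (dgm D') u) (l j)) p) = m p)"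
    using h by (intro exI[of _ h]) auto
next
  fix y h h' assume h: "h \<in> hom C (omap (dgm D') k) y" "h' \<in> hom C (omap (dgm D') k) y"
    and eq: "\<forall>p\<in>ob (shape (Comma_dgm k)).
      cmp C h ((\<lambda>(j, u). cmp C (amap (dgm D') u) (l j)) p) = cmp C h' ((\<lambda>(j, u). cmp C (amap (dgm D') u) (l j)) p)"
  show "h = h'"
  proof (rule is_colimit_eqI[OF col h])
    fix j assume "j \<in> ob (shape (Fib_dgm k))"
    then have j: "j \<in> ob (shape D)" "omap F j = k" by simp_all
    show "cmp C h (l j) = cmp C h' (l j)"
      using eq[rule_format, of "(j, idt (shape D') k)"] j K.idt_hom[OF k] is_functorD(5)[OF functor_D' k]
        C.idt_left[OF l_hom[OF j]] by simp
  qed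
qed

text \<open>A cocone \<open>m\<close> on the fibre extends to the comma category by the legs
  \<open>m (push u j)\<close> after \<open>D (s (j, u))\<close>. Uniqueness holds because by
  \<open>l_push\<close> every comma leg factors through a fibre leg.\<close>

lemma colimit_fibre_if_colimit_comma:
  assumes k: "k \<in> ob (shape D')"
    and col: "is_colimit C (Comma_dgm k) (omap (dgm D') k) (\<lambda>(j, u). cmp C (amap (dgm D') u) (l j))"
  shows "is_colimit C (Fib_dgm k) (omap (dgm D') k) l"
proof (rule is_colimitI[OF cocone_fibre[OF k]])
  have id: "idt (shape D') k \<in> hom (shape D') k k"
    by (rule K.idt_hom[OF k])
  have refl: "cmp C h (cmp C (amap (dgm D') u) (l j)) = cmp C (cmp C h (l (push u j))) (amap (dgm D) (s (j, u)))"
    if h: "h \<in> hom C (omap (dgm D') k) y" and j: "j \<in> ob (shape D)" and u: "u \<in> hom (shape D') (omap F j) k"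
    for h j u y
    unfolding l_push[OF j u, symmetric]
    by (rule C.assoc[OF is_functorD(4)[OF functor_D s_hom[OF j u]] l_hom[OF push_ob[OF j u] F_push[OF j u]] h])
  {
    fix y m assume m: "is_cocone C (Fib_dgm k) y m"
    note M = is_coconeD[OF m, unfolded fibre_dgm_simps fibre_simps]
    let ?m = "\<lambda>(j, u). cmp C (m (push u j)) (amap (dgm D) (s (j, u)))"
    have mp: "m (push u j) \<in> hom C (omap (dgm D) (push u j)) y"
      if j: "j \<in> ob (shape D)" and u: "u \<in> hom (shape D') (omap F j) k" for j u
      using M(3) push_ob[OF j u] F_push[OF j u] by simp
    have "is_cocone C (Comma_dgm k) y ?m"
    proof (rule is_coconeI)
      show "is_functor (shape (Comma_dgm k)) C (dgm (Comma_dgm k))"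
        using functor_comma_dgm[OF functor_F functor_D] by simp
      fix p assume "p \<in> ob (shape (Comma_dgm k))"
      then show "?m p \<in> hom C (omap (dgm (Comma_dgm k)) p) y"
        by (cases p) (auto intro: C.cmp_in_hom[OF is_functorD(4)[OF functor_D s_hom] mp])
    next
      fix a p q assume "a \<in> hom (shape (Comma_dgm k)) p q"
      then obtain j u g j' u' where a: "a = ((j, u), g, (j', u'))" "p = (j, u)" "q = (j', u')"
        "u \<in> hom (shape D') (omap F j) k" "u' \<in> hom (shape D') (omap F j') k" "g \<in> hom (shape D) j j'"
        "cmp (shape D') u' (amap F g) = u"
        unfolding comma_dgm_simps by (rule comma_homE)
      note j = J.hom_ob(1)[OF a(6)] and j' = J.hom_ob(2)[OF a(6)]
      note sh = s_hom[OF j a(4)] and sh' = s_hom[OF j' a(5)]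
      have id': "idt (shape D') k \<in> hom (shape D') k (omap F (push u' j'))"
        using id F_push[OF j' a(5)] by simp
      \<comment> \<open>The composite of \<open>g\<close> with the lift of \<open>u'\<close> lies
        over \<open>u\<close>, so it factors through the opcartesian lift of \<open>u\<close> by
        some \<open>h\<close> over \<open>idt k\<close>. This \<open>h\<close> is an arrow of the
        fibre, hence \<open>m\<close> is compatible with it.\<close>
      have "amap F (cmp (shape D) (s (j', u')) g) = cmp (shape D') (idt (shape D') k) u"
        using is_functorD(6)[OF functor_F a(6) sh'] s_props(2)[OF j' a(5)] a(7) K.idt_left[OF a(4)] by simp
      from s_factor[OF j a(4) J.cmp_in_hom[OF a(6) sh'] id' this]
      obtain h where h: "h \<in> hom (shape D) (push u j) (push u' j')" "amap F h = idt (shape D') k"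
        "cmp (shape D) h (s (j, u)) = cmp (shape D) (s (j', u')) g"
        by blast
      have "cmp C (cmp C (m (push u' j')) (amap (dgm D) (s (j', u')))) (amap (dgm D) g)
          = cmp C (m (push u' j')) (cmp C (amap (dgm D) (s (j', u'))) (amap (dgm D) g))"
        by (rule C.assoc[OF is_functorD(4)[OF functor_D a(6)] is_functorD(4)[OF functor_D sh'] mp[OF j' a(5)], symmetric])
      also have "\<dots> = cmp C (m (push u' j')) (cmp C (amap (dgm D) h) (amap (dgm D) (s (j, u))))"
        using is_functorD(6)[OF functor_D a(6) sh'] is_functorD(6)[OF functor_D sh h(1)] h(3) by simp
      also have "\<dots> = cmp C (cmp C (m (push u' j')) (amap (dgm D) h)) (amap (dgm D) (s (j, u)))"
        by (rule C.assoc[OF is_functorD(4)[OF functor_D sh] is_functorD(4)[OF functor_D h(1)] mp[OF j' a(5)]])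
      also have "cmp C (m (push u' j')) (amap (dgm D) h) = m (push u j)"
        using M(4)[of h "push u j"] h by simp
      finally show "cmp C (?m q) (amap (dgm (Comma_dgm k)) a) = ?m p"
        by (simp add: a(1,2,3))
    qed (rule M(2))
    then obtain h where h: "h \<in> hom C (omap (dgm D') k) y" and hm':
      "\<And>p. p \<in> ob (shape (Comma_dgm k)) \<Longrightarrow>
        cmp C h ((\<lambda>(j, u). cmp C (amap (dgm D') u) (l j)) p) = ?m p"
      by (rule is_colimit_factor[OF col]) blast
    have hm: "cmp C h (cmp C (amap (dgm D') u) (l j)) = cmp C (m (push u j)) (amap (dgm D) (s (j, u)))"
      if "j \<in> ob (shape D)" "u \<in> hom (shape D') (omap F j) k" for j u
      using hm'[of "(j, u)"] that by simp
    have "cmp C h (l j) = m j" if j: "j \<in> ob (shape D)" "omap F j = k" for j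
    proof -
      \<comment> \<open>Splitness on identities makes the extended leg at \<open>(j, idt k)\<close>
        equal to \<open>m j\<close>.\<close>
      have "s (j, idt (shape D') k) = idt (shape D) j" "push (idt (shape D') k) j = j"
        using s_idt[OF j(1)] push_idt[OF j(1)] j(2) by simp_all
      then show ?thesis
        using hm[OF j(1), of "idt (shape D') k"] id j is_functorD(5)[OF functor_D' k] C.idt_left[OF l_hom[OF j]]
          is_functorD(5)[OF functor_D j(1)] C.idt_right[OF M(3)[of j]] by simp
    qed
    then show "\<exists>h. h \<in> hom C (omap (dgm D') k) y \<and>
        (\<forall>j\<in>ob (shape (Fib_dgm k)). cmp C h (l j) = m j)"
      using h by (intro exI[of _ h]) auto
  }
  fix y h h' assume h: "h \<in> hom C (omap (dgm D') k) y" "h' \<in> hom C (omap (dgm D') k) y"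
    and eq: "\<forall>j\<in>ob (shape (Fib_dgm k)). cmp C h (l j) = cmp C h' (l j)"
  show "h = h'"
  proof (rule is_colimit_eqI[OF col h])
    fix p assume "p \<in> ob (shape (Comma_dgm k))"
    then obtain j u where p: "p = (j, u)" "j \<in> ob (shape D)" "u \<in> hom (shape D') (omap F j) k"
      by (cases p) simp
    have "cmp C h (l (push u j)) = cmp C h' (l (push u j))"
      using eq push_ob[OF p(2,3)] F_push[OF p(2,3)] by simp
    then show "cmp C h ((\<lambda>(j, u). cmp C (amap (dgm D') u) (l j)) p) =
        cmp C h' ((\<lambda>(j, u). cmp C (amap (dgm D') u) (l j)) p)"
      using refl[OF h(1) p(2,3)] refl[OF h(2) p(2,3)] by (simp add: p(1))
  qed
qed

text \<open>For \<open>j\<close> over \<open>k\<close> the arrows \<open>g j\<close> form a cocone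
  on the fibre over \<open>k\<close>, and this induces the component at \<open>k\<close>. The lifts
  enter in proving that these components are natural.\<close>

lemma left_kan_if_colimit_fibre:
  assumes col: "\<And>k. k \<in> ob (shape D') \<Longrightarrow> is_colimit C (Fib_dgm k) (omap (dgm D') k) l"
  shows "left_kan C D F D' l"
  unfolding left_kan_def
proof (intro conjI allI impI; (elim conjE)?)
  fix G g assume g: "nat_trans (shape D) C (dgm D) (comp_ftr G F) g" and G: "is_functor (shape D') C G"
  note g_hom = nat_transD(3)[OF g, unfolded omap_comp_ftr]
  note g_nat = nat_transD(4)[OF g, unfolded amap_comp_ftr]
  have ex1: "\<exists>!h. h \<in> hom C (omap (dgm D') k) (omap G k) \<and>
      (\<forall>j\<in>ob (shape (Fib_dgm k)). cmp C h (l j) = g j)"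
    if k: "k \<in> ob (shape D')" for k
  proof (rule is_colimitD(2)[OF col[OF k]], rule is_coconeI)
    show "is_functor (shape (Fib_dgm k)) C (dgm (Fib_dgm k))"
      using functor_fibre_dgm[OF functor_F functor_D k] by simp
    show "omap G k \<in> ob C" by (rule is_functorD(3)[OF G k])
    show "g j \<in> hom C (omap (dgm (Fib_dgm k)) j) (omap G k)"
      if "j \<in> ob (shape (Fib_dgm k))" for j
      using that g_hom by auto
    fix f i j assume "f \<in> hom (shape (Fib_dgm k)) i j"
    then have f: "f \<in> hom (shape D) i j" "amap F f = idt (shape D') k" by simp_all
    have "omap F i = k"
      using homD(2)[OF is_functorD(4)[OF functor_F f(1)]] K.idt_ar(2)[OF k] f(2) by simp
    then show "cmp C (g j) (amap (dgm (Fib_dgm k)) f) = g i"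
      using g_nat[OF f(1)] f(2) is_functorD(5)[OF G k] C.idt_left[OF g_hom[OF J.hom_ob(1)[OF f(1)]]] by simp
  qed
  \<comment> \<open>Restricted because \<open>left_kan\<close> asks for a unique extensional
    family.\<close>
  define d where "d = restrict (\<lambda>k. THE h. h \<in> hom C (omap (dgm D') k) (omap G k) \<and>
      (\<forall>j\<in>ob (shape (Fib_dgm k)). cmp C h (l j) = g j)) (ob (shape D'))"
  have d: "d k \<in> hom C (omap (dgm D') k) (omap G k)" "j \<in> ob (shape D) \<Longrightarrow> omap F j = k \<Longrightarrow> cmp C (d k) (l j) = g j"
    if k: "k \<in> ob (shape D')" for k j
    using theI'[OF ex1[OF k]] k by (simp_all add: d_def)
  have "nat_trans (shape D') C (dgm D') G d"
  proof (rule nat_transI[OF functor_D' G d(1)])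
    fix v k k' assume v: "v \<in> hom (shape D') k k'"
    note k = K.hom_ob[OF v]
    note D'v = is_functorD(4)[OF functor_D' v] and Gv = is_functorD(4)[OF G v]
    \<comment> \<open>Tested on the leg at \<open>j\<close>: \<open>l_push\<close> moves the leg to
      the fibre over \<open>k'\<close>, where \<open>d k'\<close> turns it into \<open>g\<close>,
      and naturality of \<open>g\<close> at the lift of \<open>v\<close> brings it back.\<close>
    show "cmp C (d k') (amap (dgm D') v) = cmp C (amap G v) (d k)"
    proof (rule is_colimit_eqI[OF col[OF k(1)] C.cmp_in_hom[OF D'v d(1)[OF k(2)]] C.cmp_in_hom[OF d(1)[OF k(1)] Gv]])
      fix j assume "j \<in> ob (shape (Fib_dgm k))"
      then have j: "j \<in> ob (shape D)" "omap F j = k" by simp_all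
      have u: "v \<in> hom (shape D') (omap F j) k'" using v j by simp
      note p = push_ob[OF j(1) u] F_push[OF j(1) u]
      note sh = s_hom[OF j(1) u]
      have "cmp C (cmp C (d k') (amap (dgm D') v)) (l j) = cmp C (d k') (cmp C (l (push v j)) (amap (dgm D) (s (j, v))))"
        using C.assoc[OF l_hom[OF j] D'v d(1)[OF k(2)]] l_push[OF j(1) u] by simp
      also have "\<dots> = cmp C (g (push v j)) (amap (dgm D) (s (j, v)))"
        using C.assoc[OF is_functorD(4)[OF functor_D sh] l_hom[OF p] d(1)[OF k(2)]] d(2)[OF k(2) p] by simp
      also have "\<dots> = cmp C (amap G v) (g j)"
        using g_nat[OF sh] s_props(2)[OF j(1) u] by simp
      also have "\<dots> = cmp C (cmp C (amap G v) (d k)) (l j)"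
        using C.assoc[OF l_hom[OF j] d(1)[OF k(1)] Gv] d(2)[OF k(1) j] by simp
      finally show "cmp C (cmp C (d k') (amap (dgm D') v)) (l j) = cmp C (cmp C (amap G v) (d k)) (l j)" .
    qed
  qed
  show "\<exists>!d. d \<in> extensional (ob (shape D')) \<and> nat_trans (shape D') C (dgm D') G d \<and>
      (\<forall>j\<in>ob (shape D). cmp C (d (omap F j)) (l j) = g j)"
  proof (rule ex1I[of _ d]; (intro conjI)?)
    show "d \<in> extensional (ob (shape D'))" by (simp add: d_def)
    show "nat_trans (shape D') C (dgm D') G d" by fact
    show "\<forall>j\<in>ob (shape D). cmp C (d (omap F j)) (l j) = g j"
      using d(2) is_functorD(3)[OF functor_F] by blast
    fix e assume e: "e \<in> extensional (ob (shape D')) \<and> nat_trans (shape D') C (dgm D') G e \<and>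
      (\<forall>j\<in>ob (shape D). cmp C (e (omap F j)) (l j) = g j)"
    show "e = d"
    proof (rule extensionalityI[of _ "ob (shape D')"])
      fix k assume k: "k \<in> ob (shape D')"
      show "e k = d k"
      proof (rule is_colimit_eqI[OF col[OF k] _ d(1)[OF k]])
        show "e k \<in> hom C (omap (dgm D') k) (omap G k)"
          using e nat_transD(3)[of "shape D'" C "dgm D'" G e, OF _ k] by simp
        fix j assume "j \<in> ob (shape (Fib_dgm k))"
        then show "cmp C (e k) (l j) = cmp C (d k) (l j)"
          using e d(2)[OF k] by auto
      qed
    qed (use e in \<open>simp_all add: d_def\<close>)
  qed
qed (rule functor_F, rule nat)

text \<open>In this fibrewise form the universal property can be matched with the chosen colimits of
  the diagrams \<open>E x\<close>.\<close>

lemma pointwise_left_kan_iff: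
  "pointwise_left_kan C D F D' l \<longleftrightarrow>
    (\<forall>k\<in>ob (shape D'). is_colimit C (Fib_dgm k) (omap (dgm D') k) l)"
  unfolding pointwise_left_kan_def
  using left_kan_if_colimit_fibre colimit_comma_if_colimit_fibre colimit_fibre_if_colimit_comma by blast

end

section \<open>From partial evaluations to Kan extensions along split opfibrations\<close>

text \<open>An arrow with a section is epic. It is applied to the components of \<phi> and \<psi>,
  whose sections are components of the inverses \<open>n\<close> and \<open>m\<close>.\<close>

lemma (in category) cancel_right:
  assumes f: "f \<in> hom C x y" and g: "g \<in> hom C y x" and fg: "cmp C f g = idt C y"
    and a: "a \<in> hom C y z" and b: "b \<in> hom C y z" and eq: "cmp C a f = cmp C b f"
  shows "a = b"
  using assoc[OF g f a] assoc[OF g f b] idt_right[OF a] idt_right[OF b] fg eq by simp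

lemma (in double_diagram) functor_proj:
  "is_functor G I \<lparr>omap = fst, amap = (\<lambda>a. fst (fst (snd a)))\<rparr>"
proof (rule is_functorI[OF category_G I.category_axioms])
  fix a b p q r assume a: "a \<in> hom G p q" and b: "b \<in> hom G q r"
  show "amap \<lparr>omap = fst, amap = (\<lambda>a. fst (fst (snd a)))\<rparr> (cmp G b a) =
      cmp I (amap \<lparr>omap = fst, amap = (\<lambda>a. fst (fst (snd a)))\<rparr> b) (amap \<lparr>omap = fst, amap = (\<lambda>a. fst (fst (snd a)))\<rparr> a)"
    using a b by (elim G_homE) simp
qed (auto elim!: G_homE)

text \<open>The inverses \<open>n\<close> of \<phi> and \<open>m\<close> of \<psi> are parameters
  because \<open>is_diag_iso\<close> only asserts their existence, whereas the formulas for
  \<open>F\<close>, \<open>s\<close> and \<open>l\<close> use them.\<close>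

locale partial_eval = double_diagram C E for C :: "('o, 'a) cat" and E :: "('u, 'o, 'a) ddiagram" +
  fixes c :: "('u, 'o, 'a) colimits" and D D' :: "('u, 'u, 'o, 'a) diagram"
    and \<phi> n \<psi> m
  assumes c: "colimit_choice C c"
    and functor_D': "is_functor (shape D') C (dgm D')"
    and \<phi>: "is_diag_mor C (mult C E) D \<phi>" and n: "is_diag_mor C D (mult C E) n"
    and n\<phi>: "mor_eq (mult C E) (comp_mor C n \<phi>) (id_mor C (mult C E))"
    and \<phi>n: "mor_eq D (comp_mor C \<phi> n) (id_mor C D)"
    and \<psi>: "is_diag_mor C (colim_push C c E) D' \<psi>" and m: "is_diag_mor C D' (colim_push C c E) m"
    and m\<psi>: "mor_eq (colim_push C c E) (comp_mor C m \<psi>) (id_mor C (colim_push C c E))"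
    and \<psi>m: "mor_eq D' (comp_mor C \<psi> m) (id_mor C D')"
begin

abbreviation J where "J \<equiv> shape D"
abbreviation K where "K \<equiv> shape D'"
abbreviation R where "R \<equiv> fun_part \<phi>"
abbreviation Q where "Q \<equiv> fun_part n"
abbreviation S where "S \<equiv> fun_part \<psi>"
abbreviation T where "T \<equiv> fun_part m"
abbreviation \<kappa> where "\<kappa> x \<equiv> snd (c (omap (dgm E) x))"
abbreviation col where "col x \<equiv> fst (c (omap (dgm E) x))"

lemma colim_push_simps [simp]:
  "shape (colim_push C c E) = I" "omap (dgm (colim_push C c E)) x = col x"
  "amap (dgm (colim_push C c E)) i = amap (colim_ftr C c) (amap (dgm E) i)"
  by (simp_all add: colim_push_def)

lemma functor_D: "is_functor J C (dgm D)"
  by (rule is_diag_morD(2)[OF n])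

sublocale J: category J by (rule is_functorD(1)[OF functor_D])
sublocale K: category K by (rule is_functorD(1)[OF functor_D'])
sublocale G: category G by (rule category_G)

lemma functor_R: "is_functor G J R" using is_diag_morD(1)[OF \<phi>] by simp
lemma functor_Q: "is_functor J G Q" using is_diag_morD(1)[OF n] by simp
lemma functor_S: "is_functor I K S" using is_diag_morD(1)[OF \<psi>] by simp
lemma functor_T: "is_functor K I T" using is_diag_morD(1)[OF m] by simp

lemma QR [simp]: "p \<in> ob G \<Longrightarrow> omap Q (omap R p) = p" "a \<in> ar G \<Longrightarrow> amap Q (amap R a) = a"
  using n\<phi> by (simp_all add: mor_eq_iff)

lemma RQ [simp]: "j \<in> ob J \<Longrightarrow> omap R (omap Q j) = j" "g \<in> ar J \<Longrightarrow> amap R (amap Q g) = g"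
  using \<phi>n by (simp_all add: mor_eq_iff)

lemma TS [simp]: "x \<in> ob I \<Longrightarrow> omap T (omap S x) = x" "i \<in> ar I \<Longrightarrow> amap T (amap S i) = i"
  using m\<psi> by (simp_all add: mor_eq_iff)

lemma ST [simp]: "k \<in> ob K \<Longrightarrow> omap S (omap T k) = k" "u \<in> ar K \<Longrightarrow> amap S (amap T u) = u"
  using \<psi>m by (simp_all add: mor_eq_iff)

lemma R_ob: "x \<in> ob I \<Longrightarrow> y \<in> ob (E0_ob E x) \<Longrightarrow> omap R (x, y) \<in> ob J"
  using is_functorD(3)[OF functor_R] by simp

text \<open>As \<phi> is invertible, \<open>R\<close> is bijective on objects and arrows. With this
  rule and \<open>J_homE\<close>, statements about \<open>J\<close> are proved by computing in
  \<open>G\<close>; \<open>K_homE\<close> does the same for \<open>K\<close> and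
  \<open>I\<close>.\<close>

lemma J_obE:
  assumes "j \<in> ob J"
  obtains x y where "j = omap R (x, y)" "x \<in> ob I" "y \<in> ob (E0_ob E x)"
proof -
  obtain x y where "omap Q j = (x, y)" by fastforce
  then show ?thesis
    using that[of x y] RQ(1)[OF assms] is_functorD(3)[OF functor_Q assms] by auto
qed

lemma J_homE:
  assumes "g \<in> hom J (omap R (x, y)) j'" "x \<in> ob I" "y \<in> ob (E0_ob E x)"
  obtains i f x' y' where "g = amap R ((x, y), (i, f), (x', y'))" "j' = omap R (x', y')"
    "i \<in> hom I x x'" "f \<in> hom (E0_ob E x') (omap (E0_ar E i) y) y'" "y' \<in> ob (E0_ob E x')"
proof -
  have "amap Q g \<in> hom G (x, y) (omap Q j')"
    using is_functorD(4)[OF functor_Q assms(1)] assms(2,3) by simp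
  then obtain i f x' y' where a: "amap Q g = ((x, y), (i, f), (x', y'))" "omap Q j' = (x', y')"
    "i \<in> hom I x x'" "f \<in> hom (E0_ob E x') (omap (E0_ar E i) y) y'"
    by (rule G_homE) auto
  show ?thesis
    using that[of i f x' y'] a RQ(1)[of j'] RQ(2)[of g] J.hom_ob(2)[OF assms(1)] homD(1)[OF assms(1)]
      category.hom_ob(2)[OF category_E0 a(4)] I.hom_ob(2)[OF a(3)] by simp
qed

lemma K_homE:
  assumes "u \<in> hom K (omap S x) k" "x \<in> ob I"
  obtains i x' where "u = amap S i" "k = omap S x'" "i \<in> hom I x x'"
  using that[of "amap T u" "omap T k"] is_functorD(4)[OF functor_T assms(1)] assms(2) homD(1)[OF assms(1)]
    K.hom_ob(2)[OF assms(1)] by simp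

lemma S_inj: "x \<in> ob I \<Longrightarrow> x' \<in> ob I \<Longrightarrow> omap S x = omap S x' \<Longrightarrow> x = x'"
  using TS(1) by metis

lemma S_inj_ar: "i \<in> ar I \<Longrightarrow> i' \<in> ar I \<Longrightarrow> amap S i = amap S i' \<Longrightarrow> i = i'"
  using TS(2) by metis

lemma R_inj: "p \<in> ob G \<Longrightarrow> q \<in> ob G \<Longrightarrow> omap R p = omap R q \<Longrightarrow> p = q"
  using QR(1) by metis

lemma R_inj_ar: "a \<in> ar G \<Longrightarrow> b \<in> ar G \<Longrightarrow> amap R a = amap R b \<Longrightarrow> a = b"
  using QR(2) by metis

lemma \<phi>_hom: "x \<in> ob I \<Longrightarrow> y \<in> ob (E0_ob E x) \<Longrightarrow>
    nat_part \<phi> (x, y) \<in> hom C (omap (E1_ob E x) y) (omap (dgm D) (omap R (x, y)))"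
  using is_diag_morD(3)[OF \<phi>, of "(x, y)"] by simp

lemma n_hom: "x \<in> ob I \<Longrightarrow> y \<in> ob (E0_ob E x) \<Longrightarrow>
    nat_part n (omap R (x, y)) \<in> hom C (omap (dgm D) (omap R (x, y))) (omap (E1_ob E x) y)"
  using is_diag_morD(3)[OF n R_ob] by simp

lemma n_\<phi>: "x \<in> ob I \<Longrightarrow> y \<in> ob (E0_ob E x) \<Longrightarrow>
    cmp C (nat_part n (omap R (x, y))) (nat_part \<phi> (x, y)) = idt C (omap (E1_ob E x) y)"
  using n\<phi> by (simp add: mor_eq_iff)

lemma \<phi>_n: "x \<in> ob I \<Longrightarrow> y \<in> ob (E0_ob E x) \<Longrightarrow>
    cmp C (nat_part \<phi> (x, y)) (nat_part n (omap R (x, y))) = idt C (omap (dgm D) (omap R (x, y)))"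
  using \<phi>n bspec[OF _ R_ob[of x y], of "\<lambda>j. cmp C (nat_part \<phi> (omap Q j)) (nat_part n j) = idt C (omap (dgm D) j)"]
  by (simp add: mor_eq_iff)

lemma \<psi>_hom: "x \<in> ob I \<Longrightarrow> nat_part \<psi> x \<in> hom C (col x) (omap (dgm D') (omap S x))"
  using is_diag_morD(3)[OF \<psi>, of x] by simp

lemma m_hom: "x \<in> ob I \<Longrightarrow> nat_part m (omap S x) \<in> hom C (omap (dgm D') (omap S x)) (col x)"
  using is_diag_morD(3)[OF m is_functorD(3)[OF functor_S]] by simp

lemma m_\<psi>: "x \<in> ob I \<Longrightarrow> cmp C (nat_part m (omap S x)) (nat_part \<psi> x) = idt C (col x)"
  using m\<psi> by (simp add: mor_eq_iff)

lemma \<psi>_m: "x \<in> ob I \<Longrightarrow> cmp C (nat_part \<psi> x) (nat_part m (omap S x)) = idt C (omap (dgm D') (omap S x))"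
  using \<psi>m bspec[OF _ is_functorD(3)[OF functor_S, of x], of "\<lambda>k. cmp C (nat_part \<psi> (omap T k)) (nat_part m k) = idt C (omap (dgm D') k)"]
  by (simp add: mor_eq_iff)

lemma colimit_\<kappa>: "x \<in> ob I \<Longrightarrow> is_colimit C (omap (dgm E) x) (col x) (\<kappa> x)"
  by (rule colimit_choiceD[OF c small_E_ob])

lemma \<kappa>_hom: "x \<in> ob I \<Longrightarrow> y \<in> ob (E0_ob E x) \<Longrightarrow> \<kappa> x y \<in> hom C (omap (E1_ob E x) y) (col x)"
  by (rule is_coconeD(3)[OF is_colimitD(1)[OF colimit_\<kappa>]])

lemma colim_E_hom: "i \<in> hom I x x' \<Longrightarrow> amap (colim_ftr C c) (amap (dgm E) i) \<in> hom C (col x) (col x')"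
  using is_functorD(4)[OF functor_colim_push[OF c]] by simp

lemma colim_E_\<kappa>:
  assumes i: "i \<in> hom I x x'" and y: "y \<in> ob (E0_ob E x)"
  shows "cmp C (amap (colim_ftr C c) (amap (dgm E) i)) (\<kappa> x y) = cmp C (\<kappa> x' (omap (E0_ar E i) y)) (E1_ar E i y)"
  using colim_ftr_amap(2)[OF c small_E_ob small_E_ob amap_E(2)[OF i] y] I.hom_ob[OF i]
  by (simp flip: amap_E(1)[OF i])

text \<open>The arrow with identity fibre part in \<open>corresponds\<close> is
  \<open>lift y i\<close>. In this form the four requirements on \<open>F\<close> (objects and
  arrows), \<open>s\<close> and \<open>l\<close> stand apart.\<close>

lemma corresponds_iff:
  "corresponds C c (E, \<phi>, \<psi>) (F, s, l) \<longleftrightarrow>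
    (\<forall>x y. x \<in> ob I \<longrightarrow> y \<in> ob (E0_ob E x) \<longrightarrow> omap F (omap R (x, y)) = omap S x) \<and>
    (\<forall>x y i x'. i \<in> hom I x x' \<longrightarrow> y \<in> ob (E0_ob E x) \<longrightarrow>
        s (omap R (x, y), amap S i) = amap R (lift y i)) \<and>
    (\<forall>x y. x \<in> ob I \<longrightarrow> y \<in> ob (E0_ob E x) \<longrightarrow>
        cmp C (l (omap R (x, y))) (nat_part \<phi> (x, y)) = cmp C (nat_part \<psi> x) (\<kappa> x y)) \<and>
    (\<forall>p i f q. (p, (i, f), q) \<in> ar G \<longrightarrow> amap F (amap R (p, (i, f), q)) = amap S i)"
  (is "?L \<longleftrightarrow> ?O \<and> ?L' \<and> ?N \<and> ?A")
proof -
  have "?L \<longleftrightarrow> (\<forall>x y. x \<in> ob I \<longrightarrow> y \<in> ob (E0_ob E x) \<longrightarrow> omap F (omap R (x, y)) = omap S x \<and>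
      (\<forall>i\<in>ar I. src I i = x \<longrightarrow> s (omap R (x, y), amap S i) = amap R (lift y i)) \<and>
      cmp C (l (omap R (x, y))) (nat_part \<phi> (x, y)) = cmp C (nat_part \<psi> x) (\<kappa> x y)) \<and> ?A"
  proof -
    have ob: "(\<forall>p\<in>ob G. case p of (x, y) \<Rightarrow> P x y) \<longleftrightarrow>
        (\<forall>x y. x \<in> ob I \<longrightarrow> y \<in> ob (E0_ob E x) \<longrightarrow> P x y)" for P
      by auto
    show ?thesis
      unfolding corresponds_def Let_def prod.case mult_simps ob lift_def
      by (rule arg_cong2[where f = "(\<and>)"]) (simp, force)
  qed
  also have "\<dots> \<longleftrightarrow> ?O \<and> ?L' \<and> ?N \<and> ?A"
    using I.hom_ob by (auto simp: hom_def)
  finally show ?thesis .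
qed

section \<open>The split opfibration and the transformation induced by a partial evaluation\<close>

definition F where "F = restrict_ftr J (comp_ftr S (comp_ftr \<lparr>omap = fst, amap = (\<lambda>a. fst (fst (snd a)))\<rparr> Q))"

definition s where "s = restrict (\<lambda>(j, u). amap R (lift (snd (omap Q j)) (amap T u)))
  {(j, u). j \<in> ob J \<and> u \<in> ar K \<and> src K u = omap F j}"

text \<open>The formula solves the equation of \<open>corresponds\<close> for \<open>l\<close>, with
  \<open>n\<close> inverting \<phi>.\<close>

definition l where "l = restrict (\<lambda>j. cmp C (cmp C (nat_part \<psi> (fst (omap Q j)))
  (\<kappa> (fst (omap Q j)) (snd (omap Q j)))) (nat_part n j)) (ob J)"

lemma functor_F: "is_functor J K F"
  unfolding F_def
  by (rule is_functor_cong[OF is_functor_comp[OF is_functor_comp[OF functor_Q functor_proj] functor_S]])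
    (simp_all add: restrict_ftr_simps)

lemma F_R: "x \<in> ob I \<Longrightarrow> y \<in> ob (E0_ob E x) \<Longrightarrow> omap F (omap R (x, y)) = omap S x"
  using R_ob[of x y] by (simp add: F_def restrict_ftr_simps)

lemma F_R_ar: "((x, y), (i, f), (x', y')) \<in> ar G \<Longrightarrow> amap F (amap R ((x, y), (i, f), (x', y'))) = amap S i"
  using is_functor_ar(1)[OF functor_R, of "((x, y), (i, f), (x', y'))"] by (simp add: F_def restrict_ftr_simps)

lemma s_R:
  assumes i: "i \<in> hom I x x'" and y: "y \<in> ob (E0_ob E x)"
  shows "s (omap R (x, y), amap S i) = amap R (lift y i)"
  using R_ob[OF I.hom_ob(1)[OF i] y] is_functorD(4)[OF functor_S i] F_R[OF I.hom_ob(1)[OF i] y] homD[OF i]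
    I.hom_ob(1)[OF i] y by (simp add: s_def hom_def)

lemma l_R_hom:
  assumes "x \<in> ob I" "y \<in> ob (E0_ob E x)"
  shows "l (omap R (x, y)) \<in> hom C (omap (dgm D) (omap R (x, y))) (omap (dgm D') (omap S x))"
  using R_ob[OF assms] cmp_in_hom[OF n_hom[OF assms] cmp_in_hom[OF \<kappa>_hom[OF assms] \<psi>_hom[OF assms(1)]]] assms
  by (simp add: l_def)

lemma l_R:
  assumes xy: "x \<in> ob I" "y \<in> ob (E0_ob E x)"
  shows "cmp C (l (omap R (x, y))) (nat_part \<phi> (x, y)) = cmp C (nat_part \<psi> x) (\<kappa> x y)"
proof -
  note \<psi>\<kappa> = cmp_in_hom[OF \<kappa>_hom[OF xy] \<psi>_hom[OF xy(1)]]
  show ?thesis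
    using R_ob[OF xy] assoc[OF \<phi>_hom[OF xy] n_hom[OF xy] \<psi>\<kappa>] n_\<phi>[OF xy] idt_right[OF \<psi>\<kappa>] xy
    by (simp add: l_def)
qed

lemma corresponds: "corresponds C c (E, \<phi>, \<psi>) (F, s, l)"
  unfolding corresponds_iff using F_R F_R_ar s_R l_R by auto

lemma lift_ar: "i \<in> hom I x x' \<Longrightarrow> y \<in> ob (E0_ob E x) \<Longrightarrow> lift y i \<in> ar G"
  by (rule homD(1)[OF lift_hom])

lemma F_R_lift:
  assumes "i \<in> hom I x x'" "y \<in> ob (E0_ob E x)"
  shows "amap F (amap R (lift y i)) = amap S i"
  using F_R_ar lift_ar[OF assms] unfolding lift_eq[OF assms(1)] by blast

text \<open>Read in \<open>G\<close>, the task is to factor an arrow \<open>(i2, f)\<close> through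
  \<open>lift y i\<close> over a base arrow \<open>v\<close>. The base parts force
  \<open>i2 = cmp I v i\<close>, and by \<open>cmp_lift\<close> the only possible factor is
  \<open>(v, f)\<close>.\<close>

lemma opcartesian_lift:
  assumes i: "i \<in> hom I x x'" and y: "y \<in> ob (E0_ob E x)"
  shows "opcartesian J K F (amap R (lift y i))"
  unfolding opcartesian_def
proof (intro conjI ballI impI; (elim conjE)?)
  note x = I.hom_ob[OF i] and y' = E0_ob[OF i y]
  note L = lift_hom[OF i y]
  note RL = is_functorD(4)[OF functor_R L]
  show "amap R (lift y i) \<in> ar J" by (rule homD(1)[OF RL])
  fix g w assume g: "g \<in> ar J" and w: "w \<in> hom K (omap F (tgt J (amap R (lift y i)))) (omap F (tgt J g))"
    and src: "src J g = src J (amap R (lift y i))" and e: "amap F g = cmp K w (amap F (amap R (lift y i)))"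
  have "g \<in> hom J (omap R (x, y)) (tgt J g)"
    using g src homD(2)[OF RL] by (simp add: hom_def)
  then obtain i2 f x2 y2 where G: "g = amap R ((x, y), (i2, f), (x2, y2))" "tgt J g = omap R (x2, y2)"
    "i2 \<in> hom I x x2" "f \<in> hom (E0_ob E x2) (omap (E0_ar E i2) y) y2" "y2 \<in> ob (E0_ob E x2)"
    using x(1) y by (rule J_homE)
  note x2 = I.hom_ob(2)[OF G(3)]
  have w': "w \<in> hom K (omap S x') (omap S x2)"
    using w by (simp add: homD(3)[OF RL] G(2) F_R[OF x2 G(5)] F_R[OF x(2) y'])
  then obtain v x2' where v: "w = amap S v" "omap S x2 = omap S x2'" "v \<in> hom I x' x2'"
    using x(2) by (rule K_homE)
  then have v: "w = amap S v" "v \<in> hom I x' x2"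
    using S_inj[OF x2 I.hom_ob(2)] by auto
  have "amap S i2 = amap S (cmp I v i)"
    using e F_R_ar[of x y i2 f x2 y2] G y F_R_lift[OF i y] is_functorD(6)[OF functor_S i v(2)]
    by (simp add: G_ar v(1))
  then have i2: "i2 = cmp I v i"
    using S_inj_ar[OF homD(1)[OF G(3)] homD(1)[OF I.cmp_in_hom[OF i v(2)]]] by simp
  have f: "f \<in> hom (E0_ob E x2) (omap (E0_ar E v) (omap (E0_ar E i) y)) y2"
    using G(4) by (simp add: i2 E_cmp(1)[OF i v(2) y])
  let ?h = "((x', omap (E0_ar E i) y), (v, f), (x2, y2))"
  have h: "?h \<in> hom G (x', omap (E0_ar E i) y) (x2, y2)"
    using v(2) y' f by (simp add: G_hom)
  show "\<exists>!h. h \<in> hom J (tgt J (amap R (lift y i))) (tgt J g) \<and> amap F h = w \<and> cmp J h (amap R (lift y i)) = g"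
  proof (rule ex1I[of _ "amap R ?h"]; (intro conjI)?)
    show "amap R ?h \<in> hom J (tgt J (amap R (lift y i))) (tgt J g)"
      using is_functorD(4)[OF functor_R h] by (simp add: homD(3)[OF RL] G(2))
    show "amap F (amap R ?h) = w"
      using F_R_ar homD(1)[OF h] v(1) by blast
    show "cmp J (amap R ?h) (amap R (lift y i)) = g"
      using is_functorD(6)[OF functor_R L h] cmp_lift[OF i y v(2) f] by (simp add: G(1) i2)
    fix h' assume h': "h' \<in> hom J (tgt J (amap R (lift y i))) (tgt J g) \<and> amap F h' = w \<and>
      cmp J h' (amap R (lift y i)) = g"
    then have "h' \<in> hom J (omap R (x', omap (E0_ar E i) y)) (omap R (x2, y2))"
      by (simp add: homD(3)[OF RL] G(2))
    then obtain v' f' x3 y3 where H: "h' = amap R ((x', omap (E0_ar E i) y), (v', f'), (x3, y3))"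
      "omap R (x2, y2) = omap R (x3, y3)" "v' \<in> hom I x' x3"
      "f' \<in> hom (E0_ob E x3) (omap (E0_ar E v') (omap (E0_ar E i) y)) y3" "y3 \<in> ob (E0_ob E x3)"
      using x(2) y' by (rule J_homE)
    have x3: "x3 = x2" "y3 = y2"
      using R_inj[OF _ _ H(2)] H(5) I.hom_ob(2)[OF H(3)] x2 G(5) by simp_all
    note H = H[unfolded x3]
    have H': "((x', omap (E0_ar E i) y), (v', f'), (x2, y2)) \<in> hom G (x', omap (E0_ar E i) y) (x2, y2)"
      using H y' by (simp add: G_hom)
    have "amap S v' = amap S v"
      using h' F_R_ar[OF homD(1)[OF H']] by (simp add: H(1) v(1))
    then have v': "v' = v"
      using S_inj_ar[OF homD(1)[OF H(3)] homD(1)[OF v(2)]] by simp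
    have "amap R (cmp G ((x', omap (E0_ar E i) y), (v', f'), (x2, y2)) (lift y i)) = amap R ((x, y), (i2, f), (x2, y2))"
      using h' is_functorD(6)[OF functor_R L H'] by (simp add: H(1) G(1))
    then have "cmp G ((x', omap (E0_ar E i) y), (v', f'), (x2, y2)) (lift y i) = ((x, y), (i2, f), (x2, y2))"
      using R_inj_ar[OF homD(1)[OF G.cmp_in_hom[OF L H']]] G(3,4) y by (simp add: G_ar)
    then have "f' = f"
      using cmp_lift[OF i y H(3,4)] by simp
    then show "h' = amap R ?h"
      by (simp add: H(1) v')
  qed
qed

text \<open>Strict functoriality of \<open>E\<close> makes lifts respect identities and composites,
  by \<open>lift_idt\<close> and \<open>lift_cmp\<close>; the functor \<open>R\<close> carries this
  to \<open>J\<close>.\<close>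

lemma split_opfibration_F: "split_opfibration J K F s"
  unfolding split_opfibration_def
proof (intro conjI ballI impI; (elim conjE)?)
  show "is_functor J K F" by (rule functor_F)
next
  fix j u assume j: "j \<in> ob J" and u: "u \<in> ar K" "src K u = omap F j"
  obtain x y where xy: "j = omap R (x, y)" "x \<in> ob I" "y \<in> ob (E0_ob E x)"
    using j by (rule J_obE)
  have "u \<in> hom K (omap S x) (tgt K u)"
    using u F_R[OF xy(2,3)] by (simp add: hom_def xy(1))
  then obtain i x' where i: "u = amap S i" "i \<in> hom I x x'"
    using xy(2) by (rule K_homE)
  note RL = is_functorD(4)[OF functor_R lift_hom[OF i(2) xy(3)]]
  note s = s_R[OF i(2) xy(3)]
  show "src J (s (j, u)) = j" "amap F (s (j, u)) = u" "opcartesian J K F (s (j, u))"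
    using homD(2)[OF RL] F_R_lift[OF i(2) xy(3)] opcartesian_lift[OF i(2) xy(3)] by (simp_all add: s xy(1) i(1))
  fix v assume v: "v \<in> ar K" "src K v = tgt K u"
  have "v \<in> hom K (omap S x') (tgt K v)"
    using v homD(3)[OF is_functorD(4)[OF functor_S i(2)]] by (simp add: hom_def i(1))
  then obtain i' x'' where i': "v = amap S i'" "i' \<in> hom I x' x''"
    using I.hom_ob(2)[OF i(2)] by (rule K_homE)
  note y' = E0_ob[OF i(2) xy(3)]
  have "s (j, cmp K v u) = amap R (lift y (cmp I i' i))"
    using s_R[OF I.cmp_in_hom[OF i(2) i'(2)] xy(3)] is_functorD(6)[OF functor_S i(2) i'(2)]
    by (simp add: xy(1) i(1) i'(1))
  also have "\<dots> = cmp J (amap R (lift (omap (E0_ar E i) y) i')) (amap R (lift y i))"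
    unfolding lift_cmp[OF i(2) i'(2) xy(3)]
    by (rule is_functorD(6)[OF functor_R lift_hom[OF i(2) xy(3)] lift_hom[OF i'(2) y']])
  also have "\<dots> = cmp J (s (tgt J (s (j, u)), v)) (s (j, u))"
    using s_R[OF i'(2) y'] homD(3)[OF RL] s by (simp add: xy(1) i(1) i'(1))
  finally show "s (j, cmp K v u) = cmp J (s (tgt J (s (j, u)), v)) (s (j, u))" .
next
  fix j assume j: "j \<in> ob J"
  obtain x y where xy: "j = omap R (x, y)" "x \<in> ob I" "y \<in> ob (E0_ob E x)"
    using j by (rule J_obE)
  show "s (j, idt K (omap F j)) = idt J j"
    using s_R[OF I.idt_hom[OF xy(2)] xy(3)] lift_idt[OF xy(2,3)] is_functorD(5)[OF functor_S xy(2)]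
      is_functorD(5)[OF functor_R, of "(x, y)"] xy(2,3) F_R[OF xy(2,3)] by (simp add: xy(1))
qed

text \<open>The two sides of the square are compared after precomposing with
  \<open>nat_part \<phi> (x, y)\<close>, which is epic by \<open>cancel_right\<close>; there
  naturality of \<phi> and \<psi> can be used.\<close>

lemma nat_l: "nat_trans J C (dgm D) (comp_ftr (dgm D') F) l"
proof (rule nat_transI[OF functor_D is_functor_comp[OF functor_F functor_D']])
  fix j assume "j \<in> ob J"
  then show "l j \<in> hom C (omap (dgm D) j) (omap (comp_ftr (dgm D') F) j)"
    using l_R_hom F_R by (elim J_obE) simp
next
  fix g j j' assume g: "g \<in> hom J j j'"
  obtain x y where xy: "j = omap R (x, y)" "x \<in> ob I" "y \<in> ob (E0_ob E x)"
    using J.hom_ob(1)[OF g] by (rule J_obE)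
  obtain i f x' y' where a: "g = amap R ((x, y), (i, f), (x', y'))" "j' = omap R (x', y')"
    "i \<in> hom I x x'" "f \<in> hom (E0_ob E x') (omap (E0_ar E i) y) y'" "y' \<in> ob (E0_ob E x')"
    using g[unfolded xy(1)] xy(2,3) by (rule J_homE)
  note x' = I.hom_ob(2)[OF a(3)] and Ey = E0_ob[OF a(3) xy(3)]
  let ?a = "((x, y), (i, f), (x', y'))"
  have A: "?a \<in> hom G (x, y) (x', y')"
    using a xy by (simp add: G_hom)
  note Dg = is_functorD(4)[OF functor_D is_functorD(4)[OF functor_R A]]
  note p = \<phi>_hom[OF xy(2,3)] and p' = \<phi>_hom[OF x' a(5)] and l = l_R_hom[OF xy(2,3)] and l' = l_R_hom[OF x' a(5)]
  note D'i = is_functorD(4)[OF functor_D' is_functorD(4)[OF functor_S a(3)]]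
  note e1 = E1_hom[OF a(3) xy(3)] and ef = is_functorD(4)[OF functor_E1[OF x'] a(4)]
  note k = \<kappa>_hom[OF xy(2,3)] and k' = \<kappa>_hom[OF x' a(5)] and k'' = \<kappa>_hom[OF x' Ey]
  note q = \<psi>_hom[OF xy(2)] and q' = \<psi>_hom[OF x']
  have "cmp C (cmp C (l j') (amap (dgm D) g)) (nat_part \<phi> (x, y)) =
      cmp C (l (omap R (x', y'))) (cmp C (amap (dgm D) (amap R ?a)) (nat_part \<phi> (x, y)))"
    using assoc[OF p Dg l'] by (simp add: a(1,2))
  also have "\<dots> = cmp C (l (omap R (x', y'))) (cmp C (nat_part \<phi> (x', y')) (cmp C (amap (E1_ob E x') f) (E1_ar E i y)))"
    using is_diag_morD(4)[OF \<phi>, of ?a "(x, y)" "(x', y')"] A by simp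
  also have "\<dots> = cmp C (cmp C (nat_part \<psi> x') (\<kappa> x' y')) (cmp C (amap (E1_ob E x') f) (E1_ar E i y))"
    using assoc[OF cmp_in_hom[OF e1 ef] p' l'] l_R[OF x' a(5)] by simp
  also have "\<dots> = cmp C (nat_part \<psi> x') (cmp C (cmp C (\<kappa> x' y') (amap (E1_ob E x') f)) (E1_ar E i y))"
    using assoc[OF cmp_in_hom[OF e1 ef] k' q'] assoc[OF e1 ef k'] by simp
  \<comment> \<open>The colimit leg absorbs the fibre arrow \<open>f\<close>; what remains is the
    colimit functor applied to \<open>E i\<close>, composed with the leg at
    \<open>y\<close>.\<close>
  also have "\<dots> = cmp C (nat_part \<psi> x') (cmp C (amap (colim_ftr C c) (amap (dgm E) i)) (\<kappa> x y))"
    using is_coconeD(4)[OF is_colimitD(1)[OF colimit_\<kappa>[OF x']] a(4)] colim_E_\<kappa>[OF a(3) xy(3)] by simp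
  also have "\<dots> = cmp C (cmp C (amap (dgm D') (amap S i)) (nat_part \<psi> x)) (\<kappa> x y)"
    using assoc[OF k colim_E_hom[OF a(3)] q'] is_diag_morD(4)[OF \<psi>, of i x x'] a(3) by simp
  also have "\<dots> = cmp C (amap (dgm D') (amap S i)) (cmp C (l (omap R (x, y))) (nat_part \<phi> (x, y)))"
    using assoc[OF k q D'i] l_R[OF xy(2,3)] by simp
  also have "\<dots> = cmp C (cmp C (amap (dgm D') (amap S i)) (l (omap R (x, y)))) (nat_part \<phi> (x, y))"
    by (rule assoc[OF p l D'i])
  finally have "cmp C (l j') (amap (dgm D) g) = cmp C (amap (dgm D') (amap S i)) (l (omap R (x, y)))"
    using cancel_right[OF p n_hom[OF xy(2,3)] \<phi>_n[OF xy(2,3)]] cmp_in_hom[OF Dg l'] cmp_in_hom[OF l D'i]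
    unfolding a(1,2) by blast
  then show "cmp C (l j') (amap (dgm D) g) = cmp C (amap (comp_ftr (dgm D') F) g) (l j)"
    using F_R_ar[OF homD(1)[OF A]] by (simp add: a(1) xy(1))
qed

text \<open>For \<open>x = omap T k\<close>, the functor \<open>R\<close> identifies
  \<open>E0_ob E x\<close> with the fibre over \<open>k\<close>, \<phi> identifies the diagrams on
  them, and \<open>nat_part \<psi> x\<close> is an isomorphism from the chosen colimit to
  \<open>omap (dgm D') k\<close>. The universal property is carried across.\<close>

lemma colimit_fibre_l:
  assumes k: "k \<in> ob K"
  shows "is_colimit C (fibre_dgm D K F k) (omap (dgm D') k) l"
proof -
  interpret O: opfib_cocone C D D' F s l
    by unfold_locales (rule split_opfibration_F nat_l functor_D')+
  define x where "x = omap T k"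
  have x: "x \<in> ob I" and Sx: "omap S x = k"
    using is_functorD(3)[OF functor_T k] k by (simp_all add: x_def)
  note q = \<psi>_hom[OF x, unfolded Sx] and qi = m_hom[OF x, unfolded Sx]
  have R_fibre: "omap R (x, y) \<in> ob (fibre J K F k)" if "y \<in> ob (E0_ob E x)" for y
    using R_ob[OF x that] F_R[OF x that] Sx by simp
  have fibre_E: "\<exists>y. j = omap R (x, y) \<and> y \<in> ob (E0_ob E x)" if "j \<in> ob (fibre J K F k)" for j
  proof -
    have j: "j \<in> ob J" "omap F j = k" using that by simp_all
    obtain x' y where xy: "j = omap R (x', y)" "x' \<in> ob I" "y \<in> ob (E0_ob E x')"
      using j(1) by (rule J_obE)
    have "x' = x"
      using S_inj[OF xy(2) x] F_R[OF xy(2,3)] j(2) Sx xy(1) by simp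
    then show ?thesis using xy by blast
  qed
  show ?thesis
  proof (rule is_colimitI[OF O.cocone_fibre[OF k]])
    fix z g assume g: "is_cocone C (fibre_dgm D K F k) z g"
    note g_hom = is_coconeD(3)[OF g, unfolded fibre_dgm_simps]
    note g_cmp = is_coconeD(4)[OF g, unfolded fibre_dgm_simps]
    \<comment> \<open>The cocone on the fibre is pulled back along \<phi>; \<open>vert\<close> turns
      arrows of \<open>E0_ob E x\<close> into arrows that \<open>R\<close> maps to the
      fibre.\<close>
    have "is_cocone C (omap (dgm E) x) z (\<lambda>y. cmp C (g (omap R (x, y))) (nat_part \<phi> (x, y)))"
    proof (rule is_coconeI[OF functor_E1[OF x] is_coconeD(2)[OF g]])
      show "cmp C (g (omap R (x, y))) (nat_part \<phi> (x, y)) \<in> hom C (omap (E1_ob E x) y) z"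
        if "y \<in> ob (E0_ob E x)" for y
        by (rule cmp_in_hom[OF \<phi>_hom[OF x that] g_hom[OF R_fibre[OF that]]])
      fix f y y' assume f: "f \<in> hom (E0_ob E x) y y'"
      have y: "y \<in> ob (E0_ob E x)" and y': "y' \<in> ob (E0_ob E x)"
        using category.hom_ob[OF category_E0[OF x] f] by auto
      note V = vert_hom[OF x f]
      have "amap F (amap R (vert x f)) = idt K k"
        using F_R_ar homD(1)[OF V] is_functorD(5)[OF functor_S x] Sx unfolding vert_def by simp
      then have fV: "amap R (vert x f) \<in> hom (fibre J K F k) (omap R (x, y)) (omap R (x, y'))"
        using is_functorD(4)[OF functor_R V] by simp
      have "cmp C (cmp C (g (omap R (x, y'))) (nat_part \<phi> (x, y'))) (amap (E1_ob E x) f) =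
          cmp C (g (omap R (x, y'))) (cmp C (nat_part \<phi> (x, y')) (amap (dgm (mult C E)) (vert x f)))"
        using assoc[OF is_functorD(4)[OF functor_E1[OF x] f] \<phi>_hom[OF x y'] g_hom[OF R_fibre[OF y']]] mult_vert[OF x f]
        by simp
      also have "\<dots> = cmp C (g (omap R (x, y'))) (cmp C (amap (dgm D) (amap R (vert x f))) (nat_part \<phi> (x, y)))"
        using is_diag_morD(4)[OF \<phi>, of "vert x f"] V by simp
      also have "\<dots> = cmp C (cmp C (g (omap R (x, y'))) (amap (dgm D) (amap R (vert x f)))) (nat_part \<phi> (x, y))"
        by (rule assoc[OF \<phi>_hom[OF x y] is_functorD(4)[OF functor_D is_functorD(4)[OF functor_R V]]
              g_hom[OF R_fibre[OF y']]])
      also have "\<dots> = cmp C (g (omap R (x, y))) (nat_part \<phi> (x, y))"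
        using g_cmp[OF fV] by simp
      finally show "cmp C (cmp C (g (omap R (x, y'))) (nat_part \<phi> (x, y'))) (amap (E1_ob E x) f) =
          cmp C (g (omap R (x, y))) (nat_part \<phi> (x, y))" .
    qed
    then obtain h where h: "h \<in> hom C (col x) z" and h\<kappa>: "\<And>y. y \<in> ob (E0_ob E x) \<Longrightarrow>
        cmp C h (\<kappa> x y) = cmp C (g (omap R (x, y))) (nat_part \<phi> (x, y))"
      by (rule is_colimit_factor[OF colimit_\<kappa>[OF x]]) blast
    \<comment> \<open>As \<open>nat_part m k\<close> inverts \<open>nat_part \<psi> x\<close>, this
      is \<open>h\<close> moved from the chosen colimit to \<open>omap (dgm D') k\<close>.\<close>
    let ?h = "cmp C h (nat_part m k)"
    have H: "?h \<in> hom C (omap (dgm D') k) z"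
      by (rule cmp_in_hom[OF qi h])
    have "cmp C ?h (l j) = g j" if j: "j \<in> ob (shape (fibre_dgm D K F k))" for j
    proof -
      obtain y where y: "j = omap R (x, y)" "y \<in> ob (E0_ob E x)"
        using fibre_E j by auto
      note lj = l_R_hom[OF x y(2), unfolded Sx]
      have "cmp C (cmp C ?h (l (omap R (x, y)))) (nat_part \<phi> (x, y)) = cmp C ?h (cmp C (nat_part \<psi> x) (\<kappa> x y))"
        using assoc[OF \<phi>_hom[OF x y(2)] lj H] l_R[OF x y(2)] by simp
      also have "\<dots> = cmp C (cmp C ?h (nat_part \<psi> x)) (\<kappa> x y)"
        by (rule assoc[OF \<kappa>_hom[OF x y(2)] q H])
      also have "cmp C ?h (nat_part \<psi> x) = h"
        using assoc[OF q qi h] m_\<psi>[OF x] Sx idt_right[OF h] by simp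
      finally have "cmp C (cmp C ?h (l (omap R (x, y)))) (nat_part \<phi> (x, y)) =
          cmp C (g (omap R (x, y))) (nat_part \<phi> (x, y))"
        using h\<kappa>[OF y(2)] by simp
      from cancel_right[OF \<phi>_hom[OF x y(2)] n_hom[OF x y(2)] \<phi>_n[OF x y(2)] cmp_in_hom[OF lj H]
          g_hom[OF R_fibre[OF y(2)]] this]
      show ?thesis by (simp add: y(1))
    qed
    then show "\<exists>h. h \<in> hom C (omap (dgm D') k) z \<and> (\<forall>j\<in>ob (shape (fibre_dgm D K F k)). cmp C h (l j) = g j)"
      using H by blast
  next
    fix z h h' assume h: "h \<in> hom C (omap (dgm D') k) z" "h' \<in> hom C (omap (dgm D') k) z"
      and eq: "\<forall>j\<in>ob (shape (fibre_dgm D K F k)). cmp C h (l j) = cmp C h' (l j)"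
    \<comment> \<open>The chosen legs detect equality after precomposition with \<psi>, and the
      component of \<psi> is epic.\<close>
    have "cmp C h (nat_part \<psi> x) = cmp C h' (nat_part \<psi> x)"
    proof (rule is_colimit_eqI[OF colimit_\<kappa>[OF x] cmp_in_hom[OF q h(1)] cmp_in_hom[OF q h(2)]])
      fix y assume y: "y \<in> ob (E0_ob E x)"
      have "cmp C h (l (omap R (x, y))) = cmp C h' (l (omap R (x, y)))"
        using eq R_fibre[OF y] unfolding fibre_dgm_simps by blast
      moreover have "cmp C (cmp C d (nat_part \<psi> x)) (\<kappa> x y) = cmp C (cmp C d (l (omap R (x, y)))) (nat_part \<phi> (x, y))"
        if "d \<in> hom C (omap (dgm D') k) z" for d
        using assoc[OF \<kappa>_hom[OF x y] q that] assoc[OF \<phi>_hom[OF x y] l_R_hom[OF x y, unfolded Sx] that] l_R[OF x y]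
        by simp
      ultimately show "cmp C (cmp C h (nat_part \<psi> x)) (\<kappa> x y) = cmp C (cmp C h' (nat_part \<psi> x)) (\<kappa> x y)"
        using h by simp
    qed
    from cancel_right[OF q qi _ h this] show "h = h'"
      using \<psi>_m[OF x] Sx by simp
  qed
qed

lemma kan_opfib: "(F, s, l) \<in> kan_opfibs C D D'"
proof -
  interpret O: opfib_cocone C D D' F s l
    by unfold_locales (rule split_opfibration_F nat_l functor_D')+
  show ?thesis
    unfolding kan_opfibs_def
    using split_opfibration_F O.pointwise_left_kan_iff colimit_fibre_l
    by (simp add: F_def restrict_ftr_idem) (simp add: s_def l_def F_def)
qed

text \<open>Since \<open>R\<close> is surjective on objects and arrows, \<open>S\<close> is
  surjective on arrows, and the components of \<phi> are epic, the equations of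
  \<open>corresponds\<close> fix the triple on its carriers. Extensionality in
  \<open>kan_opfibs\<close> fixes it elsewhere.\<close>

lemma corresponds_unique:
  assumes k: "(F', s', l') \<in> kan_opfibs C D D'" and cor: "corresponds C c (E, \<phi>, \<psi>) (F', s', l')"
  shows "(F', s', l') = (F, s, l)"
proof -
  note cor' = cor[unfolded corresponds_iff]
  have Fo: "omap F' j = omap F j" if "j \<in> ob J" for j
    using that cor' F_R by (elim J_obE) simp
  have Fa: "amap F' g = amap F g" if g: "g \<in> ar J" for g
  proof -
    obtain x y i f x' y' where a: "amap Q g = ((x, y), (i, f), (x', y'))"
      by (metis surj_pair)
    have A: "((x, y), (i, f), (x', y')) \<in> ar G"
      using is_functor_ar(1)[OF functor_Q g] by (simp add: a)
    have "amap F' (amap R ((x, y), (i, f), (x', y'))) = amap S i"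
      using cor' A by blast
    then show ?thesis
      using F_R_ar[OF A] RQ(2)[OF g] by (simp add: a)
  qed
  have "restrict_ftr J F' = restrict_ftr J F"
    using Fo Fa by (simp add: restrict_ftr_eq_iff)
  then have F': "F' = F"
    using k kan_opfib by (simp add: kan_opfibs_def)
  let ?X = "{(j, u). j \<in> ob J \<and> u \<in> ar K \<and> src K u = omap F j}"
  have "s' = s"
  proof (rule extensionalityI[of _ ?X])
    show "s' \<in> extensional ?X" using k by (simp add: kan_opfibs_def F')
    show "s \<in> extensional ?X" by (simp add: s_def)
    fix p assume "p \<in> ?X"
    then obtain j u where p: "p = (j, u)" "j \<in> ob J" "u \<in> ar K" "src K u = omap F j" by auto
    obtain x y where xy: "j = omap R (x, y)" "x \<in> ob I" "y \<in> ob (E0_ob E x)"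
      using p(2) by (rule J_obE)
    have "u \<in> hom K (omap S x) (tgt K u)"
      using p F_R[OF xy(2,3)] by (simp add: hom_def xy(1))
    then obtain i x' where i: "u = amap S i" "i \<in> hom I x x'"
      using xy(2) by (rule K_homE)
    show "s' p = s p"
      unfolding p(1) xy(1) i(1) s_R[OF i(2) xy(3)] using cor' i(2) xy(3) by blast
  qed
  moreover have "l' = l"
  proof (rule extensionalityI[of _ "ob J"])
    show "l' \<in> extensional (ob J)" using k by (simp add: kan_opfibs_def)
    show "l \<in> extensional (ob J)" by (simp add: l_def)
    fix j assume j: "j \<in> ob J"
    obtain x y where xy: "j = omap R (x, y)" "x \<in> ob I" "y \<in> ob (E0_ob E x)"
      using j by (rule J_obE)
    have "nat_trans J C (dgm D) (comp_ftr (dgm D') F) l'"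
      using k by (simp add: kan_opfibs_def F' pointwise_left_kan_def left_kan_def)
    from nat_transD(3)[OF this j]
    have "l' j \<in> hom C (omap (dgm D) (omap R (x, y))) (omap (dgm D') (omap S x))"
      using F_R[OF xy(2,3)] by (simp add: xy(1))
    from cancel_right[OF \<phi>_hom[OF xy(2,3)] n_hom[OF xy(2,3)] \<phi>_n[OF xy(2,3)] this l_R_hom[OF xy(2,3)]]
    show "l' j = l j"
      using cor' l_R[OF xy(2,3)] xy by simp
  qed
  ultimately show ?thesis
    by (simp add: F')
qed

end

section \<open>Isomorphisms of partial evaluations\<close>

lemma mult_mor_simps [simp]:
  "omap (fun_part (mult_mor t)) (x, y) = (omap (fun_part t) x, omap (fun_part (mor_of (nat_part t x))) y)"
  "amap (fun_part (mult_mor t)) ((x, y), (i, f), (x', y')) =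
     ((omap (fun_part t) x, omap (fun_part (mor_of (nat_part t x))) y),
      (amap (fun_part t) i, amap (fun_part (mor_of (nat_part t x'))) f),
      (omap (fun_part t) x', omap (fun_part (mor_of (nat_part t x'))) y'))"
  "nat_part (mult_mor t) (x, y) = nat_part (mor_of (nat_part t x)) y"
  by (simp_all add: mult_mor_def Let_def)

lemma colim_push_mor_simps [simp]:
  "fun_part (colim_push_mor C c t) = fun_part t"
  "nat_part (colim_push_mor C c t) x = amap (colim_ftr C c) (nat_part t x)"
  by (simp_all add: colim_push_mor_def)

lemma mor_of_cmp_diag_cat:
  assumes "a \<in> hom (diag_cat C) X Y" "b \<in> hom (diag_cat C) Y Z"
  shows "mor_of (cmp (diag_cat C) b a) = restrict_mor X (comp_mor C (mor_of b) (mor_of a))"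
proof -
  obtain m n where "a = (X, m, Y)" "b = (Y, n, Z)"
    using assms unfolding diag_cat_hom by blast
  then show ?thesis by simp
qed

locale peval_mor = P: partial_eval C E c D D' \<phi> n \<psi> m + P': partial_eval C E' c D D' \<phi>' n' \<psi>' m'
  for C :: "('o, 'a) cat" and E E' :: "('u, 'o, 'a) ddiagram" and c D D' \<phi> n \<psi> m \<phi>' n' \<psi>' m' +
  fixes t
  assumes t: "is_diag_mor (diag_cat C) E E' t"
    and t\<phi>: "mor_eq (mult C E) (comp_mor C \<phi>' (mult_mor t)) \<phi>"
    and t\<psi>: "mor_eq (colim_push C c E) (comp_mor C \<psi>' (colim_push_mor C c t)) \<psi>"
begin

abbreviation A where "A \<equiv> fun_part t"
abbreviation \<beta> where "\<beta> x \<equiv> mor_of (nat_part t x)"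

lemma functor_A: "is_functor P.I P'.I A"
  by (rule is_diag_morD(1)[OF t])

lemma t_hom: "x \<in> ob P.I \<Longrightarrow> nat_part t x \<in> hom (diag_cat C) (omap (dgm E) x) (omap (dgm E') (omap A x))"
  by (rule is_diag_morD(3)[OF t])

lemma t_eq: "x \<in> ob P.I \<Longrightarrow> nat_part t x = (omap (dgm E) x, \<beta> x, omap (dgm E') (omap A x))"
  and \<beta>: "x \<in> ob P.I \<Longrightarrow> is_diag_mor C (omap (dgm E) x) (omap (dgm E') (omap A x)) (\<beta> x)"
  using t_hom unfolding diag_cat_hom by auto

lemma \<beta>_ob: "x \<in> ob P.I \<Longrightarrow> y \<in> ob (E0_ob E x) \<Longrightarrow> omap (fun_part (\<beta> x)) y \<in> ob (E0_ob E' (omap A x))"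
  by (rule is_functorD(3)[OF is_diag_morD(1)[OF \<beta>]])

text \<open>Naturality of \<open>t\<close> is an equation of composites in
  \<open>diag_cat C\<close>. This is its functor part on objects, by which \<open>mult_mor t\<close>
  sends arrows of \<open>P.G\<close> to well-typed arrows of \<open>P'.G\<close>.\<close>

lemma \<beta>_nat_ob:
  assumes i: "i \<in> hom P.I x x'" and y: "y \<in> ob (E0_ob E x)"
  shows "omap (fun_part (\<beta> x')) (omap (E0_ar E i) y) = omap (E0_ar E' (amap A i)) (omap (fun_part (\<beta> x)) y)"
proof -
  note x = P.I.hom_ob[OF i]
  have "restrict_mor (omap (dgm E) x) (comp_mor C (\<beta> x') (mor_of (amap (dgm E) i))) =
    restrict_mor (omap (dgm E) x) (comp_mor C (mor_of (amap (dgm E') (amap A i))) (\<beta> x))"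
    using arg_cong[OF is_diag_morD(4)[OF t i], of mor_of]
      mor_of_cmp_diag_cat[OF is_functorD(4)[OF P.functor_E i] t_hom[OF x(2)]]
      mor_of_cmp_diag_cat[OF t_hom[OF x(1)] is_functorD(4)[OF P'.functor_E is_functorD(4)[OF functor_A i]]]
    by simp
  from arg_cong[OF this, of "\<lambda>m. omap (fun_part m) y"] show ?thesis
    using y by (simp add: restrict_mor_simps)
qed

lemma R_ob: "x \<in> ob P.I \<Longrightarrow> y \<in> ob (E0_ob E x) \<Longrightarrow>
    omap P.R (x, y) = omap P'.R (omap A x, omap (fun_part (\<beta> x)) y)"
  using bspec[OF conjunct1[OF t\<phi>[unfolded mor_eq_iff]], of "(x, y)"] by simp

lemma S_ob: "x \<in> ob P.I \<Longrightarrow> omap P.S x = omap P'.S (omap A x)"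
  and S_ar: "i \<in> ar P.I \<Longrightarrow> amap P.S i = amap P'.S (amap A i)"
  using t\<psi> unfolding mor_eq_iff by auto

lemma mult_mor_ar:
  assumes "((x, y), (i, f), (x', y')) \<in> ar P.G"
  shows "((omap A x, omap (fun_part (\<beta> x)) y), (amap A i, amap (fun_part (\<beta> x')) f), (omap A x', omap (fun_part (\<beta> x')) y')) \<in> ar P'.G"
proof -
  have a: "i \<in> hom P.I x x'" "y \<in> ob (E0_ob E x)" "f \<in> hom (E0_ob E x') (omap (E0_ar E i) y) y'"
    using assms by (simp_all add: P.G_ar)
  note x = P.I.hom_ob[OF a(1)]
  show ?thesis
    using is_functorD(4)[OF functor_A a(1)] \<beta>_ob[OF x(1) a(2)] is_functorD(4)[OF is_diag_morD(1)[OF \<beta>[OF x(2)]] a(3)]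
    by (simp add: P'.G_ar \<beta>_nat_ob[OF a(1,2)])
qed

lemma R_ar:
  assumes "((x, y), (i, f), (x', y')) \<in> ar P.G"
  shows "amap P.R ((x, y), (i, f), (x', y')) = amap P'.R ((omap A x, omap (fun_part (\<beta> x)) y),
      (amap A i, amap (fun_part (\<beta> x')) f), (omap A x', omap (fun_part (\<beta> x')) y'))"
proof -
  have "\<forall>a\<in>ar P.G. amap P'.R (amap (fun_part (mult_mor t)) a) = amap P.R a"
    using t\<phi> unfolding mor_eq_iff by simp
  from bspec[OF this assms] show ?thesis by simp
qed

text \<open>The data \<open>R\<close>, \<open>S\<close>, \<phi> and \<psi> of \<open>E\<close> are
  those of \<open>E'\<close> precomposed with \<open>t\<close>. Hence the triple built from
  \<open>E'\<close> also solves the equations for \<open>E\<close>, and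
  \<open>corresponds_unique\<close> makes the two triples equal.\<close>

lemma corresponds_source: "corresponds C c (E, \<phi>, \<psi>) (P'.F, P'.s, P'.l)"
  unfolding P.corresponds_iff
proof (intro conjI allI impI)
  fix x y assume xy: "x \<in> ob P.I" "y \<in> ob (E0_ob E x)"
  let ?y = "omap (fun_part (\<beta> x)) y"
  note Ax = is_functorD(3)[OF functor_A xy(1)] and y = \<beta>_ob[OF xy]
  show "omap P'.F (omap P.R (x, y)) = omap P.S x"
    using P'.F_R[OF Ax y] by (simp add: R_ob[OF xy] S_ob[OF xy(1)])
  have \<phi>: "nat_part \<phi> (x, y) = cmp C (nat_part \<phi>' (omap A x, ?y)) (nat_part (\<beta> x) y)"
    using bspec[OF conjunct2[OF conjunct2[OF t\<phi>[unfolded mor_eq_iff]]], of "(x, y)"] xy by simp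
  have \<psi>: "nat_part \<psi> x = cmp C (nat_part \<psi>' (omap A x)) (amap (colim_ftr C c) (nat_part t x))"
    using t\<psi> xy unfolding mor_eq_iff by simp
  note bh = is_diag_morD(3)[OF \<beta>[OF xy(1)] xy(2)]
  have colim: "amap (colim_ftr C c) (nat_part t x) \<in> hom C (P.col x) (P'.col (omap A x))"
    "cmp C (amap (colim_ftr C c) (nat_part t x)) (P.\<kappa> x y) = cmp C (P'.\<kappa> (omap A x) ?y) (nat_part (\<beta> x) y)"
    using colim_ftr_amap[OF P.c P.small_E_ob[OF xy(1)] P'.small_E_ob[OF Ax] \<beta>[OF xy(1)]] xy(2)
    by (simp_all flip: t_eq[OF xy(1)])
  have "cmp C (P'.l (omap P.R (x, y))) (nat_part \<phi> (x, y)) =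
      cmp C (cmp C (P'.l (omap P'.R (omap A x, ?y))) (nat_part \<phi>' (omap A x, ?y))) (nat_part (\<beta> x) y)"
    using P.assoc[OF bh P'.\<phi>_hom[OF Ax y] P'.l_R_hom[OF Ax y]] by (simp add: \<phi> R_ob[OF xy])
  also have "\<dots> = cmp C (nat_part \<psi>' (omap A x)) (cmp C (P'.\<kappa> (omap A x) ?y) (nat_part (\<beta> x) y))"
    using P.assoc[OF bh P'.\<kappa>_hom[OF Ax y] P'.\<psi>_hom[OF Ax]] by (simp add: P'.l_R[OF Ax y])
  also have "\<dots> = cmp C (nat_part \<psi> x) (P.\<kappa> x y)"
    using P.assoc[OF P.\<kappa>_hom[OF xy] colim(1) P'.\<psi>_hom[OF Ax]] by (simp add: \<psi> colim(2))
  finally show "cmp C (P'.l (omap P.R (x, y))) (nat_part \<phi> (x, y)) = cmp C (nat_part \<psi> x) (P.\<kappa> x y)" .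
next
  fix x y i x' assume i: "i \<in> hom P.I x x'" and y: "y \<in> ob (E0_ob E x)"
  note x = P.I.hom_ob[OF i]
  have "amap P.R (P.lift y i) = amap P'.R (P'.lift (omap (fun_part (\<beta> x)) y) (amap A i))"
    unfolding P.lift_eq[OF i] P'.lift_eq[OF is_functorD(4)[OF functor_A i]]
    using R_ar[OF P.lift_ar[OF i y, unfolded P.lift_eq[OF i]]]
      is_functorD(5)[OF is_diag_morD(1)[OF \<beta>[OF x(2)]] P.E0_ob[OF i y]] \<beta>_nat_ob[OF i y] by simp
  then show "P'.s (omap P.R (x, y), amap P.S i) = amap P.R (P.lift y i)"
    using P'.s_R[OF is_functorD(4)[OF functor_A i] \<beta>_ob[OF x(1) y]]
    by (simp add: R_ob[OF x(1) y] S_ar[OF homD(1)[OF i]])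
next
  fix p i f q assume a: "(p, (i, f), q) \<in> ar P.G"
  obtain x y x' y' where pq: "p = (x, y)" "q = (x', y')" by (cases p; cases q)
  note a = a[unfolded pq]
  show "amap P'.F (amap P.R (p, (i, f), q)) = amap P.S i"
    unfolding pq R_ar[OF a] using P'.F_R_ar[OF mult_mor_ar[OF a]] S_ar[of i] a
    by (simp add: P.G_ar hom_def)
qed

end

text \<open>Conversely, if \<open>E\<close> and \<open>E'\<close> induce the same split opfibration, then \<open>\<theta> = \<phi>'\<inverse> \<circ> \<phi>\<close> is an isomorphism
  \<open>\<mu>(E) \<cong> \<mu>(E')\<close> over \<open>\<psi>'\<inverse> \<circ> \<psi>\<close> which preserves the splittings; hence it is \<open>\<mu>\<close> of an isomorphism.\<close>

locale peval_pair = P: partial_eval C E c D D' \<phi> n \<psi> m + P': partial_eval C E' c D D' \<phi>' n' \<psi>' m'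
  for C :: "('o, 'a) cat" and E E' :: "('u, 'o, 'a) ddiagram" and c D D' \<phi> n \<psi> m \<phi>' n' \<psi>' m' +
  assumes agree: "P'.F = P.F" "P'.s = P.s" "P'.l = P.l"
begin

abbreviation \<theta> where "\<theta> \<equiv> comp_mor C n' \<phi>"
abbreviation \<Theta> where "\<Theta> \<equiv> fun_part \<theta>"
abbreviation A where "A \<equiv> comp_ftr P'.T P.S"
text \<open>Agreement of the functors \<open>F\<close> forces the first coordinate of
  \<open>omap \<Theta> (x, y)\<close> to be \<open>omap A x\<close>, so the second carries all the
  new information.\<close>

definition \<alpha> where "\<alpha> x y = snd (omap \<Theta> (x, y))"
text \<open>The projections select the fibre arrow \<open>f\<close> from an encoded arrow
  \<open>(p, (i, f), q)\<close>.\<close>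

definition \<alpha>_ar where "\<alpha>_ar x f = snd (fst (snd (amap \<Theta> (P.vert x f))))"

lemma \<theta>: "is_diag_mor C (mult C E) (mult C E') \<theta>"
  by (rule is_diag_mor_comp[OF P.\<phi> P'.n]) (simp add: P'.functor_mult)

lemma functor_\<Theta>: "is_functor P.G P'.G \<Theta>"
  using is_diag_morD(1)[OF \<theta>] by simp

lemma functor_A: "is_functor P.I P'.I A"
  by (rule is_functor_comp[OF P.functor_S P'.functor_T])

context
  fixes x y assumes xy: "x \<in> ob P.I" "y \<in> ob (E0_ob E x)"
begin

lemma \<Theta>_ob: "omap \<Theta> (x, y) = (omap A x, \<alpha> x y)" and \<alpha>_ob: "\<alpha> x y \<in> ob (E0_ob E' (omap A x))"
proof -
  obtain x' y' where R: "omap P.R (x, y) = omap P'.R (x', y')" and xy': "x' \<in> ob P'.I" "y' \<in> ob (E0_ob E' x')"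
    by (rule P'.J_obE[OF P.R_ob[OF xy]])
  have "omap P'.S x' = omap P.S x"
    using P'.F_R[OF xy'] P.F_R[OF xy] by (simp add: agree R)
  then have "x' = omap A x"
    using P'.TS(1)[OF xy'(1)] by simp
  moreover have "omap \<Theta> (x, y) = (x', y')"
    using P'.QR(1)[of "(x', y')"] xy' by (simp add: R)
  ultimately show "omap \<Theta> (x, y) = (omap A x, \<alpha> x y)" "\<alpha> x y \<in> ob (E0_ob E' (omap A x))"
    using xy'(2) by (simp_all add: \<alpha>_def)
qed

lemma R_\<Theta>: "omap P'.R (omap A x, \<alpha> x y) = omap P.R (x, y)"
  using P'.RQ(1)[OF P.R_ob[OF xy]] \<Theta>_ob by simp

end

text \<open>The common splitting has one value at \<open>R (x, y)\<close> and \<open>S i\<close>,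
  and \<open>s_R\<close> on each side shows this value as the image of a canonical lift.\<close>

lemma \<Theta>_lift:
  assumes i: "i \<in> hom P.I x x'" and y: "y \<in> ob (E0_ob E x)"
  shows "amap \<Theta> (P.lift y i) = P'.lift (\<alpha> x y) (amap A i)"
proof -
  note x = P.I.hom_ob[OF i]
  note Ai = is_functorD(4)[OF functor_A i] and ay = \<alpha>_ob[OF x(1) y]
  have "amap P.R (P.lift y i) = amap P'.R (P'.lift (\<alpha> x y) (amap A i))"
    using P.s_R[OF i y] P'.s_R[OF Ai ay] P'.ST(2)[OF homD(1)[OF is_functorD(4)[OF P.functor_S i]]]
      R_\<Theta>[OF x(1) y] by (simp add: agree)
  then show ?thesis
    using P'.QR(2)[OF P'.lift_ar[OF Ai ay]] by simp
qed

text \<open>The image of a vertical arrow lies over an identity because \<open>F\<close> is common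
  to both sides and \<psi>' is invertible; hence it is vertical again.\<close>

lemma \<Theta>_vert:
  assumes x: "x \<in> ob P.I" and f: "f \<in> hom (E0_ob E x) y y'"
  shows "amap \<Theta> (P.vert x f) = P'.vert (omap A x) (\<alpha>_ar x f)"
    and "\<alpha>_ar x f \<in> hom (E0_ob E' (omap A x)) (\<alpha> x y) (\<alpha> x y')"
proof -
  note y = category.hom_ob[OF P.category_E0[OF x] f]
  note Ax = is_functorD(3)[OF functor_A x]
  note V = P.vert_hom[OF x f]
  have "amap \<Theta> (P.vert x f) \<in> hom P'.G (omap A x, \<alpha> x y) (omap A x, \<alpha> x y')"
    using is_functorD(4)[OF functor_\<Theta> V] \<Theta>_ob[OF x y(1)] \<Theta>_ob[OF x y(2)] by simp
  then obtain i g where g: "amap \<Theta> (P.vert x f) = ((omap A x, \<alpha> x y), (i, g), (omap A x, \<alpha> x y'))"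
    "i \<in> hom P'.I (omap A x) (omap A x)"
    "g \<in> hom (E0_ob E' (omap A x)) (omap (E0_ar E' i) (\<alpha> x y)) (\<alpha> x y')"
    by (rule P'.G_homE) auto
  have a: "((omap A x, \<alpha> x y), (i, g), (omap A x, \<alpha> x y')) \<in> ar P'.G"
    using g(2,3) \<alpha>_ob[OF x y(1)] by (simp add: P'.G_ar)
  have "amap P'.R (amap \<Theta> (P.vert x f)) = amap P.R (P.vert x f)"
    using P'.RQ(2)[OF homD(1)[OF is_functorD(4)[OF P.functor_R V]]] by simp
  moreover have "amap P.F (amap P.R (P.vert x f)) = amap P.S (idt P.I x)"
    unfolding P.vert_def by (rule P.F_R_ar) (use homD(1)[OF V] in \<open>simp add: P.vert_def\<close>)
  ultimately have "amap P'.S i = amap P.S (idt P.I x)"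
    using P'.F_R_ar[OF a] unfolding agree g(1) by metis
  then have i: "i = idt P'.I (omap A x)"
    using P'.TS(2)[OF homD(1)[OF g(2)]] is_functorD(5)[OF functor_A x] by simp
  have g': "g \<in> hom (E0_ob E' (omap A x)) (\<alpha> x y) (\<alpha> x y')"
    using g(3) P'.E_idt(1)[OF Ax \<alpha>_ob[OF x y(1)]] by (simp add: i)
  have ag: "\<alpha>_ar x f = g"
    by (simp add: \<alpha>_ar_def g(1) del: comp_mor_simps)
  show "amap \<Theta> (P.vert x f) = P'.vert (omap A x) (\<alpha>_ar x f)"
    "\<alpha>_ar x f \<in> hom (E0_ob E' (omap A x)) (\<alpha> x y) (\<alpha> x y')"
    unfolding ag g(1) P'.vert_def homD(2,3)[OF g'] i by (rule refl, rule g')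
qed

text \<open>An arrow is a vertical one after a lift, and \<Theta> preserves both kinds. Comparing
  targets of lifts gives the second claim.\<close>

lemma \<Theta>_ar:
  assumes "((x, y), (i, f), (x', y')) \<in> ar P.G"
  shows "amap \<Theta> ((x, y), (i, f), (x', y')) = ((omap A x, \<alpha> x y), (amap A i, \<alpha>_ar x' f), (omap A x', \<alpha> x' y'))"
    and "omap (E0_ar E' (amap A i)) (\<alpha> x y) = \<alpha> x' (omap (E0_ar E i) y)"
proof -
  have a: "i \<in> hom P.I x x'" "y \<in> ob (E0_ob E x)" "f \<in> hom (E0_ob E x') (omap (E0_ar E i) y) y'"
    using assms by (simp_all add: P.G_ar)
  note x = P.I.hom_ob[OF a(1)]
  note Ey = P.E0_ob[OF a(1,2)]
  note L = P.lift_hom[OF a(1,2)] and V = P.vert_hom[OF x(2) a(3)]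
  note Ai = is_functorD(4)[OF functor_A a(1)] and ay = \<alpha>_ob[OF x(1) a(2)]
  show tgt: "omap (E0_ar E' (amap A i)) (\<alpha> x y) = \<alpha> x' (omap (E0_ar E i) y)"
    using homD(3)[OF is_functorD(4)[OF functor_\<Theta> L]] \<Theta>_ob[OF x(2) Ey] \<Theta>_lift[OF a(1,2)]
      homD(3)[OF P'.lift_hom[OF Ai ay]] by simp
  have "amap \<Theta> ((x, y), (i, f), (x', y')) = amap \<Theta> (cmp P.G (P.vert x' f) (P.lift y i))"
    by (simp add: P.vert_cmp_lift[OF a])
  also have "\<dots> = cmp P'.G (P'.vert (omap A x') (\<alpha>_ar x' f)) (P'.lift (\<alpha> x y) (amap A i))"
    unfolding is_functorD(6)[OF functor_\<Theta> L V] \<Theta>_lift[OF a(1,2)] \<Theta>_vert(1)[OF x(2) a(3)] by simp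
  also have "\<dots> = ((omap A x, \<alpha> x y), (amap A i, \<alpha>_ar x' f), (omap A x', \<alpha> x' y'))"
    by (rule P'.vert_cmp_lift[OF Ai ay]) (use \<Theta>_vert(2)[OF x(2) a(3)] in \<open>simp only: tgt\<close>)
  finally show "amap \<Theta> ((x, y), (i, f), (x', y')) = ((omap A x, \<alpha> x y), (amap A i, \<alpha>_ar x' f), (omap A x', \<alpha> x' y'))" .
qed

lemma \<alpha>_E0_ob:
  assumes "i \<in> hom P.I x x'" "y \<in> ob (E0_ob E x)"
  shows "\<alpha> x' (omap (E0_ar E i) y) = omap (E0_ar E' (amap A i)) (\<alpha> x y)"
  using \<Theta>_ar(2) P.lift_ar[OF assms] unfolding P.lift_eq[OF assms(1)] by metis

text \<open>Apply \<Theta> to the exchange law \<open>lift_cmp_vert\<close>. Both sides become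
  vertical arrows after the same lift in \<open>P'.G\<close>, so their fibre arrows are
  equal.\<close>

lemma \<alpha>_E0_ar:
  assumes i: "i \<in> hom P.I x x'" and f: "f \<in> hom (E0_ob E x) y y'"
  shows "\<alpha>_ar x' (amap (E0_ar E i) f) = amap (E0_ar E' (amap A i)) (\<alpha>_ar x f)"
proof -
  note x = P.I.hom_ob[OF i] and y = category.hom_ob[OF P.category_E0[OF P.I.hom_ob(1)[OF i]] f]
  note Ai = is_functorD(4)[OF functor_A i] and Ef = P.E0_hom[OF i f]
  note af = \<Theta>_vert(2)[OF x(1) f] and aEf = \<Theta>_vert(2)[OF x(2) Ef]
  have "cmp P'.G (P'.vert (omap A x') (\<alpha>_ar x' (amap (E0_ar E i) f))) (P'.lift (\<alpha> x y) (amap A i))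
      = amap \<Theta> (cmp P.G (P.vert x' (amap (E0_ar E i) f)) (P.lift y i))"
    unfolding is_functorD(6)[OF functor_\<Theta> P.lift_hom[OF i y(1)] P.vert_hom[OF x(2) Ef]]
      \<Theta>_lift[OF i y(1)] \<Theta>_vert(1)[OF x(2) Ef] by simp
  also have "\<dots> = cmp P'.G (P'.lift (\<alpha> x y') (amap A i)) (P'.vert (omap A x) (\<alpha>_ar x f))"
    unfolding P.lift_cmp_vert[OF i f, symmetric]
      is_functorD(6)[OF functor_\<Theta> P.vert_hom[OF x(1) f] P.lift_hom[OF i y(2)]]
      \<Theta>_lift[OF i y(2)] \<Theta>_vert(1)[OF x(1) f] by simp
  also have "\<dots> = cmp P'.G (P'.vert (omap A x') (amap (E0_ar E' (amap A i)) (\<alpha>_ar x f))) (P'.lift (\<alpha> x y) (amap A i))"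
    by (rule P'.lift_cmp_vert[OF Ai af])
  finally show ?thesis
    using P'.vert_cmp_lift[OF Ai \<alpha>_ob[OF x(1) y(1)] aEf[unfolded \<alpha>_E0_ob[OF i y(1)]]]
      P'.vert_cmp_lift[OF Ai \<alpha>_ob[OF x(1) y(1)] P'.E0_hom[OF Ai af]] by simp
qed

lemma \<theta>_hom: "x \<in> ob P.I \<Longrightarrow> y \<in> ob (E0_ob E x) \<Longrightarrow>
    nat_part \<theta> (x, y) \<in> hom C (omap (E1_ob E x) y) (omap (E1_ob E' (omap A x)) (\<alpha> x y))"
  using is_diag_morD(3)[OF \<theta>, of "(x, y)"] by (simp del: comp_mor_simps add: \<Theta>_ob)

definition component where
  "component x = \<lparr>fun_part = \<lparr>omap = \<alpha> x, amap = \<alpha>_ar x\<rparr>, nat_part = (\<lambda>y. nat_part \<theta> (x, y))\<rparr>"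

lemma component_simps [simp]:
  "omap (fun_part (component x)) = \<alpha> x" "amap (fun_part (component x)) = \<alpha>_ar x"
  "nat_part (component x) y = nat_part \<theta> (x, y)"
  by (simp_all add: component_def)

text \<open>Since \<open>vert\<close> embeds each fibre faithfully into the Grothendieck
  construction, the functor laws and naturality of the component are those of \<Theta> and \<theta>
  on vertical arrows.\<close>

lemma component:
  assumes x: "x \<in> ob P.I"
  shows "is_diag_mor C (omap (dgm E) x) (omap (dgm E') (omap A x)) (component x)"
proof (rule is_diag_morI)
  note Ax = is_functorD(3)[OF functor_A x]
  show "is_functor (E0_ob E x) C (E1_ob E x)" by (rule P.functor_E1[OF x])
  show "is_functor (E0_ob E' (omap A x)) C (E1_ob E' (omap A x))" by (rule P'.functor_E1[OF Ax])
  show "is_functor (E0_ob E x) (E0_ob E' (omap A x)) (fun_part (component x))"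
  proof (rule is_functorI[OF P.category_E0[OF x] P'.category_E0[OF Ax]], unfold component_simps)
    fix y assume y: "y \<in> ob (E0_ob E x)"
    show "\<alpha> x y \<in> ob (E0_ob E' (omap A x))" by (rule \<alpha>_ob[OF x y])
    have idy: "idt (E0_ob E x) y \<in> hom (E0_ob E x) y y"
      by (rule category.idt_hom[OF P.category_E0[OF x] y])
    have "P'.vert (omap A x) (\<alpha>_ar x (idt (E0_ob E x) y)) = amap \<Theta> (P.vert x (idt (E0_ob E x) y))"
      by (rule \<Theta>_vert(1)[OF x idy, symmetric])
    also have "\<dots> = idt P'.G (omap \<Theta> (x, y))"
      unfolding P.vert_idt[OF x y] by (rule is_functorD(5)[OF functor_\<Theta>]) (simp add: x y)
    also have "\<dots> = P'.vert (omap A x) (idt (E0_ob E' (omap A x)) (\<alpha> x y))"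
      unfolding \<Theta>_ob[OF x y] by (rule P'.vert_idt[OF Ax \<alpha>_ob[OF x y], symmetric])
    finally show "\<alpha>_ar x (idt (E0_ob E x) y) = idt (E0_ob E' (omap A x)) (\<alpha> x y)"
      by (simp add: P'.vert_def)
  next
    fix f y y' assume f: "f \<in> hom (E0_ob E x) y y'"
    show "\<alpha>_ar x f \<in> hom (E0_ob E' (omap A x)) (\<alpha> x y) (\<alpha> x y')" by (rule \<Theta>_vert(2)[OF x f])
    fix g y'' assume g: "g \<in> hom (E0_ob E x) y' y''"
    note gf = category.cmp_in_hom[OF P.category_E0[OF x] f g]
    have "P'.vert (omap A x) (\<alpha>_ar x (cmp (E0_ob E x) g f)) = amap \<Theta> (P.vert x (cmp (E0_ob E x) g f))"
      by (rule \<Theta>_vert(1)[OF x gf, symmetric])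
    also have "\<dots> = cmp P'.G (P'.vert (omap A x) (\<alpha>_ar x g)) (P'.vert (omap A x) (\<alpha>_ar x f))"
      unfolding P.vert_cmp[OF x f g] is_functorD(6)[OF functor_\<Theta> P.vert_hom[OF x f] P.vert_hom[OF x g]]
        \<Theta>_vert(1)[OF x f] \<Theta>_vert(1)[OF x g] by simp
    also have "\<dots> = P'.vert (omap A x) (cmp (E0_ob E' (omap A x)) (\<alpha>_ar x g) (\<alpha>_ar x f))"
      by (rule P'.vert_cmp[OF Ax \<Theta>_vert(2)[OF x f] \<Theta>_vert(2)[OF x g], symmetric])
    finally show "\<alpha>_ar x (cmp (E0_ob E x) g f) = cmp (E0_ob E' (omap A x)) (\<alpha>_ar x g) (\<alpha>_ar x f)"
      by (simp add: P'.vert_def)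
  qed
  show "nat_part (component x) y \<in> hom C (omap (E1_ob E x) y) (omap (E1_ob E' (omap A x)) (omap (fun_part (component x)) y))"
    if "y \<in> ob (E0_ob E x)" for y
    unfolding component_simps by (rule \<theta>_hom[OF x that])
  show "cmp C (nat_part (component x) y') (amap (E1_ob E x) f) =
      cmp C (amap (E1_ob E' (omap A x)) (amap (fun_part (component x)) f)) (nat_part (component x) y)"
    if f: "f \<in> hom (E0_ob E x) y y'" for f y y'
    using is_diag_morD(4)[OF \<theta>, of "P.vert x f" "(x, y)" "(x, y')"] P.vert_hom[OF x f]
    unfolding component_simps \<Theta>_vert(1)[OF x f] P'.mult_vert[OF Ax \<Theta>_vert(2)[OF x f]] P.mult_vert[OF x f]
    by (simp del: comp_mor_simps)
qed

text \<open>Naturality of \<theta> at a lift, where the multiplication reduces to the bare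
  transition component by \<open>mult_lift\<close>.\<close>

lemma \<theta>_nat_lift:
  assumes i: "i \<in> hom P.I x x'" and y: "y \<in> ob (E0_ob E x)"
  shows "cmp C (nat_part \<theta> (x', omap (E0_ar E i) y)) (E1_ar E i y) =
    cmp C (E1_ar E' (amap A i) (\<alpha> x y)) (nat_part \<theta> (x, y))"
  using is_diag_morD(4)[OF \<theta>, of "P.lift y i" "(x, y)" "(x', omap (E0_ar E i) y)"] P.lift_hom[OF i y]
  unfolding \<Theta>_lift[OF i y] P.mult_lift[OF i y]
    P'.mult_lift[OF is_functorD(4)[OF functor_A i] \<alpha>_ob[OF P.I.hom_ob(1)[OF i] y]]
  by (simp del: comp_mor_simps)

definition t where
  "t = \<lparr>fun_part = A,
    nat_part = (\<lambda>x. (omap (dgm E) x, restrict_mor (omap (dgm E) x) (component x), omap (dgm E') (omap A x)))\<rparr>"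

lemma t_simps [simp]:
  "fun_part t = A"
  "nat_part t x = (omap (dgm E) x, restrict_mor (omap (dgm E) x) (component x), omap (dgm E') (omap A x))"
  by (simp_all add: t_def)

lemma t_hom: "x \<in> ob P.I \<Longrightarrow> nat_part t x \<in> hom (diag_cat C) (omap (dgm E) x) (omap (dgm E') (omap A x))"
  using P.small_E_ob P'.small_E_ob[OF is_functorD(3)[OF functor_A]]
    is_diag_mor_restrict[OF component P'.functor_E1[OF is_functorD(3)[OF functor_A]]]
  by (simp add: diag_cat_hom restrict_mor_idem)

text \<open>A naturality square in \<open>diag_cat C\<close> has three parts: transport of objects,
  transport of arrows, and transition components. They are \<open>\<alpha>_E0_ob\<close>,
  \<open>\<alpha>_E0_ar\<close> and \<open>\<theta>_nat_lift\<close>.\<close>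

lemma t: "is_diag_mor (diag_cat C) E E' t"
proof (rule is_diag_morI[OF _ P.functor_E P'.functor_E])
  show "is_functor P.I P'.I (fun_part t)" using functor_A by simp
  show "nat_part t x \<in> hom (diag_cat C) (omap (dgm E) x) (omap (dgm E') (omap (fun_part t) x))"
    if "x \<in> ob P.I" for x
    using t_hom[OF that] by simp
  fix i x x' assume i: "i \<in> hom P.I x x'"
  note x = P.I.hom_ob[OF i]
  note Ai = is_functorD(4)[OF functor_A i]
  obtain e e' where e: "amap (dgm E) i = (omap (dgm E) x, e, omap (dgm E) x')"
    "amap (dgm E') (amap A i) = (omap (dgm E') (omap A x), e', omap (dgm E') (omap A x'))"
    using P.amap_E(1)[OF i] P'.amap_E(1)[OF Ai] by blast
  have eE: "mor_of (amap (dgm E) i) = e" "mor_of (amap (dgm E') (amap A i)) = e'"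
    by (simp_all only: e fst_conv snd_conv)
  let ?l = "comp_mor C (restrict_mor (omap (dgm E) x') (component x')) e"
    and ?r = "comp_mor C e' (restrict_mor (omap (dgm E) x) (component x))"
  have "mor_eq (omap (dgm E) x) ?l ?r"
    unfolding mor_eq_iff
  proof (intro conjI ballI)
    fix y assume y: "y \<in> ob (E0_ob E x)"
    show "omap (fun_part ?l) y =
        omap (fun_part ?r) y"
      using \<alpha>_E0_ob[OF i y] P.E0_ob[OF i y] y unfolding eE by (simp add: restrict_mor_simps)
    show "nat_part ?l y =
        nat_part ?r y"
      using \<theta>_nat_lift[OF i y] P.E0_ob[OF i y] y unfolding eE by (simp add: restrict_mor_simps)
  next
    fix f assume f: "f \<in> ar (E0_ob E x)"
    then have f': "f \<in> hom (E0_ob E x) (src (E0_ob E x) f) (tgt (E0_ob E x) f)" by (simp add: hom_def)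
    show "amap (fun_part ?l) f =
        amap (fun_part ?r) f"
      using \<alpha>_E0_ar[OF i f'] homD(1)[OF P.E0_hom[OF i f']] f unfolding eE by (simp add: restrict_mor_simps)
  qed
  then show "cmp (diag_cat C) (nat_part t x') (amap (dgm E) i) =
      cmp (diag_cat C) (amap (dgm E') (amap (fun_part t) i)) (nat_part t x)"
    unfolding t_simps e by (simp add: mor_eq_def)
qed

text \<open>The transformation \<theta> is \<phi> followed by the inverse of \<phi>', which
  cancels.\<close>

lemma \<phi>_\<theta>:
  assumes xy: "x \<in> ob P.I" "y \<in> ob (E0_ob E x)"
  shows "cmp C (nat_part \<phi>' (omap A x, \<alpha> x y)) (nat_part \<theta> (x, y)) = nat_part \<phi> (x, y)"
proof -
  note Ax = is_functorD(3)[OF functor_A xy(1)] and ay = \<alpha>_ob[OF xy]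
  show ?thesis
    using P.assoc[OF P.\<phi>_hom[OF xy] P'.n_hom[OF Ax ay, unfolded R_\<Theta>[OF xy]]
        P'.\<phi>_hom[OF Ax ay, unfolded R_\<Theta>[OF xy]]]
      P'.\<phi>_n[OF Ax ay] R_\<Theta>[OF xy] P.idt_left[OF P.\<phi>_hom[OF xy]] by simp
qed

lemma mult_mor_t: "mor_eq (mult C E) (comp_mor C \<phi>' (mult_mor t)) \<phi>"
  unfolding mor_eq_iff P.mult_simps
proof (intro conjI ballI)
  fix p assume p: "p \<in> ob P.G"
  obtain x y where e: "p = (x, y)" by (cases p)
  have xy: "x \<in> ob P.I" "y \<in> ob (E0_ob E x)"
    using p by (auto simp: e)
  show "omap (fun_part (comp_mor C \<phi>' (mult_mor t))) p = omap P.R p"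
    using R_\<Theta>[OF xy] xy by (simp add: e restrict_mor_simps)
  show "nat_part (comp_mor C \<phi>' (mult_mor t)) p = nat_part \<phi> p"
    using \<phi>_\<theta>[OF xy] xy by (simp add: e restrict_mor_simps)
next
  fix a assume a: "a \<in> ar P.G"
  then obtain x y i f x' y' where e: "a = ((x, y), (i, f), (x', y'))" "i \<in> hom P.I x x'"
    "y \<in> ob (E0_ob E x)" "f \<in> hom (E0_ob E x') (omap (E0_ar E i) y) y'"
    by (rule P.G_arE)
  note x = P.I.hom_ob[OF e(2)]
  note y' = category.hom_ob(2)[OF P.category_E0[OF x(2)] e(4)]
  have "amap (fun_part (mult_mor t)) a = amap \<Theta> a"
    using \<Theta>_ar(1)[OF a[unfolded e(1)]] e(3) y' homD(1)[OF e(4)] by (simp add: e(1) restrict_mor_simps)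
  then show "amap (fun_part (comp_mor C \<phi>' (mult_mor t))) a = amap P.R a"
    using P'.RQ(2)[OF is_functor_ar(1)[OF P.functor_R a]] by simp
qed

text \<open>Agreement of the transformations \<open>l\<close> enters here: on components both sides
  are arrows out of the chosen colimit of \<open>E x\<close>, and \<open>l_R\<close> for
  \<open>E'\<close> and for \<open>E\<close> evaluates them on its legs.\<close>

lemma colim_push_mor_t: "mor_eq (colim_push C c E) (comp_mor C \<psi>' (colim_push_mor C c t)) \<psi>"
  unfolding mor_eq_iff P.colim_push_simps
proof (intro conjI ballI)
  fix x assume x: "x \<in> ob P.I"
  note Ax = is_functorD(3)[OF functor_A x]
  note S = P'.ST(1)[OF is_functorD(3)[OF P.functor_S x]]
  show "omap (fun_part (comp_mor C \<psi>' (colim_push_mor C c t))) x = omap P.S x"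
    using S by simp
  have r: "is_diag_mor C (omap (dgm E) x) (omap (dgm E') (omap A x)) (restrict_mor (omap (dgm E) x) (component x))"
    using t_hom[OF x] by (simp add: diag_cat_hom)
  note colim = colim_ftr_amap[OF P.c P.small_E_ob[OF x] P'.small_E_ob[OF Ax] r, folded t_simps(2)]
  note q' = P'.\<psi>_hom[OF Ax]
  have q'': "nat_part \<psi>' (omap A x) \<in> hom C (P'.col (omap A x)) (omap (dgm D') (omap P.S x))"
    using q' S by simp
  have "cmp C (nat_part \<psi>' (omap A x)) (amap (colim_ftr C c) (nat_part t x)) = nat_part \<psi> x"
  proof (rule is_colimit_eqI[OF P.colimit_\<kappa>[OF x] P.cmp_in_hom[OF colim(1) q''] P.\<psi>_hom[OF x]])
    fix y assume y: "y \<in> ob (E0_ob E x)"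
    note ay = \<alpha>_ob[OF x y] and k = P'.\<kappa>_hom[OF Ax \<alpha>_ob[OF x y]] and th = \<theta>_hom[OF x y]
    have "cmp C (cmp C (nat_part \<psi>' (omap A x)) (amap (colim_ftr C c) (nat_part t x))) (P.\<kappa> x y) =
        cmp C (nat_part \<psi>' (omap A x)) (cmp C (P'.\<kappa> (omap A x) (\<alpha> x y)) (nat_part \<theta> (x, y)))"
      using P.assoc[OF P.\<kappa>_hom[OF x y] colim(1) q'] colim(2)[OF y] y
      by (simp add: restrict_mor_simps del: comp_mor_simps t_simps)
    also have "\<dots> = cmp C (cmp C (P'.l (omap P'.R (omap A x, \<alpha> x y))) (nat_part \<phi>' (omap A x, \<alpha> x y))) (nat_part \<theta> (x, y))"
      using P.assoc[OF th k q'] P'.l_R[OF Ax ay] by simp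
    also have "\<dots> = cmp C (P.l (omap P.R (x, y))) (nat_part \<phi> (x, y))"
      using P.assoc[OF th P'.\<phi>_hom[OF Ax ay] P'.l_R_hom[OF Ax ay]] \<phi>_\<theta>[OF x y] R_\<Theta>[OF x y]
      by (simp add: agree)
    also have "\<dots> = cmp C (nat_part \<psi> x) (P.\<kappa> x y)"
      by (rule P.l_R[OF x y])
    finally show "cmp C (cmp C (nat_part \<psi>' (omap A x)) (amap (colim_ftr C c) (nat_part t x))) (P.\<kappa> x y) =
        cmp C (nat_part \<psi> x) (P.\<kappa> x y)" .
  qed
  then show "nat_part (comp_mor C \<psi>' (colim_push_mor C c t)) x = nat_part \<psi> x"
    by simp
next
  fix i assume "i \<in> ar P.I"
  then show "amap (fun_part (comp_mor C \<psi>' (colim_push_mor C c t))) i = amap P.S i"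
    using P'.ST(2)[OF is_functor_ar(1)[OF P.functor_S]] by simp
qed

definition arrow where "arrow = (E, restrict_mor E t, E')"

lemma arrow_hom: "arrow \<in> hom (diag_cat (diag_cat C)) E E'"
  using P.small_E P'.small_E is_diag_mor_restrict[OF t P'.functor_E]
  by (simp add: arrow_def diag_cat_hom restrict_mor_idem)

end

section \<open>Invertibility of the induced morphism\<close>

context peval_pair
begin

interpretation swap: peval_pair C E' E c D D' \<phi>' n' \<psi>' m' \<phi> n \<psi> m
  by unfold_locales (simp_all add: agree)

text \<open>The agreement assumptions are symmetric, so the same construction from \<open>E'\<close>
  to \<open>E\<close> supplies the candidate inverse. It undoes each \<open>component\<close>
  because \<open>swap.\<Theta>\<close> undoes \<Theta>.\<close>

lemma swap_arrow: "cmp (diag_cat (diag_cat C)) swap.arrow arrow = idt (diag_cat (diag_cat C)) E"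
proof -
  let ?T = "comp_mor (diag_cat C) (restrict_mor E' swap.t) (restrict_mor E t)"
  have "mor_eq E ?T (id_mor (diag_cat C) E)"
    unfolding mor_eq_iff
  proof (intro conjI ballI)
    fix x assume x: "x \<in> ob P.I"
    note Ax = is_functorD(3)[OF functor_A x]
    have AA: "omap swap.A (omap A x) = x"
      using x P'.ST(1)[OF is_functorD(3)[OF P.functor_S x]] by simp
    then show "omap (fun_part ?T) x =
        omap (fun_part (id_mor (diag_cat C) E)) x"
      using x Ax by (simp add: restrict_mor_simps)
    let ?M = "comp_mor C (restrict_mor (omap (dgm E') (omap A x)) (swap.component (omap A x)))
      (restrict_mor (omap (dgm E) x) (component x))"
    have "mor_eq (omap (dgm E) x) ?M (id_mor C (omap (dgm E) x))"
      unfolding mor_eq_iff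
    proof (intro conjI ballI)
      fix y assume y: "y \<in> ob (E0_ob E x)"
      note ay = \<alpha>_ob[OF x y]
      have "omap swap.\<Theta> (omap A x, \<alpha> x y) = (x, y)"
        using R_\<Theta>[OF x y] P.QR(1)[of "(x, y)"] x y by simp
      then have aa: "swap.\<alpha> (omap A x) (\<alpha> x y) = y"
        by (simp add: swap.\<alpha>_def del: comp_mor_simps)
      then show "omap (fun_part ?M) y = omap (fun_part (id_mor C (omap (dgm E) x))) y"
        using y ay by (simp add: restrict_mor_simps)
      have "nat_part swap.\<theta> (omap A x, \<alpha> x y) = cmp C (nat_part n (omap P.R (x, y))) (nat_part \<phi>' (omap A x, \<alpha> x y))"
        using R_\<Theta>[OF x y] by simp
      then have "cmp C (nat_part swap.\<theta> (omap A x, \<alpha> x y)) (nat_part \<theta> (x, y)) =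
          cmp C (nat_part n (omap P.R (x, y))) (cmp C (nat_part \<phi>' (omap A x, \<alpha> x y)) (nat_part \<theta> (x, y)))"
        using P.assoc[OF \<theta>_hom[OF x y] P'.\<phi>_hom[OF Ax ay, unfolded R_\<Theta>[OF x y]] P.n_hom[OF x y]] by simp
      also have "\<dots> = idt C (omap (E1_ob E x) y)"
        unfolding \<phi>_\<theta>[OF x y] by (rule P.n_\<phi>[OF x y])
      finally show "nat_part ?M y = nat_part (id_mor C (omap (dgm E) x)) y"
        using y ay unfolding comp_mor_simps(2)[of C "restrict_mor U V" for U V]
        by (simp add: restrict_mor_simps del: comp_mor_simps)
    next
      fix f assume f: "f \<in> ar (E0_ob E x)"
      then have f': "f \<in> hom (E0_ob E x) (src (E0_ob E x) f) (tgt (E0_ob E x) f)" by (simp add: hom_def)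
      note V = P.vert_hom[OF x f']
      have "amap swap.\<Theta> (P'.vert (omap A x) (\<alpha>_ar x f)) = P.vert x f"
        unfolding \<Theta>_vert(1)[OF x f', symmetric]
        using P'.RQ(2)[OF homD(1)[OF is_functorD(4)[OF P.functor_R V]]] P.QR(2)[OF homD(1)[OF V]] by simp
      then have "swap.\<alpha>_ar (omap A x) (\<alpha>_ar x f) = f"
        by (simp add: swap.\<alpha>_ar_def P.vert_def del: comp_mor_simps)
      then show "amap (fun_part ?M) f = amap (fun_part (id_mor C (omap (dgm E) x))) f"
        using f homD(1)[OF \<Theta>_vert(2)[OF x f']] by (simp add: restrict_mor_simps)
    qed
    then show "nat_part ?T x =
        nat_part (id_mor (diag_cat C) E) x"
      using x Ax AA by (simp add: restrict_mor_simps mor_eq_def)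
  next
    fix i assume i: "i \<in> ar P.I"
    then show "amap (fun_part ?T) i =
        amap (fun_part (id_mor (diag_cat C) E)) i"
      using is_functor_ar(1)[OF functor_A i] P'.ST(2)[OF is_functor_ar(1)[OF P.functor_S i]]
      by (simp add: restrict_mor_simps)
  qed
  then show ?thesis
    by (simp add: arrow_def swap.arrow_def mor_eq_def)
qed

end

context peval_pair
begin

text \<open>The one-sided law \<open>swap_arrow\<close>, used for the pair and for the swapped pair,
  gives both inverse laws.\<close>

lemma is_iso_arrow: "is_iso (diag_cat (diag_cat C)) arrow"
proof -
  interpret swap: peval_pair C E' E c D D' \<phi>' n' \<psi>' m' \<phi> n \<psi> m
    by unfold_locales (simp_all add: agree)
  show ?thesis
    unfolding is_iso_def using arrow_hom swap.arrow_hom swap_arrow swap.swap_arrow homD[OF arrow_hom] by auto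
qed

text \<open>Compatibility was shown for \<open>t\<close>, while \<open>arrow\<close> carries its
  restriction; the two agree on carriers.\<close>

lemma mor_eq_arrow:
  "mor_eq (mult C E) (comp_mor C \<phi>' (mult_mor (mor_of arrow))) \<phi>"
  "mor_eq (colim_push C c E) (comp_mor C \<psi>' (colim_push_mor C c (mor_of arrow))) \<psi>"
proof -
  have "mor_eq (mult C E) (comp_mor C \<phi>' (mult_mor (restrict_mor E t))) (comp_mor C \<phi>' (mult_mor t))"
    unfolding mor_eq_iff P.mult_simps
  proof (intro conjI ballI)
    fix a assume "a \<in> ar P.G"
    then obtain x y i f x' y' where e: "a = ((x, y), (i, f), (x', y'))" "i \<in> hom P.I x x'"
      by (rule P.G_arE)
    show "amap (fun_part (comp_mor C \<phi>' (mult_mor (restrict_mor E t)))) a =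
      amap (fun_part (comp_mor C \<phi>' (mult_mor t))) a"
      using P.I.hom_ob[OF e(2)] homD(1)[OF e(2)] by (simp add: e(1) restrict_mor_simps)
  qed (auto simp: restrict_mor_simps)
  then show "mor_eq (mult C E) (comp_mor C \<phi>' (mult_mor (mor_of arrow))) \<phi>"
    using mult_mor_t by (simp add: mor_eq_def arrow_def)
  have "mor_eq (colim_push C c E) (comp_mor C \<psi>' (colim_push_mor C c (restrict_mor E t)))
      (comp_mor C \<psi>' (colim_push_mor C c t))"
    unfolding mor_eq_iff by (auto simp: restrict_mor_simps)
  then show "mor_eq (colim_push C c E) (comp_mor C \<psi>' (colim_push_mor C c (mor_of arrow))) \<psi>"
    using colim_push_mor_t by (simp add: mor_eq_def arrow_def)
qed

end

section \<open>From split opfibrations to partial evaluations\<close>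

text \<open>It suffices to invert the functor part as a map of objects and arrows respecting ends,
  and the components one at a time: functor laws and naturality of the inverse follow from those of
  \<open>m\<close> by cancellation.\<close>

lemma is_diag_isoI:
  fixes Q :: "('j, 'l, 'i, 'k) ftr"
  assumes m: "is_diag_mor C X Y m" and Y: "is_functor (shape Y) C (dgm Y)"
    and Q_ob: "\<And>y. y \<in> ob (shape Y) \<Longrightarrow> omap Q y \<in> ob (shape X)"
    and Q_hom: "\<And>f y y'. f \<in> hom (shape Y) y y' \<Longrightarrow> amap Q f \<in> hom (shape X) (omap Q y) (omap Q y')"
    and RQ: "\<And>y. y \<in> ob (shape Y) \<Longrightarrow> omap (fun_part m) (omap Q y) = y"
      "\<And>f. f \<in> ar (shape Y) \<Longrightarrow> amap (fun_part m) (amap Q f) = f"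
    and QR: "\<And>x. x \<in> ob (shape X) \<Longrightarrow> omap Q (omap (fun_part m) x) = x"
      "\<And>f. f \<in> ar (shape X) \<Longrightarrow> amap Q (amap (fun_part m) f) = f"
    and g: "\<And>x. x \<in> ob (shape X) \<Longrightarrow> g x \<in> hom C (omap (dgm Y) (omap (fun_part m) x)) (omap (dgm X) x)"
      "\<And>x. x \<in> ob (shape X) \<Longrightarrow> cmp C (g x) (nat_part m x) = idt C (omap (dgm X) x)"
      "\<And>x. x \<in> ob (shape X) \<Longrightarrow> cmp C (nat_part m x) (g x) = idt C (omap (dgm Y) (omap (fun_part m) x))"
  shows "is_diag_iso C X Y m"
proof -
  note M = is_diag_morD[OF m]
  interpret C: category C by (rule is_functorD(2)[OF Y])
  interpret X: category "shape X" by (rule is_functorD(1)[OF M(2)])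
  interpret Y: category "shape Y" by (rule is_functorD(1)[OF Y])
  let ?R = "fun_part m"
  let ?n = "\<lparr>fun_part = Q, nat_part = (\<lambda>y. g (omap Q y))\<rparr>"
  have Q: "is_functor (shape Y) (shape X) Q"
  proof (rule is_functorI[OF Y.category_axioms X.category_axioms Q_ob Q_hom])
    fix y assume y: "y \<in> ob (shape Y)"
    have "amap ?R (idt (shape X) (omap Q y)) = idt (shape Y) y"
      using is_functorD(5)[OF M(1) Q_ob[OF y]] RQ(1)[OF y] by simp
    then show "amap Q (idt (shape Y) y) = idt (shape X) (omap Q y)"
      using QR(2)[OF X.idt_ar(1)[OF Q_ob[OF y]]] by simp
  next
    fix f f' y y' y'' assume f: "f \<in> hom (shape Y) y y'" and f': "f' \<in> hom (shape Y) y' y''"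
    have "amap ?R (cmp (shape X) (amap Q f') (amap Q f)) = cmp (shape Y) f' f"
      using is_functorD(6)[OF M(1) Q_hom[OF f] Q_hom[OF f']] RQ(2)[OF homD(1)[OF f]] RQ(2)[OF homD(1)[OF f']]
      by simp
    then show "amap Q (cmp (shape Y) f' f) = cmp (shape X) (amap Q f') (amap Q f)"
      using QR(2)[OF homD(1)[OF X.cmp_in_hom[OF Q_hom[OF f] Q_hom[OF f']]]] by simp
  qed
  have "is_diag_mor C Y X ?n"
  proof (rule is_diag_morI[OF _ Y M(2)])
    show "is_functor (shape Y) (shape X) (fun_part ?n)" using Q by simp
    show "nat_part ?n y \<in> hom C (omap (dgm Y) y) (omap (dgm X) (omap (fun_part ?n) y))"
      if "y \<in> ob (shape Y)" for y
      using g(1)[OF Q_ob[OF that]] RQ(1)[OF that] by simp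
    fix f y y' assume f: "f \<in> hom (shape Y) y y'"
    note y = Y.hom_ob[OF f]
    note Qf = Q_hom[OF f] and Rf = RQ(2)[OF homD(1)[OF f]]
    have gy: "g (omap Q y) \<in> hom C (omap (dgm Y) y) (omap (dgm X) (omap Q y))"
      and gy': "g (omap Q y') \<in> hom C (omap (dgm Y) y') (omap (dgm X) (omap Q y'))"
      and my: "nat_part m (omap Q y) \<in> hom C (omap (dgm X) (omap Q y)) (omap (dgm Y) y)"
      and my': "nat_part m (omap Q y') \<in> hom C (omap (dgm X) (omap Q y')) (omap (dgm Y) y')"
      using g(1)[OF Q_ob] M(3)[OF Q_ob] RQ(1) y by metis+
    note XQ = is_functorD(4)[OF M(2) Qf] and Yf = is_functorD(4)[OF Y f]
    \<comment> \<open>Insert the identity \<open>m g\<close> on the right, use naturality of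
      \<open>m\<close> at \<open>amap Q f\<close>, and cancel \<open>g m\<close> on the
      left.\<close>
    have "cmp C (g (omap Q y')) (amap (dgm Y) f) =
       cmp C (cmp C (g (omap Q y')) (amap (dgm Y) f)) (cmp C (nat_part m (omap Q y)) (g (omap Q y)))"
      using C.idt_right[OF C.cmp_in_hom[OF Yf gy']] g(3)[OF Q_ob[OF y(1)]] RQ(1)[OF y(1)] by simp
    also have "\<dots> = cmp C (g (omap Q y')) (cmp C (cmp C (amap (dgm Y) f) (nat_part m (omap Q y))) (g (omap Q y)))"
      using C.assoc[OF C.cmp_in_hom[OF gy my] Yf gy'] C.assoc[OF gy my Yf] by simp
    also have "\<dots> = cmp C (g (omap Q y')) (cmp C (cmp C (nat_part m (omap Q y')) (amap (dgm X) (amap Q f))) (g (omap Q y)))"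
      using M(4)[OF Qf] Rf by simp
    also have "\<dots> = cmp C (cmp C (g (omap Q y')) (nat_part m (omap Q y'))) (cmp C (amap (dgm X) (amap Q f)) (g (omap Q y)))"
      using C.assoc[OF gy XQ my'] C.assoc[OF C.cmp_in_hom[OF gy XQ] my' gy'] by simp
    also have "\<dots> = cmp C (amap (dgm X) (amap Q f)) (g (omap Q y))"
      using g(2)[OF Q_ob[OF y(2)]] C.idt_left[OF C.cmp_in_hom[OF gy XQ]] by simp
    finally show "cmp C (nat_part ?n y') (amap (dgm Y) f) =
        cmp C (amap (dgm X) (amap (fun_part ?n) f)) (nat_part ?n y)"
      by simp
  qed
  moreover have "mor_eq X (comp_mor C ?n m) (id_mor C X)"
    using QR g(2) by (simp add: mor_eq_iff)
  moreover have "mor_eq Y (comp_mor C m ?n) (id_mor C Y)"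
    using RQ g(3)[OF Q_ob] by (simp add: mor_eq_iff)
  ultimately show ?thesis
    using m unfolding is_diag_iso_def by blast
qed

section \<open>Transport between fibres and the double diagram it defines\<close>

locale kan_opfib = opfib_cocone C D D' F s l
  for C :: "('o, 'a) cat" and D D' :: "('u, 'u, 'o, 'a) diagram" and F s l +
  fixes c :: "('u, 'o, 'a) colimits"
  assumes c: "colimit_choice C c"
    and small_D: "small_diagram C D" and small_D': "small_diagram C D'"
    and colimit_l: "k \<in> ob (shape D') \<Longrightarrow> is_colimit C (fibre_dgm D (shape D') F k) (omap (dgm D') k) l"
begin

abbreviation J where "J \<equiv> shape D"
abbreviation K where "K \<equiv> shape D'"
abbreviation Fib where "Fib \<equiv> fibre J K F"

lemma category_Fib: "k \<in> ob K \<Longrightarrow> category (Fib k)"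
  by (rule category_fibre[OF functor_F])

lemma functor_Fib: "k \<in> ob K \<Longrightarrow> is_functor (Fib k) C (dgm D)"
  by (rule functor_fibre_dgm[OF functor_F functor_D])

lemma Fib_hom_ob:
  assumes "k \<in> ob K" "f \<in> hom J j j'" "amap F f = idt K k"
  shows "j \<in> ob J" "omap F j = k" "j' \<in> ob J" "omap F j' = k"
  using category.hom_ob[OF category_Fib[OF assms(1)], of f j j'] assms(2,3) by simp_all

text \<open>The arrow part of transport along \<open>u\<close>. For \<open>f\<close> in the fibre
  over the source of \<open>u\<close> the description is proper because the chosen lift at the
  source of \<open>f\<close> is opcartesian.\<close>

definition push_ar where
  "push_ar u f = (THE h. h \<in> hom J (push u (src J f)) (push u (tgt J f)) \<and> amap F h = idt K (tgt K u) \<and>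
     cmp J h (s (src J f, u)) = cmp J (s (tgt J f, u)) f)"

context
  fixes k k' u j assumes u: "u \<in> hom K k k'" and j: "j \<in> ob J" "omap F j = k"
begin

lemma u_F: "u \<in> hom K (omap F j) k'"
  using u j(2) by simp

lemma pushes: "push u j \<in> ob J" "omap F (push u j) = k'" "s (j, u) \<in> hom J j (push u j)" "amap F (s (j, u)) = u"
  using push_ob[OF j(1) u_F] F_push[OF j(1) u_F] s_hom[OF j(1) u_F] s_props(2)[OF j(1) u_F] by simp_all

lemma push_unique:
  "h \<in> hom J (push u j) j' \<Longrightarrow> h' \<in> hom J (push u j) j' \<Longrightarrow> amap F h = amap F h' \<Longrightarrow>
    cmp J h (s (j, u)) = cmp J h' (s (j, u)) \<Longrightarrow> h = h'"
  by (rule s_factor_unique[OF j(1) u_F])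

end

context
  fixes k k' u f j j' assumes u: "u \<in> hom K k k'" and f: "f \<in> hom J j j'" "amap F f = idt K k"
begin

lemma push_ar: "push_ar u f \<in> hom J (push u j) (push u j')" "amap F (push_ar u f) = idt K k'"
  "cmp J (push_ar u f) (s (j, u)) = cmp J (s (j', u)) f"
proof -
  note k = K.hom_ob[OF u]
  note ob = Fib_hom_ob[OF k(1) f]
  note p' = pushes[OF u ob(3,4)]
  have w: "idt K k' \<in> hom K k' (omap F (push u j'))"
    using K.idt_hom[OF k(2)] p'(2) by simp
  have "\<exists>!h. h \<in> hom J (push u j) (push u j') \<and> amap F h = idt K k' \<and> cmp J h (s (j, u)) = cmp J (s (j', u)) f"
    by (rule s_factor[OF ob(1) u_F[OF u ob(1,2)] J.cmp_in_hom[OF f(1) p'(3)] w])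
      (use is_functorD(6)[OF functor_F f(1) p'(3)] p'(4) f(2) K.idt_right[OF u] K.idt_left[OF u] in simp)
  from theI'[OF this] show "push_ar u f \<in> hom J (push u j) (push u j')" "amap F (push_ar u f) = idt K k'"
    "cmp J (push_ar u f) (s (j, u)) = cmp J (s (j', u)) f"
    by (simp_all add: push_ar_def homD[OF f(1)] homD[OF u])
qed

lemma push_ar_eqI:
  assumes "h \<in> hom J (push u j) (push u j')" "amap F h = idt K k'" "cmp J h (s (j, u)) = cmp J (s (j', u)) f"
  shows "push_ar u f = h"
  using push_unique[OF u Fib_hom_ob(1,2)[OF K.hom_ob(1)[OF u] f] push_ar(1) assms(1)] push_ar(2,3) assms(2,3)
  by simp

end

definition push_mor where
  "push_mor u = \<lparr>fun_part = \<lparr>omap = push u, amap = push_ar u\<rparr>, nat_part = (\<lambda>j. amap (dgm D) (s (j, u)))\<rparr>"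

lemma push_mor_simps [simp]:
  "omap (fun_part (push_mor u)) = push u" "amap (fun_part (push_mor u)) = push_ar u"
  "nat_part (push_mor u) j = amap (dgm D) (s (j, u))"
  by (simp_all add: push_mor_def)

text \<open>Functoriality is uniqueness of opcartesian factorisations, through
  \<open>push_ar_eqI\<close>. The square defining \<open>push_ar\<close>, mapped to \<open>C\<close>
  by \<open>D\<close>, is naturality of the components.\<close>

lemma push_mor:
  assumes u: "u \<in> hom K k k'"
  shows "is_diag_mor C (Fib_dgm k) (Fib_dgm k') (push_mor u)"
proof (rule is_diag_morI, unfold fibre_dgm_simps push_mor_simps)
  note k = K.hom_ob[OF u]
  show "is_functor (Fib k) C (dgm D)" "is_functor (Fib k') C (dgm D)"
    by (rule functor_Fib[OF k(1)], rule functor_Fib[OF k(2)])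
  show "is_functor (Fib k) (Fib k') (fun_part (push_mor u))"
  proof (rule is_functorI[OF category_Fib[OF k(1)] category_Fib[OF k(2)]], unfold push_mor_simps)
    fix j assume "j \<in> ob (Fib k)"
    then have j: "j \<in> ob J" "omap F j = k" by simp_all
    note p = pushes[OF u j]
    show "push u j \<in> ob (Fib k')" using p by simp
    have id: "amap F (idt J j) = idt K k" "amap F (idt J (push u j)) = idt K k'"
      using is_functorD(5)[OF functor_F j(1)] is_functorD(5)[OF functor_F p(1)] j(2) p(2) by simp_all
    have "push_ar u (idt J j) = idt J (push u j)"
      by (rule push_ar_eqI[OF u J.idt_hom[OF j(1)] id(1) J.idt_hom[OF p(1)] id(2)])
        (simp add: J.idt_left[OF p(3)] J.idt_right[OF p(3)])
    then show "push_ar u (idt (Fib k) j) = idt (Fib k') (push u j)" by simp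
  next
    fix f i j assume "f \<in> hom (Fib k) i j"
    then have f: "f \<in> hom J i j" "amap F f = idt K k" by simp_all
    show "push_ar u f \<in> hom (Fib k') (push u i) (push u j)"
      using push_ar[OF u f] by simp
    fix g j' assume "g \<in> hom (Fib k) j j'"
    then have g: "g \<in> hom J j j'" "amap F g = idt K k" by simp_all
    note Pf = push_ar[OF u f] and Pg = push_ar[OF u g]
    note oi = pushes[OF u Fib_hom_ob(1,2)[OF k(1) f]] and oj = pushes[OF u Fib_hom_ob(1,2)[OF k(1) g]]
      and oj' = pushes[OF u Fib_hom_ob(3,4)[OF k(1) g]]
    have "push_ar u (cmp J g f) = cmp J (push_ar u g) (push_ar u f)"
    proof (rule push_ar_eqI[OF u J.cmp_in_hom[OF f(1) g(1)] _ J.cmp_in_hom[OF Pf(1) Pg(1)]])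
      show "amap F (cmp J g f) = idt K k"
        using is_functorD(6)[OF functor_F f(1) g(1)] f(2) g(2) K.idt_left[OF K.idt_hom[OF k(1)]] by simp
      show "amap F (cmp J (push_ar u g) (push_ar u f)) = idt K k'"
        using is_functorD(6)[OF functor_F Pf(1) Pg(1)] Pf(2) Pg(2) K.idt_left[OF K.idt_hom[OF k(2)]] by simp
      show "cmp J (cmp J (push_ar u g) (push_ar u f)) (s (i, u)) = cmp J (s (j', u)) (cmp J g f)"
        using J.assoc[OF oi(3) Pf(1) Pg(1)] Pf(3) J.assoc[OF f(1) oj(3) Pg(1)] Pg(3) J.assoc[OF f(1) g(1) oj'(3)]
        by simp
    qed
    then show "push_ar u (cmp (Fib k) g f) = cmp (Fib k') (push_ar u g) (push_ar u f)" by simp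
  qed
  show "amap (dgm D) (s (j, u)) \<in> hom C (omap (dgm D) j) (omap (dgm D) (push u j))" if "j \<in> ob (Fib k)" for j
    using is_functorD(4)[OF functor_D pushes(3)[OF u]] that by simp
  fix f i j assume "f \<in> hom (Fib k) i j"
  then have f: "f \<in> hom J i j" "amap F f = idt K k" by simp_all
  note Pf = push_ar[OF u f]
  note oi = pushes[OF u Fib_hom_ob(1,2)[OF k(1) f]] and oj = pushes[OF u Fib_hom_ob(3,4)[OF k(1) f]]
  show "cmp C (amap (dgm D) (s (j, u))) (amap (dgm D) f) =
      cmp C (amap (dgm D) (push_ar u f)) (amap (dgm D) (s (i, u)))"
    using is_functorD(6)[OF functor_D f(1) oj(3)] is_functorD(6)[OF functor_D oi(3) Pf(1)] Pf(3) by simp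
qed

text \<open>The fibre functor of the split opfibration, each fibre equipped with \<open>D\<close> on
  it. Restriction turns \<open>push_mor u\<close> into the canonical representative required of
  arrows of \<open>diag_cat C\<close>.\<close>

definition E :: "('u, 'o, 'a) ddiagram" where
  "E = \<lparr>shape = K, dgm = \<lparr>omap = Fib_dgm,
    amap = (\<lambda>u. (Fib_dgm (src K u), restrict_mor (Fib_dgm (src K u)) (push_mor u), Fib_dgm (tgt K u)))\<rparr>\<rparr>"

lemma E_simps [simp]:
  "shape E = K" "omap (dgm E) = Fib_dgm"
  by (simp_all add: E_def)

lemma E_amap:
  "amap (dgm E) u = (Fib_dgm (src K u), restrict_mor (Fib_dgm (src K u)) (push_mor u), Fib_dgm (tgt K u))"
  by (simp_all add: E_def)

lemma small_Fib: "k \<in> ob K \<Longrightarrow> small_diagram C (Fib_dgm k)"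
proof -
  assume k: "k \<in> ob K"
  have "ob (Fib k) \<subseteq> ob J" "ar (Fib k) \<subseteq> ar J" by auto
  then have "ob (Fib k) \<prec> (UNIV :: 'u set)" "ar (Fib k) \<prec> (UNIV :: 'u set)"
    using small_D lesspoll_trans1[OF subset_imp_lepoll] unfolding small_diagram_def by blast+
  then show ?thesis
    using functor_Fib[OF k] by (simp add: small_diagram_def is_diagram_def)
qed

text \<open>Strict functoriality of \<open>E\<close> is the splitting: \<open>s_idt\<close> and
  \<open>s_cmp\<close> give it for objects and components, and \<open>push_ar_eqI\<close> extends it
  to the arrows of fibres.\<close>

lemma small_E: "small_diagram (diag_cat C) E"
proof -
  have "is_functor K (diag_cat C) (dgm E)"
  proof (rule is_functorI[OF K.category_axioms category_diag_cat[OF C.category_axioms]])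
    fix k assume k: "k \<in> ob K"
    show "omap (dgm E) k \<in> ob (diag_cat C)" using small_Fib[OF k] by simp
    note id = K.idt_hom[OF k]
    have "mor_eq (Fib_dgm k) (push_mor (idt K k)) (id_mor C (Fib_dgm k))"
      unfolding mor_eq_iff
    proof (intro conjI ballI)
      fix j assume "j \<in> ob (shape (Fib_dgm k))"
      then have j: "j \<in> ob J" "omap F j = k" by simp_all
      show "omap (fun_part (push_mor (idt K k))) j = omap (fun_part (id_mor C (Fib_dgm k))) j"
        using push_idt[OF j(1)] j(2) by simp
      show "nat_part (push_mor (idt K k)) j = nat_part (id_mor C (Fib_dgm k)) j"
        using s_idt[OF j(1)] j(2) is_functorD(5)[OF functor_D j(1)] by simp
    next
      fix f assume "f \<in> ar (shape (Fib_dgm k))"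
      then have f: "f \<in> hom J (src J f) (tgt J f)" "amap F f = idt K k" by (simp_all add: hom_def)
      note ob = Fib_hom_ob[OF k f]
      have p: "push (idt K k) (src J f) = src J f" "push (idt K k) (tgt J f) = tgt J f"
        using push_idt[OF ob(1)] push_idt[OF ob(3)] ob(2,4) by simp_all
      have s: "s (src J f, idt K k) = idt J (src J f)" "s (tgt J f, idt K k) = idt J (tgt J f)"
        using s_idt[OF ob(1)] s_idt[OF ob(3)] ob(2,4) by simp_all
      have "push_ar (idt K k) f = f"
        by (rule push_ar_eqI[OF id f]) (use f p s J.idt_right[OF f(1)] J.idt_left[OF f(1)] in simp_all)
      then show "amap (fun_part (push_mor (idt K k))) f = amap (fun_part (id_mor C (Fib_dgm k))) f" by simp
    qed
    then show "amap (dgm E) (idt K k) = idt (diag_cat C) (omap (dgm E) k)"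
      using homD[OF id] by (simp add: mor_eq_def E_amap)
  next
    fix u k k' assume u: "u \<in> hom K k k'"
    note k = K.hom_ob[OF u]
    show "amap (dgm E) u \<in> hom (diag_cat C) (omap (dgm E) k) (omap (dgm E) k')"
      using small_Fib[OF k(1)] small_Fib[OF k(2)] functor_Fib[OF k(2)] homD[OF u]
      by (simp add: E_amap diag_cat_hom restrict_mor_idem is_diag_mor_restrict[OF push_mor[OF u]])
    fix v k'' assume v: "v \<in> hom K k' k''"
    note vu = K.cmp_in_hom[OF u v]
    let ?M = "comp_mor C (restrict_mor (Fib_dgm k') (push_mor v)) (restrict_mor (Fib_dgm k) (push_mor u))"
    have "mor_eq (Fib_dgm k) (push_mor (cmp K v u)) ?M"
      unfolding mor_eq_iff
    proof (intro conjI ballI)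
      fix j assume "j \<in> ob (shape (Fib_dgm k))"
      then have j: "j \<in> ob (Fib k)" "j \<in> ob J" "omap F j = k" by simp_all
      note uF = u_F[OF u j(2,3)]
      note p = pushes[OF u j(2,3)]
      note q = pushes[OF v p(1,2)]
      have Pj: "push u j \<in> ob (Fib k')" using p by simp
      show "omap (fun_part (push_mor (cmp K v u))) j = omap (fun_part ?M) j"
        using push_cmp[OF j(2) uF v] j Pj by (simp add: restrict_mor_simps del: fibre_simps)
      show "nat_part (push_mor (cmp K v u)) j = nat_part ?M j"
        using s_cmp[OF j(2) uF v] is_functorD(6)[OF functor_D p(3) q(3)] j Pj
        by (simp add: restrict_mor_simps del: fibre_simps)
    next
      fix f assume "f \<in> ar (shape (Fib_dgm k))"
      then have f: "f \<in> ar (Fib k)" "f \<in> hom J (src J f) (tgt J f)" "amap F f = idt K k" by (simp_all add: hom_def)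
      let ?i = "src J f" and ?j = "tgt J f"
      note ob = Fib_hom_ob[OF k(1) f(2,3)]
      note ui = u_F[OF u ob(1,2)] and uj = u_F[OF u ob(3,4)]
      note pi = pushes[OF u ob(1,2)] and pj = pushes[OF u ob(3,4)]
      note qi = pushes[OF v pi(1,2)] and qj = pushes[OF v pj(1,2)]
      note Pf = push_ar[OF u f(2,3)]
      note Qf = push_ar[OF v Pf(1,2)]
      have Pf': "push_ar u f \<in> ar (Fib k')" using Pf homD(1) by simp
      \<comment> \<open>The transport squares of \<open>u\<close> and \<open>v\<close> are pasted,
        and splitness identifies the composite lifts with the lifts of
        \<open>cmp K v u\<close>.\<close>
      have "push_ar (cmp K v u) f = push_ar v (push_ar u f)"
      proof (rule push_ar_eqI[OF vu f(2,3)])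
        show "push_ar v (push_ar u f) \<in> hom J (push (cmp K v u) ?i) (push (cmp K v u) ?j)"
          using Qf(1) push_cmp[OF ob(1) ui v] push_cmp[OF ob(3) uj v] by simp
        show "amap F (push_ar v (push_ar u f)) = idt K k''" by (rule Qf(2))
        have "cmp J (push_ar v (push_ar u f)) (s (?i, cmp K v u)) =
            cmp J (cmp J (push_ar v (push_ar u f)) (s (push u ?i, v))) (s (?i, u))"
          unfolding s_cmp[OF ob(1) ui v] by (rule J.assoc[OF pi(3) qi(3) Qf(1)])
        also have "\<dots> = cmp J (s (push u ?j, v)) (cmp J (push_ar u f) (s (?i, u)))"
          unfolding Qf(3) by (rule J.assoc[OF pi(3) Pf(1) qj(3), symmetric])
        also have "\<dots> = cmp J (s (?j, cmp K v u)) f"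
          unfolding Pf(3) s_cmp[OF ob(3) uj v] by (rule J.assoc[OF f(2) pj(3) qj(3)])
        finally show "cmp J (push_ar v (push_ar u f)) (s (?i, cmp K v u)) = cmp J (s (?j, cmp K v u)) f" .
      qed
      then show "amap (fun_part (push_mor (cmp K v u))) f = amap (fun_part ?M) f"
        using f Pf' by (simp add: restrict_mor_simps del: fibre_simps)
    qed
    then show "amap (dgm E) (cmp K v u) = cmp (diag_cat C) (amap (dgm E) v) (amap (dgm E) u)"
      using homD[OF u] homD[OF v] homD[OF vu] by (simp add: mor_eq_def E_amap)
  qed
  then show ?thesis
    using small_D' by (simp add: small_diagram_def is_diagram_def)
qed

sublocale X: double_diagram C E
  by unfold_locales (rule small_E)

context
  fixes u k k' assumes u: "u \<in> hom K k k'"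
begin

lemma E0_push: "j \<in> ob J \<Longrightarrow> omap F j = k \<Longrightarrow> omap (E0_ar E u) j = push u j"
  and E0_push_ar: "f \<in> ar J \<Longrightarrow> amap F f = idt K k \<Longrightarrow> amap (E0_ar E u) f = push_ar u f"
  and E1_push: "j \<in> ob J \<Longrightarrow> omap F j = k \<Longrightarrow> E1_ar E u j = amap (dgm D) (s (j, u))"
  using homD[OF u] by (simp_all add: E_amap restrict_mor_simps)

end

lemma X_G_homE:
  assumes "a \<in> hom X.G p q"
  obtains k j u f k' j' where "a = ((k, j), (u, f), (k', j'))" "p = (k, j)" "q = (k', j')" "u \<in> hom K k k'"
    "j \<in> ob J" "omap F j = k" "f \<in> hom J (push u j) j'" "amap F f = idt K k'" "j' \<in> ob J" "omap F j' = k'"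
proof -
  obtain k j u f k' j' where a: "a = ((k, j), (u, f), (k', j'))" "p = (k, j)" "q = (k', j')"
    "u \<in> hom X.I k k'" "j \<in> ob (E0_ob E k)" "f \<in> hom (E0_ob E k') (omap (E0_ar E u) j) j'"
    using assms by (rule X.G_homE)
  have u: "u \<in> hom K k k'" and j: "j \<in> ob J" "omap F j = k"
    using a(4,5) by simp_all
  have f: "f \<in> hom J (push u j) j'" "amap F f = idt K k'"
    using a(6) E0_push[OF u j] by simp_all
  show ?thesis
    using that[OF a(1,2,3) u j f] Fib_hom_ob(3,4)[OF K.hom_ob(2)[OF u] f] by blast
qed

text \<open>An arrow \<open>(u, f)\<close> goes to the vertical \<open>f\<close> after the lift of
  \<open>u\<close>, the arrow of \<open>J\<close> that it encodes. The components are identities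
  because each diagram of \<open>E\<close> is \<open>D\<close> on a fibre.\<close>

definition \<phi> where
  "\<phi> = \<lparr>fun_part = \<lparr>omap = snd, amap = (\<lambda>((k, j), (u, f), q). cmp J f (s (j, u)))\<rparr>,
     nat_part = (\<lambda>(k, j). idt C (omap (dgm D) j))\<rparr>"

lemma \<phi>_simps [simp]:
  "omap (fun_part \<phi>) (k, j) = j" "amap (fun_part \<phi>) ((k, j), (u, f), q) = cmp J f (s (j, u))"
  "nat_part \<phi> (k, j) = idt C (omap (dgm D) j)"
  by (simp_all add: \<phi>_def)

lemma mult_E_ar:
  assumes "u \<in> hom K k k'" "j \<in> ob J" "omap F j = k"
  shows "amap (dgm (mult C E)) ((k, j), (u, f), (k', j')) = cmp C (amap (dgm D) f) (amap (dgm D) (s (j, u)))"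
  using E1_push[OF assms] by simp

lemma \<phi>: "is_diag_mor C (mult C E) D \<phi>"
proof (rule is_diag_morI)
  show "is_functor (shape (mult C E)) C (dgm (mult C E))" using X.functor_mult by simp
  show "is_functor J C (dgm D)" by (rule functor_D)
  show "is_functor (shape (mult C E)) J (fun_part \<phi>)"
    unfolding X.mult_simps
  proof (rule is_functorI[OF X.category_G J.category_axioms])
    fix p assume p: "p \<in> ob X.G"
    obtain k j where e: "p = (k, j)" by (cases p)
    have kj: "k \<in> ob K" "j \<in> ob J" "omap F j = k" using p by (simp_all add: e)
    show "omap (fun_part \<phi>) p \<in> ob J" using kj by (simp add: e)
    show "amap (fun_part \<phi>) (idt X.G p) = idt J (omap (fun_part \<phi>) p)"
      using s_idt[OF kj(2)] kj(3) J.idt_left[OF J.idt_hom[OF kj(2)]] by (simp add: e)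
  next
    fix a p q assume "a \<in> hom X.G p q"
    then obtain k j u f k' j' where a: "a = ((k, j), (u, f), (k', j'))" "p = (k, j)" "q = (k', j')"
      "u \<in> hom K k k'" "j \<in> ob J" "omap F j = k" "f \<in> hom J (push u j) j'" "amap F f = idt K k'"
      "j' \<in> ob J" "omap F j' = k'"
      by (rule X_G_homE)
    note sh = pushes(3)[OF a(4,5,6)]
    show "amap (fun_part \<phi>) a \<in> hom J (omap (fun_part \<phi>) p) (omap (fun_part \<phi>) q)"
      using J.cmp_in_hom[OF sh a(7)] by (simp add: a(1-3))
    fix b r assume "b \<in> hom X.G q r"
    then obtain v g k'' j'' where b: "b = ((k', j'), (v, g), (k'', j''))" "r = (k'', j'')" "v \<in> hom K k' k''"
      "g \<in> hom J (push v j') j''" "amap F g = idt K k''"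
      by (rule X_G_homE) (simp add: a(3))
    note p = pushes(1,2)[OF a(4,5,6)]
    note s1 = pushes(3)[OF b(3) p] and s2 = pushes(3)[OF b(3) a(9,10)]
    note Pf = push_ar[OF b(3) a(7,8)]
    \<comment> \<open>Composition in the Grothendieck construction first transports \<open>f\<close>
      along \<open>v\<close>; the square defining \<open>push_ar\<close> exchanges this with the
      lift of \<open>v\<close>.\<close>
    have "cmp J (cmp J g (push_ar v f)) (s (j, cmp K v u)) = cmp J g (cmp J (cmp J (push_ar v f) (s (push u j, v))) (s (j, u)))"
      unfolding s_cmp[OF a(5) u_F[OF a(4,5,6)] b(3)]
      using J.assoc[OF J.cmp_in_hom[OF sh s1] Pf(1) b(4)] J.assoc[OF sh s1 Pf(1)] by simp
    also have "\<dots> = cmp J (cmp J g (s (j', v))) (cmp J f (s (j, u)))"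
      unfolding Pf(3) using J.assoc[OF sh a(7) s2] J.assoc[OF J.cmp_in_hom[OF sh a(7)] s2 b(4)] by simp
    finally show "amap (fun_part \<phi>) (cmp X.G b a) = cmp J (amap (fun_part \<phi>) b) (amap (fun_part \<phi>) a)"
      using E0_push_ar[OF b(3) homD(1)[OF a(7)] a(8)] by (simp add: a(1) b(1))
  qed
  show "nat_part \<phi> p \<in> hom C (omap (dgm (mult C E)) p) (omap (dgm D) (omap (fun_part \<phi>) p))"
    if "p \<in> ob (shape (mult C E))" for p
    using that C.idt_hom is_functorD(3)[OF functor_D] by (cases p) simp
  fix a p q assume "a \<in> hom (shape (mult C E)) p q"
  then obtain k j u f k' j' where a: "a = ((k, j), (u, f), (k', j'))" "p = (k, j)" "q = (k', j')"
    "u \<in> hom K k k'" "j \<in> ob J" "omap F j = k" "f \<in> hom J (push u j) j'" "amap F f = idt K k'"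
    "j' \<in> ob J" "omap F j' = k'"
    unfolding X.mult_simps by (rule X_G_homE)
  note sh = pushes(3)[OF a(4,5,6)]
  note Dfs = is_functorD(4)[OF functor_D J.cmp_in_hom[OF sh a(7)]]
  show "cmp C (nat_part \<phi> q) (amap (dgm (mult C E)) a) = cmp C (amap (dgm D) (amap (fun_part \<phi>) a)) (nat_part \<phi> p)"
    unfolding a(1-3) mult_E_ar[OF a(4,5,6)] \<phi>_simps is_functorD(6)[OF functor_D sh a(7), symmetric]
      C.idt_left[OF Dfs] C.idt_right[OF Dfs] by (rule refl)
qed

text \<open>Each arrow \<open>g\<close> of \<open>J\<close> factors uniquely as an arrow over an
  identity after the chosen lift of \<open>amap F g\<close>. Recording \<open>amap F g\<close> and
  that factor inverts the recomposition.\<close>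

lemma \<phi>_iso: "is_diag_iso C (mult C E) D \<phi>"
proof -
  \<comment> \<open>The vertical factor of \<open>g\<close>, unique since the chosen lift is
    opcartesian.\<close>
  define vp where "vp g = (THE h. h \<in> hom J (push (amap F g) (src J g)) (tgt J g) \<and>
      amap F h = idt K (omap F (tgt J g)) \<and> cmp J h (s (src J g, amap F g)) = g)" for g
  have vp: "vp g \<in> hom J (push (amap F g) j) j'" "amap F (vp g) = idt K (omap F j')"
    "cmp J (vp g) (s (j, amap F g)) = g" if g: "g \<in> hom J j j'" for g j j'
  proof -
    note Fg = is_functorD(4)[OF functor_F g] and j = J.hom_ob[OF g]
    have "\<exists>!h. h \<in> hom J (push (amap F g) j) j' \<and> amap F h = idt K (omap F j') \<and> cmp J h (s (j, amap F g)) = g"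
      by (rule s_factor[OF j(1) Fg g K.idt_hom[OF K.hom_ob(2)[OF Fg]]]) (simp add: K.idt_left[OF Fg])
    from theI'[OF this] show "vp g \<in> hom J (push (amap F g) j) j'" "amap F (vp g) = idt K (omap F j')"
      "cmp J (vp g) (s (j, amap F g)) = g"
      by (simp_all add: vp_def homD[OF g])
  qed
  define Q where "Q = \<lparr>omap = (\<lambda>j. (omap F j, j)), amap = (\<lambda>g. ((omap F (src J g), src J g),
      (amap F g, vp g), (omap F (tgt J g), tgt J g)))\<rparr>"
  have Q_simps: "omap Q j = (omap F j, j)"
    "amap Q g = ((omap F (src J g), src J g), (amap F g, vp g), (omap F (tgt J g), tgt J g))" for j g
    by (simp_all add: Q_def)
  show ?thesis
  proof (rule is_diag_isoI[OF \<phi> functor_D, of Q "nat_part \<phi>"])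
    show "omap Q j \<in> ob (shape (mult C E))" if "j \<in> ob J" for j
      using that is_functorD(3)[OF functor_F that] by (simp add: Q_simps)
    show "omap (fun_part \<phi>) (omap Q j) = j" for j by (simp add: Q_simps)
    show "omap Q (omap (fun_part \<phi>) p) = p" if "p \<in> ob (shape (mult C E))" for p
      using that by (cases p) (simp add: Q_simps)
    show "amap (fun_part \<phi>) (amap Q g) = g" if "g \<in> ar J" for g
      using vp(3)[of g "src J g" "tgt J g"] that by (simp add: Q_simps hom_def)
    show "amap Q g \<in> hom (shape (mult C E)) (omap Q j) (omap Q j')" if g: "g \<in> hom J j j'" for g j j'
    proof -
      note Fg = is_functorD(4)[OF functor_F g] and j = J.hom_ob[OF g]
      show ?thesis
        unfolding X.mult_simps Q_simps homD(2,3)[OF g] X.G_hom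
        using Fg vp[OF g] j E0_push[OF Fg j(1) refl] by simp
    qed
    show "amap Q (amap (fun_part \<phi>) a) = a" if "a \<in> ar (shape (mult C E))" for a
    proof -
      have "a \<in> hom X.G (src X.G a) (tgt X.G a)" using that by (simp add: hom_def)
      then obtain k j u f k' j' where a: "a = ((k, j), (u, f), (k', j'))"
        "u \<in> hom K k k'" "j \<in> ob J" "omap F j = k" "f \<in> hom J (push u j) j'" "amap F f = idt K k'"
        "j' \<in> ob J" "omap F j' = k'"
        by (rule X_G_homE)
      note sh = pushes[OF a(2,3,4)]
      let ?g = "cmp J f (s (j, u))"
      note g = J.cmp_in_hom[OF sh(3) a(5)]
      have Fg: "amap F ?g = u"
        using is_functorD(6)[OF functor_F sh(3) a(5)] a(6) sh(4) K.idt_left[OF a(2)] by simp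
      have "vp ?g = f"
        using push_unique[OF a(2,3,4) vp(1)[OF g, unfolded Fg] a(5)] vp(2,3)[OF g] a(6,8) Fg by simp
      then show ?thesis
        using Fg homD[OF g] a(4,8) by (simp add: Q_simps a(1))
    qed
  next
    fix p assume "p \<in> ob (shape (mult C E))"
    then obtain k j where p: "p = (k, j)" "j \<in> ob J" by (cases p) simp
    note id = C.idt_hom[OF is_functorD(3)[OF functor_D p(2)]]
    show "nat_part \<phi> p \<in> hom C (omap (dgm D) (omap (fun_part \<phi>) p)) (omap (dgm (mult C E)) p)"
      "cmp C (nat_part \<phi> p) (nat_part \<phi> p) = idt C (omap (dgm (mult C E)) p)"
      "cmp C (nat_part \<phi> p) (nat_part \<phi> p) = idt C (omap (dgm D) (omap (fun_part \<phi>) p))"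
      using id C.idt_left[OF id] by (simp_all add: p(1))
  qed
qed

text \<open>By \<open>colimit_l\<close> both objects are colimits of \<open>D\<close> on the fibre
  over \<open>k\<close>; the component is the comparison between them.\<close>

definition \<psi> :: "('u, 'u, 'u, 'u, 'a) diag_mor" where
  "\<psi> = \<lparr>fun_part = id_ftr, nat_part = (\<lambda>k. THE h. h \<in> hom C (fst (c (Fib_dgm k))) (omap (dgm D') k) \<and>
     (\<forall>j\<in>ob (Fib k). cmp C h (snd (c (Fib_dgm k)) j) = l j))\<rparr>"

lemma colimit_c: "k \<in> ob K \<Longrightarrow> is_colimit C (Fib_dgm k) (fst (c (Fib_dgm k))) (snd (c (Fib_dgm k)))"
  by (rule colimit_choiceD[OF c small_Fib])

lemma \<psi>_nat:
  assumes k: "k \<in> ob K"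
  shows "nat_part \<psi> k \<in> hom C (fst (c (Fib_dgm k))) (omap (dgm D') k)"
    and "j \<in> ob J \<Longrightarrow> omap F j = k \<Longrightarrow> cmp C (nat_part \<psi> k) (snd (c (Fib_dgm k)) j) = l j"
  using theI'[OF is_colimitD(2)[OF colimit_c[OF k] is_colimitD(1)[OF colimit_l[OF k]]]]
  by (simp_all add: \<psi>_def)

text \<open>Naturality is tested on the chosen legs: there the colimit functor acts through the lift
  of \<open>u\<close>, and \<open>l_push\<close> replaces that lift by
  \<open>amap (dgm D') u\<close>.\<close>

lemma \<psi>: "is_diag_mor C (colim_push C c E) D' \<psi>"
proof (rule is_diag_morI)
  show "is_functor (shape (colim_push C c E)) C (dgm (colim_push C c E))"
    using X.functor_colim_push[OF c] by (simp add: colim_push_def)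
  show "is_functor K C (dgm D')" by (rule functor_D')
  show "is_functor (shape (colim_push C c E)) K (fun_part \<psi>)"
    using is_functor_id[OF K.category_axioms] by (simp add: colim_push_def \<psi>_def)
  show "nat_part \<psi> k \<in> hom C (omap (dgm (colim_push C c E)) k) (omap (dgm D') (omap (fun_part \<psi>) k))"
    if "k \<in> ob (shape (colim_push C c E))" for k
    using \<psi>_nat(1) that by (simp add: colim_push_def) (simp add: \<psi>_def)
  fix u k k' assume "u \<in> hom (shape (colim_push C c E)) k k'"
  then have u: "u \<in> hom K k k'" by (simp add: colim_push_def)
  note k = K.hom_ob[OF u]
  have r: "is_diag_mor C (Fib_dgm k) (Fib_dgm k') (restrict_mor (Fib_dgm k) (push_mor u))"
    using is_diag_mor_restrict[OF push_mor[OF u]] functor_Fib[OF k(2)] by simp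
  note colim = colim_ftr_amap[OF c small_Fib[OF k(1)] small_Fib[OF k(2)] r]
  note D'u = is_functorD(4)[OF functor_D' u]
  let ?a = "amap (colim_ftr C c) (Fib_dgm k, restrict_mor (Fib_dgm k) (push_mor u), Fib_dgm k')"
  have "cmp C (nat_part \<psi> k') ?a = cmp C (amap (dgm D') u) (nat_part \<psi> k)"
  proof (rule is_colimit_eqI[OF colimit_c[OF k(1)] C.cmp_in_hom[OF colim(1) \<psi>_nat(1)[OF k(2)]]
        C.cmp_in_hom[OF \<psi>_nat(1)[OF k(1)] D'u]])
    fix j assume j': "j \<in> ob (shape (Fib_dgm k))"
    then have j: "j \<in> ob J" "omap F j = k" by simp_all
    note p = pushes[OF u j]
    note kj = is_coconeD(3)[OF is_colimitD(1)[OF colimit_c[OF k(1)]] j', unfolded fibre_dgm_simps]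
    have kp: "snd (c (Fib_dgm k')) (push u j) \<in> hom C (omap (dgm D) (push u j)) (fst (c (Fib_dgm k')))"
      using is_coconeD(3)[OF is_colimitD(1)[OF colimit_c[OF k(2)]]] p by simp
    have "cmp C (cmp C (nat_part \<psi> k') ?a) (snd (c (Fib_dgm k)) j) =
        cmp C (nat_part \<psi> k') (cmp C (snd (c (Fib_dgm k')) (push u j)) (amap (dgm D) (s (j, u))))"
      using C.assoc[OF kj colim(1) \<psi>_nat(1)[OF k(2)]] colim(2)[OF j'] j by (simp add: restrict_mor_simps)
    also have "\<dots> = cmp C (l (push u j)) (amap (dgm D) (s (j, u)))"
      using C.assoc[OF is_functorD(4)[OF functor_D p(3)] kp \<psi>_nat(1)[OF k(2)]] \<psi>_nat(2)[OF k(2) p(1,2)] by simp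
    also have "\<dots> = cmp C (amap (dgm D') u) (l j)"
      by (rule l_push[OF j(1) u_F[OF u j]])
    also have "\<dots> = cmp C (cmp C (amap (dgm D') u) (nat_part \<psi> k)) (snd (c (Fib_dgm k)) j)"
      using C.assoc[OF kj \<psi>_nat(1)[OF k(1)] D'u] \<psi>_nat(2)[OF k(1) j] by simp
    finally show "cmp C (cmp C (nat_part \<psi> k') ?a) (snd (c (Fib_dgm k)) j) =
        cmp C (cmp C (amap (dgm D') u) (nat_part \<psi> k)) (snd (c (Fib_dgm k)) j)" .
  qed
  then show "cmp C (nat_part \<psi> k') (amap (dgm (colim_push C c E)) u) =
      cmp C (amap (dgm D') (amap (fun_part \<psi>) u)) (nat_part \<psi> k)"
    using homD[OF u] by (simp add: colim_push_def E_amap) (simp add: \<psi>_def)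
qed

text \<open>Two colimits of one diagram: the inverse components are the comparison arrows in the
  other direction.\<close>

lemma \<psi>_iso: "is_diag_iso C (colim_push C c E) D' \<psi>"
proof -
  have shape: "shape (colim_push C c E) = K" and omap: "omap (dgm (colim_push C c E)) k = fst (c (Fib_dgm k))"
    and fun_part: "fun_part \<psi> = id_ftr" for k
    by (simp_all add: colim_push_def \<psi>_def)
  have "\<exists>g. g \<in> hom C (omap (dgm D') k) (fst (c (Fib_dgm k))) \<and>
      cmp C g (nat_part \<psi> k) = idt C (fst (c (Fib_dgm k))) \<and> cmp C (nat_part \<psi> k) g = idt C (omap (dgm D') k)"
    if k: "k \<in> ob K" for k
  proof -
    note cc = colimit_c[OF k] and cl = colimit_l[OF k] and q = \<psi>_nat[OF k]
    obtain g where g: "g \<in> hom C (omap (dgm D') k) (fst (c (Fib_dgm k)))"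
      "\<And>j. j \<in> ob (shape (Fib_dgm k)) \<Longrightarrow> cmp C g (l j) = snd (c (Fib_dgm k)) j"
      by (rule is_colimit_factor[OF cl is_colimitD(1)[OF cc]]) blast
    note kj = is_coconeD(3)[OF is_colimitD(1)[OF cc]] and lj = is_coconeD(3)[OF is_colimitD(1)[OF cl]]
    have "cmp C g (nat_part \<psi> k) = idt C (fst (c (Fib_dgm k)))"
      by (rule is_colimit_eqI[OF cc C.cmp_in_hom[OF q(1) g(1)] C.idt_hom[OF C.hom_ob(2)[OF g(1)]]])
        (use C.assoc[OF kj q(1) g(1)] g(2) q(2) C.idt_left[OF kj] in simp)
    moreover have "cmp C (nat_part \<psi> k) g = idt C (omap (dgm D') k)"
      by (rule is_colimit_eqI[OF cl C.cmp_in_hom[OF g(1) q(1)] C.idt_hom[OF C.hom_ob(1)[OF g(1)]]])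
        (use C.assoc[OF lj g(1) q(1)] g(2) q(2) C.idt_left[OF lj] in simp)
    ultimately show ?thesis using g(1) by blast
  qed
  then obtain g where g: "\<And>k. k \<in> ob K \<Longrightarrow> g k \<in> hom C (omap (dgm D') k) (fst (c (Fib_dgm k)))"
    "\<And>k. k \<in> ob K \<Longrightarrow> cmp C (g k) (nat_part \<psi> k) = idt C (fst (c (Fib_dgm k)))"
    "\<And>k. k \<in> ob K \<Longrightarrow> cmp C (nat_part \<psi> k) (g k) = idt C (omap (dgm D') k)"
    by metis
  show ?thesis
    by (rule is_diag_isoI[OF \<psi> functor_D', of id_ftr g]) (use g in \<open>simp_all add: shape omap fun_part\<close>)
qed

lemma partial_eval_E: "(E, \<phi>, \<psi>) \<in> partial_evals C c D D'"
  using small_E \<phi>_iso \<psi>_iso by (simp add: partial_evals_def)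

end

section \<open>The bijection\<close>

lemma partial_evalsE:
  assumes "category C" "colimit_choice C c" "small_diagram C D'" "(E, \<phi>, \<psi>) \<in> partial_evals C c D D'"
  obtains n m where "partial_eval C E c D D' \<phi> n \<psi> m"
proof -
  have E: "small_diagram (diag_cat C) E" and "is_diag_iso C (mult C E) D \<phi>"
    "is_diag_iso C (colim_push C c E) D' \<psi>"
    using assms(4) by (simp_all add: partial_evals_def)
  then obtain n m where nm: "is_diag_mor C (mult C E) D \<phi>" "is_diag_mor C D (mult C E) n"
    "mor_eq (mult C E) (comp_mor C n \<phi>) (id_mor C (mult C E))" "mor_eq D (comp_mor C \<phi> n) (id_mor C D)"
    "is_diag_mor C (colim_push C c E) D' \<psi>" "is_diag_mor C D' (colim_push C c E) m"
    "mor_eq (colim_push C c E) (comp_mor C m \<psi>) (id_mor C (colim_push C c E))"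
    "mor_eq D' (comp_mor C \<psi> m) (id_mor C D')"
    unfolding is_diag_iso_def by blast
  have "partial_eval C E c D D' \<phi> n \<psi> m"
    by (intro partial_eval.intro double_diagram.intro double_diagram_axioms.intro partial_eval_axioms.intro
        assms(1,2) E nm small_diagramD[OF assms(3)])
  then show ?thesis by (rule that)
qed

lemma ex1_corresponds:
  assumes "category C" "colimit_choice C c" "small_diagram C D'" "p \<in> partial_evals C c D D'"
  shows "\<exists>!k. k \<in> kan_opfibs C D D' \<and> corresponds C c p k"
proof -
  obtain E \<phi> \<psi> where p: "p = (E, \<phi>, \<psi>)" by (cases p)
  obtain n m where "partial_eval C E c D D' \<phi> n \<psi> m"
    using assms unfolding p by (rule partial_evalsE)
  then interpret partial_eval C E c D D' \<phi> n \<psi> m .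
  show ?thesis
    unfolding p
  proof (rule ex1I[of _ "(F, s, l)"])
    fix k assume k: "k \<in> kan_opfibs C D D' \<and> corresponds C c (E, \<phi>, \<psi>) k"
    obtain F' s' l' where "k = (F', s', l')" by (cases k)
    then show "k = (F, s, l)"
      using corresponds_unique[of F' s' l'] k by simp
  qed (use kan_opfib corresponds in blast)
qed

text \<open>An isomorphism of partial evaluations gives equal triples through
  \<open>peval_mor\<close>; equal triples give an isomorphism through
  \<open>peval_pair\<close>.\<close>

lemma peval_iso_iff_corresponds:
  assumes "category C" "colimit_choice C c" "small_diagram C D'"
    and p: "p \<in> partial_evals C c D D'" and p': "p' \<in> partial_evals C c D D'"
    and k: "k \<in> kan_opfibs C D D'" "corresponds C c p k"
  shows "(p, p') \<in> peval_iso C c D D' \<longleftrightarrow> corresponds C c p' k"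
proof -
  obtain E \<phi> \<psi> where e: "p = (E, \<phi>, \<psi>)" by (cases p)
  obtain E' \<phi>' \<psi>' where e': "p' = (E', \<phi>', \<psi>')" by (cases p')
  obtain n m where "partial_eval C E c D D' \<phi> n \<psi> m"
    using assms(1-3) p unfolding e by (rule partial_evalsE)
  then interpret P: partial_eval C E c D D' \<phi> n \<psi> m .
  obtain n' m' where "partial_eval C E' c D D' \<phi>' n' \<psi>' m'"
    using assms(1-3) p' unfolding e' by (rule partial_evalsE)
  then interpret P': partial_eval C E' c D D' \<phi>' n' \<psi>' m' .
  obtain F s l where Fsl: "k = (F, s, l)" by (cases k)
  have k': "k = (P.F, P.s, P.l)"
    using P.corresponds_unique[of F s l] k by (simp add: Fsl e)
  show ?thesis
  proof
    assume "(p, p') \<in> peval_iso C c D D'"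
    then obtain a where a: "a \<in> hom (diag_cat (diag_cat C)) E E'"
      "mor_eq (mult C E) (comp_mor C \<phi>' (mult_mor (mor_of a))) \<phi>"
      "mor_eq (colim_push C c E) (comp_mor C \<psi>' (colim_push_mor C c (mor_of a))) \<psi>"
      by (auto simp: peval_iso_def e e')
    have "is_diag_mor (diag_cat C) E E' (mor_of a)"
      using a(1) by (simp add: diag_cat_hom)
    then interpret M: peval_mor C E E' c D D' \<phi> n \<psi> m \<phi>' n' \<psi>' m' "mor_of a"
      using a(2,3) by unfold_locales
    have "(P'.F, P'.s, P'.l) = (P.F, P.s, P.l)"
      by (rule P.corresponds_unique[OF P'.kan_opfib M.corresponds_source])
    then show "corresponds C c p' k"
      using P'.corresponds by (simp add: e' k')
  next
    assume "corresponds C c p' k"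
    then have "(P.F, P.s, P.l) = (P'.F, P'.s, P'.l)"
      using P'.corresponds_unique[OF P.kan_opfib] by (simp add: e' k')
    then interpret M: peval_pair C E E' c D D' \<phi> n \<psi> m \<phi>' n' \<psi>' m'
      by unfold_locales simp_all
    show "(p, p') \<in> peval_iso C c D D'"
      using p p' M.is_iso_arrow M.arrow_hom M.mor_eq_arrow unfolding peval_iso_def e e' mem_Collect_eq prod.case by blast
  qed
qed

text \<open>The partial evaluation built from the fibres of \<open>F\<close> returns the given
  triple: \<phi> recomposes the canonical lift to \<open>s (j, u)\<close>, and \<psi> carries the
  chosen legs to \<open>l\<close> by construction.\<close>

lemma ex_partial_eval:
  assumes "category C" "colimit_choice C c" "small_diagram C D" "small_diagram C D'"
    and k: "k \<in> kan_opfibs C D D'"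
  shows "\<exists>p \<in> partial_evals C c D D'. corresponds C c p k"
proof -
  obtain F s l where e: "k = (F, s, l)" by (cases k)
  have split: "split_opfibration (shape D) (shape D') F s" and pw: "pointwise_left_kan C D F D' l"
    using k by (simp_all add: e kan_opfibs_def)
  interpret O: opfib_cocone C D D' F s l
    by unfold_locales (use split pw small_diagramD[OF assms(4)] in \<open>simp_all add: pointwise_left_kan_def left_kan_def\<close>)
  interpret O: kan_opfib C D D' F s l c
    by unfold_locales (use assms pw O.pointwise_left_kan_iff in auto)
  obtain n m where "partial_eval C O.E c D D' O.\<phi> n O.\<psi> m"
    using assms(1,2,4) O.partial_eval_E by (rule partial_evalsE)
  then interpret P: partial_eval C O.E c D D' O.\<phi> n O.\<psi> m .
  have \<psi>: "fun_part O.\<psi> = id_ftr" by (simp add: O.\<psi>_def)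
  have "corresponds C c (O.E, O.\<phi>, O.\<psi>) (F, s, l)"
    unfolding P.corresponds_iff \<psi>
  proof (intro conjI allI impI)
    fix x y assume "x \<in> ob O.X.I" "y \<in> ob (E0_ob O.E x)"
    then have xy: "x \<in> ob O.K" "y \<in> ob O.J" "omap F y = x" by simp_all
    show "omap F (omap P.R (x, y)) = omap id_ftr x" using xy by simp
    show "cmp C (l (omap P.R (x, y))) (nat_part O.\<phi> (x, y)) = cmp C (nat_part O.\<psi> x) (P.\<kappa> x y)"
      using O.\<psi>_nat(2)[OF xy] O.C.idt_right[OF O.l_hom[OF xy(2) refl]] by simp
  next
    fix x y i x' assume "i \<in> hom O.X.I x x'" "y \<in> ob (E0_ob O.E x)"
    then have i: "i \<in> hom O.K x x'" and y: "y \<in> ob O.J" "omap F y = x" by simp_all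
    show "s (omap P.R (x, y), amap id_ftr i) = amap P.R (O.X.lift y i)"
      using O.J.idt_left[OF O.pushes(3)[OF i y]] O.E0_push[OF i y] i
      by (simp add: O.X.lift_eq[of i x x'])
  next
    fix p i f q assume a: "(p, (i, f), q) \<in> ar O.X.G"
    then have "(p, (i, f), q) \<in> hom O.X.G p q" by (simp add: hom_def)
    then obtain x y x' y' where A: "p = (x, y)" "q = (x', y')" "i \<in> hom O.K x x'" "y \<in> ob O.J" "omap F y = x"
      "f \<in> hom O.J (O.push i y) y'" "amap F f = idt O.K x'"
      by (rule O.X_G_homE) auto
    note p = O.pushes[OF A(3,4,5)]
    show "amap F (amap P.R (p, (i, f), q)) = amap id_ftr i"
      using is_functorD(6)[OF O.functor_F p(3) A(6)] A(7) p(4) O.K.idt_left[OF A(3)] by (simp add: A(1,2))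
  qed
  then show ?thesis
    using O.partial_eval_E unfolding e by blast
qed

theorem theorem5p6:
  fixes C :: "('o, 'a) cat"
    and c :: "('u, 'o, 'a) colimits"
    and D D' :: "('u, 'u, 'o, 'a) diagram"
  assumes "cocomplete TYPE('u) C"
    and "colimit_choice C c"
    and "small_diagram C D"
    and "small_diagram C D'"
  shows "\<exists>\<Phi>. bij_betw \<Phi> (partial_evals C c D D' // peval_iso C c D D') (kan_opfibs C D D') \<and>
           (\<forall>p \<in> partial_evals C c D D'. corresponds C c p (\<Phi> (peval_iso C c D D' `` {p})))"
proof -
  have C: "category C"
    using assms(1) by (simp add: cocomplete_def)
  let ?P = "partial_evals C c D D'" and ?r = "peval_iso C c D D'"
  \<comment> \<open>The map on representatives; \<open>ex1_corresponds\<close> makes the description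
    proper.\<close>
  define kan where "kan p = (THE k. k \<in> kan_opfibs C D D' \<and> corresponds C c p k)" for p
  have kan: "kan p \<in> kan_opfibs C D D'" "corresponds C c p (kan p)" if "p \<in> ?P" for p
    using theI'[OF ex1_corresponds[OF C assms(2,4) that]] by (simp_all add: kan_def)
  have kan_eq: "kan p = k" if "p \<in> ?P" "k \<in> kan_opfibs C D D'" "corresponds C c p k" for p k
    using ex1_corresponds[OF C assms(2,4) that(1)] kan[OF that(1)] that(2,3) by blast
  \<comment> \<open>The relation is the kernel of \<open>kan\<close> on partial evaluations, so its
    classes are the nonempty fibres of \<open>kan\<close>, and injectivity on classes
    follows.\<close>
  have r: "(p, p') \<in> ?r \<longleftrightarrow> p \<in> ?P \<and> p' \<in> ?P \<and> kan p = kan p'" for p p'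
  proof (cases "p \<in> ?P \<and> p' \<in> ?P")
    case True
    then have p: "p \<in> ?P" "p' \<in> ?P" by simp_all
    show ?thesis
      using peval_iso_iff_corresponds[OF C assms(2,4) p kan[OF p(1)]] kan_eq[OF p(2) kan(1)[OF p(1)]] kan(2)[OF p(2)] p
      by auto
  qed (auto simp: peval_iso_def)
  \<comment> \<open>The common value of \<open>kan\<close> on a class.\<close>
  define \<Phi> where "\<Phi> X = (THE k. \<forall>p\<in>X. kan p = k)" for X
  have r_class: "?r `` {p} = {p' \<in> ?P. kan p' = kan p}" if "p \<in> ?P" for p
    using that by (auto simp: r)
  have \<Phi>: "\<Phi> (?r `` {p}) = kan p" if "p \<in> ?P" for p
    unfolding \<Phi>_def
  proof (rule the_equality)
    show "\<forall>p'\<in>?r `` {p}. kan p' = kan p" unfolding r_class[OF that] by blast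
    have "p \<in> ?r `` {p}" unfolding r_class[OF that] using that by blast
    then show "k = kan p" if "\<forall>p'\<in>?r `` {p}. kan p' = k" for k
      using that by (metis)
  qed
  have "bij_betw \<Phi> (?P // ?r) (kan_opfibs C D D')"
    unfolding bij_betw_def
  proof
    show "inj_on \<Phi> (?P // ?r)"
    proof (rule inj_onI, elim quotientE)
      fix X Y p q assume "\<Phi> X = \<Phi> Y" "X = ?r `` {p}" "p \<in> ?P" "Y = ?r `` {q}" "q \<in> ?P"
      then have "kan p = kan q" by (simp add: \<Phi>)
      then show "X = Y"
        using \<open>X = _\<close> \<open>Y = _\<close> \<open>p \<in> _\<close> \<open>q \<in> _\<close> by (simp add: r_class)
    qed
    show "\<Phi> ` (?P // ?r) = kan_opfibs C D D'"
    proof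
      show "\<Phi> ` (?P // ?r) \<subseteq> kan_opfibs C D D'"
        using kan(1) by (auto simp: \<Phi> elim!: quotientE)
      show "kan_opfibs C D D' \<subseteq> \<Phi> ` (?P // ?r)"
      proof
        fix k assume k: "k \<in> kan_opfibs C D D'"
        obtain p where p: "p \<in> ?P" "corresponds C c p k"
          using ex_partial_eval[OF C assms(2-4) k] by blast
        show "k \<in> \<Phi> ` (?P // ?r)"
          using \<Phi>[OF p(1)] kan_eq[OF p(1) k p(2)] quotientI[OF p(1), of ?r] by (metis imageI)
      qed
    qed
  qed
  then show ?thesis
    using \<Phi> kan(2) by (intro exI[of _ \<Phi>]) simp
qed

end
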